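(* Let $\mathcal M$ be a symplectic manifold and $\Gamma$ a symmetric symplectic connection on $\mathcal M$. Then the bracket on functions on $\mathcal T^*_\rho\mathcal M\oplus T\mathcal M$ determined by $$\{x^i,p_j\}=\delta^i_j,\quad \{y^i,y^j\}=\omega^{ij},\quad \{p_i,y^j\}=\Gamma^j_{il}y^l,\quad \{p_i,p_j\}=\tfrac12R_{mn;ij}y^my^n,\quad \{x^i,x^j\}=0,\quad \{x^i,y^j\}=0$$ is a Poisson bracket.
   Context: The symplectic form on $\mathcal M$ has components $\omega_{ij}(x)$ (closed, nondegenerate) in local coordinates $x^i$, and $\omega^{ij}\omega_{jk}=\delta^i_k$. A symmetric symplectic connection is a torsion-free connection with $\partial_i\omega_{jk}-\Gamma^l_{ij}\omega_{lk}-\Gamma^l_{ik}\omega_{jl}=0$, where $\nabla_i\partial_j=\Gamma^k_{ij}\partial_k$. Its curvature is $R^k_{l;ij}=\partial_i\Gamma^k_{jl}+\Gamma^n_{jl}\Gamma^k_{in}-\partial_j\Gamma^k_{il}-\Gamma^n_{il}\Gamma^k_{jn}$, and $R_{kl;ij}=\omega_{kn}R^n_{l;ij}$. $\mathcal M$ is covered by coordinate domains $U_\alpha$ with local symplectic potentials $\rho^\alpha=\rho^\alpha_idx^i$, $\omega_{ij}=\partial_i\rho^\alpha_j-\partial_j\rho^\alpha_i$; on overlaps $\phi^{\alpha\beta}=\rho^\alpha-\rho^\beta=\phi^{\alpha\beta}_idx^i_\alpha$ is a closed 1-form. $\mathcal T^*_\rho\mathcal M$ is the affine bundle over $\mathcal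 M$ with fibre coordinates $p^\alpha_i$ over $U_\alpha$ and transition law $p^\alpha_i=p^\beta_j\,\partial x^j_\beta/\partial x^i_\alpha+\phi^{\alpha\beta}_i$. $y^i$ are the natural fibre coordinates on $T\mathcal M$. "Functions" on $\mathcal T^*_\rho\mathcal M\oplus T\mathcal M$ are formal power series in $y$ whose coefficients are smooth in $x$ and polynomial in $p$; the bracket is extended from the coordinates as an antisymmetric biderivation. *)

theory Defs
  imports "HOL-Analysis.Analysis" "HOL-Library.Function_Algebras"
begin

section \<open>Smooth functions on open subsets of Euclidean space\<close>

definition partial :: "'n::finite \<Rightarrow> (real^'n \<Rightarrow> real) \<Rightarrow> real^'n \<Rightarrow> real" where
  "partial i f z = deriv (\<lambda>t. f (z + t *\<^sub>R axis i 1)) 0"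

text \<open>
  Only used for open \<open>S\<close>. Requiring every iterated partial derivative to be (totally)
  differentiable is the same as requiring every iterated partial derivative to exist and to be
  continuous.
\<close>

definition smooth_on :: "(real^'n::finite) set \<Rightarrow> (real^'n \<Rightarrow> real) \<Rightarrow> bool" where
  "smooth_on S f \<longleftrightarrow> (\<forall>is. (foldr partial is f) differentiable_on S)"


section \<open>Manifolds, tensors and connections in local coordinates\<close>

text \<open>
  A manifold is a second countable Hausdorff space \<open>M\<close> with a smooth atlas: coordinate domains
  \<open>U \<alpha>\<close> and coordinate maps \<open>x \<alpha>\<close>, for \<open>\<alpha> \<in> A\<close>. Geometric objects are given by their components
  in all charts of the atlas, as functions of the coordinates (so on \<open>x \<alpha> ` U \<alpha>\<close>), subject
  to the transformation laws on overlaps.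
\<close>

definition coord_change ::
    "('a \<Rightarrow> 'm set) \<Rightarrow> ('a \<Rightarrow> 'm \<Rightarrow> real^'n) \<Rightarrow> 'a \<Rightarrow> 'a \<Rightarrow> real^'n \<Rightarrow> real^'n" where
  "coord_change U x \<alpha> \<beta> z = x \<beta> (inv_into (U \<alpha>) (x \<alpha>) z)"

definition overlap ::
    "('a \<Rightarrow> 'm set) \<Rightarrow> ('a \<Rightarrow> 'm \<Rightarrow> real^'n) \<Rightarrow> 'a \<Rightarrow> 'a \<Rightarrow> (real^'n) set" where
  "overlap U x \<alpha> \<beta> = x \<alpha> ` (U \<alpha> \<inter> U \<beta>)"

text \<open>\<open>jac U x \<alpha> \<beta> j i\<close> is \<open>\<partial>x\<^sub>\<beta>\<^sup>j / \<partial>x\<^sub>\<alpha>\<^sup>i\<close>, as a function of \<open>x\<^sub>\<alpha>\<close>.\<close>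

definition jac ::
    "('a \<Rightarrow> 'm set) \<Rightarrow> ('a \<Rightarrow> 'm \<Rightarrow> real^'n::finite) \<Rightarrow> 'a \<Rightarrow> 'a \<Rightarrow> 'n \<Rightarrow> 'n \<Rightarrow> real^'n \<Rightarrow> real" where
  "jac U x \<alpha> \<beta> j i = partial i (\<lambda>z. coord_change U x \<alpha> \<beta> z $ j)"

definition smooth_manifold ::
    "'m topology \<Rightarrow> 'a set \<Rightarrow> ('a \<Rightarrow> 'm set) \<Rightarrow> ('a \<Rightarrow> 'm \<Rightarrow> real^'n::finite) \<Rightarrow> bool" where
  "smooth_manifold M A U x \<longleftrightarrow>
     Hausdorff_space M \<and> second_countable M \<and>
     (\<Union>\<alpha>\<in>A. U \<alpha>) = topspace M \<and>
     (\<forall>\<alpha>\<in>A. openin M (U \<alpha>) \<and> open (x \<alpha> ` U \<alpha>) \<and>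
        homeomorphic_map (subtopology M (U \<alpha>)) (top_of_set (x \<alpha> ` U \<alpha>)) (x \<alpha>)) \<and>
     (\<forall>\<alpha>\<in>A. \<forall>\<beta>\<in>A. \<forall>j. smooth_on (overlap U x \<alpha> \<beta>) (\<lambda>z. coord_change U x \<alpha> \<beta> z $ j))"

definition symplectic_form ::
    "'a set \<Rightarrow> ('a \<Rightarrow> 'm set) \<Rightarrow> ('a \<Rightarrow> 'm \<Rightarrow> real^'n::finite) \<Rightarrow>
     ('a \<Rightarrow> real^'n \<Rightarrow> real^'n^'n) \<Rightarrow> bool" where
  "symplectic_form A U x \<omega> \<longleftrightarrow>
     (\<forall>\<alpha>\<in>A. \<forall>i j. smooth_on (x \<alpha> ` U \<alpha>) (\<lambda>z. \<omega> \<alpha> z $ i $ j)) \<and>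
     (\<forall>\<alpha>\<in>A. \<forall>\<beta>\<in>A. \<forall>z\<in>overlap U x \<alpha> \<beta>. \<forall>i j.
        \<omega> \<alpha> z $ i $ j =
          (\<Sum>k\<in>UNIV. \<Sum>l\<in>UNIV.
             \<omega> \<beta> (coord_change U x \<alpha> \<beta> z) $ k $ l * jac U x \<alpha> \<beta> k i z * jac U x \<alpha> \<beta> l j z)) \<and>
     (\<forall>\<alpha>\<in>A. \<forall>z\<in>x \<alpha> ` U \<alpha>.
        (\<forall>i j. \<omega> \<alpha> z $ i $ j = - \<omega> \<alpha> z $ j $ i) \<and>
        (\<forall>i j k. partial i (\<lambda>z. \<omega> \<alpha> z $ j $ k) z + partial j (\<lambda>z. \<omega> \<alpha> z $ k $ i) z
                 + partial k (\<lambda>z. \<omega> \<alpha> z $ i $ j) z = 0) \<and>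
        invertible (\<omega> \<alpha> z))"

text \<open>
  \<open>\<Gamma> \<alpha> k i j\<close> is the coefficient \<open>\<Gamma>\<^sup>k\<^sub>i\<^sub>j\<close> of \<open>\<nabla>\<^sub>i\<partial>\<^sub>j = \<Gamma>\<^sup>k\<^sub>i\<^sub>j\<partial>\<^sub>k\<close> in the chart \<open>\<alpha>\<close>. The transformation law
  expresses that the \<open>\<Gamma> \<alpha>\<close> are the coefficients of one covariant derivative: it is what one gets
  by substituting \<open>\<partial>/\<partial>x\<^sub>\<alpha>\<^sup>j = (\<partial>x\<^sub>\<beta>\<^sup>q/\<partial>x\<^sub>\<alpha>\<^sup>j) \<partial>/\<partial>x\<^sub>\<beta>\<^sup>q\<close>.
\<close>

definition affine_connection ::
    "'a set \<Rightarrow> ('a \<Rightarrow> 'm set) \<Rightarrow> ('a \<Rightarrow> 'm \<Rightarrow> real^'n::finite) \<Rightarrow>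
     ('a \<Rightarrow> 'n \<Rightarrow> 'n \<Rightarrow> 'n \<Rightarrow> real^'n \<Rightarrow> real) \<Rightarrow> bool" where
  "affine_connection A U x \<Gamma> \<longleftrightarrow>
     (\<forall>\<alpha>\<in>A. \<forall>k i j. smooth_on (x \<alpha> ` U \<alpha>) (\<Gamma> \<alpha> k i j)) \<and>
     (\<forall>\<alpha>\<in>A. \<forall>\<beta>\<in>A. \<forall>z\<in>overlap U x \<alpha> \<beta>. \<forall>i j m.
        (\<Sum>k\<in>UNIV. \<Gamma> \<alpha> k i j z * jac U x \<alpha> \<beta> m k z) =
          partial i (jac U x \<alpha> \<beta> m j) z +
          (\<Sum>p\<in>UNIV. \<Sum>q\<in>UNIV.
             \<Gamma> \<beta> m p q (coord_change U x \<alpha> \<beta> z) * jac U x \<alpha> \<beta> p i z * jac U x \<alpha> \<beta> q j z))"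

definition symmetric_symplectic_connection ::
    "'a set \<Rightarrow> ('a \<Rightarrow> 'm set) \<Rightarrow> ('a \<Rightarrow> 'm \<Rightarrow> real^'n::finite) \<Rightarrow>
     ('a \<Rightarrow> real^'n \<Rightarrow> real^'n^'n) \<Rightarrow> ('a \<Rightarrow> 'n \<Rightarrow> 'n \<Rightarrow> 'n \<Rightarrow> real^'n \<Rightarrow> real) \<Rightarrow> bool" where
  "symmetric_symplectic_connection A U x \<omega> \<Gamma> \<longleftrightarrow>
     affine_connection A U x \<Gamma> \<and>
     (\<forall>\<alpha>\<in>A. \<forall>z\<in>x \<alpha> ` U \<alpha>.
        (\<forall>k i j. \<Gamma> \<alpha> k i j z = \<Gamma> \<alpha> k j i z) \<and>
        (\<forall>i j k. partial i (\<lambda>z. \<omega> \<alpha> z $ j $ k) z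
                 - (\<Sum>l\<in>UNIV. \<Gamma> \<alpha> l i j z * \<omega> \<alpha> z $ l $ k)
                 - (\<Sum>l\<in>UNIV. \<Gamma> \<alpha> l i k z * \<omega> \<alpha> z $ j $ l) = 0))"

definition symplectic_potentials ::
    "'a set \<Rightarrow> ('a \<Rightarrow> 'm set) \<Rightarrow> ('a \<Rightarrow> 'm \<Rightarrow> real^'n::finite) \<Rightarrow>
     ('a \<Rightarrow> real^'n \<Rightarrow> real^'n^'n) \<Rightarrow> ('a \<Rightarrow> real^'n \<Rightarrow> real^'n) \<Rightarrow> bool" where
  "symplectic_potentials A U x \<omega> \<rho> \<longleftrightarrow>
     (\<forall>\<alpha>\<in>A. (\<forall>i. smooth_on (x \<alpha> ` U \<alpha>) (\<lambda>z. \<rho> \<alpha> z $ i)) \<and>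
       (\<forall>z\<in>x \<alpha> ` U \<alpha>. \<forall>i j.
          \<omega> \<alpha> z $ i $ j = partial i (\<lambda>z. \<rho> \<alpha> z $ j) z - partial j (\<lambda>z. \<rho> \<alpha> z $ i) z))"

text \<open>\<open>R\<^sup>k\<^sub>l\<^sub>;\<^sub>i\<^sub>j\<close> and \<open>R\<^sub>k\<^sub>l\<^sub>;\<^sub>i\<^sub>j\<close>, in one chart.\<close>

definition curvature ::
    "('n \<Rightarrow> 'n \<Rightarrow> 'n \<Rightarrow> real^'n \<Rightarrow> real) \<Rightarrow> 'n::finite \<Rightarrow> 'n \<Rightarrow> 'n \<Rightarrow> 'n \<Rightarrow> real^'n \<Rightarrow> real" where
  "curvature \<Gamma> k l i j z =
     partial i (\<Gamma> k j l) z + (\<Sum>n\<in>UNIV. \<Gamma> n j l z * \<Gamma> k i n z)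
     - partial j (\<Gamma> k i l) z - (\<Sum>n\<in>UNIV. \<Gamma> n i l z * \<Gamma> k j n z)"

definition curvature_low ::
    "(real^'n \<Rightarrow> real^'n^'n) \<Rightarrow> ('n \<Rightarrow> 'n \<Rightarrow> 'n \<Rightarrow> real^'n \<Rightarrow> real) \<Rightarrow>
     'n::finite \<Rightarrow> 'n \<Rightarrow> 'n \<Rightarrow> 'n \<Rightarrow> real^'n \<Rightarrow> real" where
  "curvature_low \<omega> \<Gamma> k l i j z = (\<Sum>n\<in>UNIV. \<omega> z $ k $ n * curvature \<Gamma> n l i j z)"


section \<open>Functions over one coordinate domain\<close>

text \<open>
  Over a coordinate domain with image \<open>V\<close>, a function is a formal power series in \<open>y\<close>, given by
  its coefficients: \<open>F I z p\<close> is the coefficient of \<open>y\<^sup>I\<close>, a function of the coordinates \<open>z\<close> and \<open>p\<close>.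
  Coefficients are set to zero for \<open>z \<notin> V\<close>, so that equality of functions over \<open>V\<close> is equality.
  Addition is the pointwise one of the library; the product is \<open>series_mult\<close> (Cauchy
  product), and not the pointwise product of the library.
\<close>

type_synonym 'n series = "('n \<Rightarrow> nat) \<Rightarrow> real^'n \<Rightarrow> real^'n \<Rightarrow> real"

definition monom_at :: "('n::finite \<Rightarrow> nat) \<Rightarrow> real^'n \<Rightarrow> real" where
  "monom_at J v = (\<Prod>i\<in>UNIV. (v $ i) ^ J i)"

definition local_functions :: "(real^'n::finite) set \<Rightarrow> 'n series set" where
  "local_functions V =
     {F. (\<forall>I. \<exists>N c. finite N \<and> (\<forall>J\<in>N. smooth_on V (c J)) \<and>
            (\<forall>z\<in>V. \<forall>p. F I z p = (\<Sum>J\<in>N. c J z * monom_at J p))) \<and>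
         (\<forall>I z p. z \<notin> V \<longrightarrow> F I z p = 0)}"

definition series_mult :: "'n::finite series \<Rightarrow> 'n series \<Rightarrow> 'n series" (infixl "\<odot>" 70) where
  "F \<odot> G = (\<lambda>I z p. \<Sum>J\<in>{J. \<forall>i. J i \<le> I i}. F J z p * G (\<lambda>i. I i - J i) z p)"

definition series_scale :: "real \<Rightarrow> 'n series \<Rightarrow> 'n series" where
  "series_scale c F = (\<lambda>I z p. c * F I z p)"

text \<open>A function of \<open>x\<close> only, and the coordinate functions, over \<open>V\<close>.\<close>

definition base_fun :: "(real^'n) set \<Rightarrow> (real^'n \<Rightarrow> real) \<Rightarrow> 'n series" where
  "base_fun V f = (\<lambda>I z p. if z \<in> V \<and> I = (\<lambda>_. 0) then f z else 0)"

definition x_fun :: "(real^'n) set \<Rightarrow> 'n \<Rightarrow> 'n series" where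
  "x_fun V i = base_fun V (\<lambda>z. z $ i)"

definition p_fun :: "(real^'n) set \<Rightarrow> 'n \<Rightarrow> 'n series" where
  "p_fun V i = (\<lambda>I z p. if z \<in> V \<and> I = (\<lambda>_. 0) then p $ i else 0)"

definition y_fun :: "(real^'n) set \<Rightarrow> 'n \<Rightarrow> 'n series" where
  "y_fun V i = (\<lambda>I z p. if z \<in> V \<and> I = (\<lambda>_. 0)(i := 1) then 1 else 0)"

datatype 'n coord = X 'n | P 'n | Y 'n

fun deriv_along :: "(real^'n::finite) set \<Rightarrow> 'n coord \<Rightarrow> 'n series \<Rightarrow> 'n series" where
  "deriv_along V (X i) F = (\<lambda>I z p. if z \<in> V then partial i (\<lambda>z. F I z p) z else 0)"
| "deriv_along V (P i) F = (\<lambda>I z p. partial i (\<lambda>p. F I z p) p)"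
| "deriv_along V (Y i) F = (\<lambda>I z p. real (I i + 1) * F (I(i := I i + 1)) z p)"

text \<open>
  The brackets of the coordinates, and their extension to an antisymmetric biderivation
  \<open>{F,G} = \<Sum>\<^sub>a\<^sub>b {a,b} (\<partial>F/\<partial>a) (\<partial>G/\<partial>b)\<close>, where \<open>a\<close> and \<open>b\<close> run through all coordinates.
\<close>

fun coord_bracket ::
    "(real^'n::finite) set \<Rightarrow> (real^'n \<Rightarrow> real^'n^'n) \<Rightarrow> ('n \<Rightarrow> 'n \<Rightarrow> 'n \<Rightarrow> real^'n \<Rightarrow> real) \<Rightarrow>
     'n coord \<Rightarrow> 'n coord \<Rightarrow> 'n series" where
  "coord_bracket V \<omega> \<Gamma> (X i) (X j) = 0"
| "coord_bracket V \<omega> \<Gamma> (X i) (Y j) = 0"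
| "coord_bracket V \<omega> \<Gamma> (Y i) (X j) = 0"
| "coord_bracket V \<omega> \<Gamma> (X i) (P j) = base_fun V (\<lambda>z. if i = j then 1 else 0)"
| "coord_bracket V \<omega> \<Gamma> (P i) (X j) = - base_fun V (\<lambda>z. if i = j then 1 else 0)"
| "coord_bracket V \<omega> \<Gamma> (Y i) (Y j) = base_fun V (\<lambda>z. matrix_inv (\<omega> z) $ i $ j)"
| "coord_bracket V \<omega> \<Gamma> (P i) (Y j) = (\<Sum>l\<in>UNIV. base_fun V (\<Gamma> j i l) \<odot> y_fun V l)"
| "coord_bracket V \<omega> \<Gamma> (Y i) (P j) = - (\<Sum>l\<in>UNIV. base_fun V (\<Gamma> i j l) \<odot> y_fun V l)"
| "coord_bracket V \<omega> \<Gamma> (P i) (P j) =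
     series_scale (1/2) (\<Sum>m\<in>UNIV. \<Sum>n\<in>UNIV.
       base_fun V (curvature_low \<omega> \<Gamma> m n i j) \<odot> y_fun V m \<odot> y_fun V n)"

definition local_bracket ::
    "(real^'n::finite) set \<Rightarrow> (real^'n \<Rightarrow> real^'n^'n) \<Rightarrow> ('n \<Rightarrow> 'n \<Rightarrow> 'n \<Rightarrow> real^'n \<Rightarrow> real) \<Rightarrow>
     'n series \<Rightarrow> 'n series \<Rightarrow> 'n series" where
  "local_bracket V \<omega> \<Gamma> F G =
     (\<Sum>a\<in>UNIV. \<Sum>b\<in>UNIV.
        coord_bracket V \<omega> \<Gamma> a b \<odot> deriv_along V a F \<odot> deriv_along V b G)"


section \<open>Functions on the whole bundle\<close>

text \<open>
  The homogeneous component of degree \<open>d\<close> in \<open>y\<close> of the formal power series \<open>F\<close>, evaluated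
  at \<open>(z, p, y)\<close>.
\<close>

definition homogeneous_part :: "'n::finite series \<Rightarrow> nat \<Rightarrow> real^'n \<Rightarrow> real^'n \<Rightarrow> real^'n \<Rightarrow> real" where
  "homogeneous_part F d z p y = (\<Sum>I\<in>{I. sum I UNIV = d}. F I z p * monom_at I y)"

text \<open>The components in the coordinates \<open>x\<^sub>\<alpha>\<close> of \<open>\<phi>\<^sup>\<alpha>\<^sup>\<beta> = \<rho>\<^sup>\<alpha> - \<rho>\<^sup>\<beta>\<close>.\<close>

definition potential_diff ::
    "('a \<Rightarrow> 'm set) \<Rightarrow> ('a \<Rightarrow> 'm \<Rightarrow> real^'n::finite) \<Rightarrow> ('a \<Rightarrow> real^'n \<Rightarrow> real^'n) \<Rightarrow>
     'a \<Rightarrow> 'a \<Rightarrow> real^'n \<Rightarrow> real^'n" where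
  "potential_diff U x \<rho> \<alpha> \<beta> z =
     (\<chi> i. \<rho> \<alpha> z $ i - (\<Sum>j\<in>UNIV. \<rho> \<beta> (coord_change U x \<alpha> \<beta> z) $ j * jac U x \<alpha> \<beta> j i z))"

text \<open>
  The fibre coordinates on the affine bundle and on the tangent bundle over a point with
  coordinates \<open>z = x\<^sub>\<alpha>\<close>: \<open>p\<^sub>\<alpha>\<close> in terms of \<open>p\<^sub>\<beta>\<close>, and \<open>y\<^sub>\<beta>\<close> in terms of \<open>y\<^sub>\<alpha>\<close>.
\<close>

definition p_change ::
    "('a \<Rightarrow> 'm set) \<Rightarrow> ('a \<Rightarrow> 'm \<Rightarrow> real^'n::finite) \<Rightarrow> ('a \<Rightarrow> real^'n \<Rightarrow> real^'n) \<Rightarrow>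
     'a \<Rightarrow> 'a \<Rightarrow> real^'n \<Rightarrow> real^'n \<Rightarrow> real^'n" where
  "p_change U x \<rho> \<alpha> \<beta> z p\<^sub>\<beta> =
     (\<chi> i. (\<Sum>j\<in>UNIV. p\<^sub>\<beta> $ j * jac U x \<alpha> \<beta> j i z) + potential_diff U x \<rho> \<alpha> \<beta> z $ i)"

definition y_change ::
    "('a \<Rightarrow> 'm set) \<Rightarrow> ('a \<Rightarrow> 'm \<Rightarrow> real^'n::finite) \<Rightarrow>
     'a \<Rightarrow> 'a \<Rightarrow> real^'n \<Rightarrow> real^'n \<Rightarrow> real^'n" where
  "y_change U x \<alpha> \<beta> z y\<^sub>\<alpha> = (\<chi> j. \<Sum>i\<in>UNIV. jac U x \<alpha> \<beta> j i z * y\<^sub>\<alpha> $ i)"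

text \<open>
  The bundle is glued from the coordinate domains by the above transition laws, so a function
  on it is a family of local functions that agree on overlaps under the change of coordinates.
  The substitution \<open>y\<^sub>\<beta> = y_change \<dots> y\<^sub>\<alpha>\<close> is linear and thus respects the degree in \<open>y\<close>; two formal
  power series are equal iff their homogeneous components are equal as polynomial functions.
  Indices outside \<open>A\<close> carry the zero function.
\<close>

definition global_functions ::
    "'a set \<Rightarrow> ('a \<Rightarrow> 'm set) \<Rightarrow> ('a \<Rightarrow> 'm \<Rightarrow> real^'n::finite) \<Rightarrow> ('a \<Rightarrow> real^'n \<Rightarrow> real^'n) \<Rightarrow>
     ('a \<Rightarrow> 'n series) set" where
  "global_functions A U x \<rho> =
     {F. (\<forall>\<alpha>\<in>A. F \<alpha> \<in> local_functions (x \<alpha> ` U \<alpha>)) \<and> (\<forall>\<alpha>. \<alpha> \<notin> A \<longrightarrow> F \<alpha> = 0) \<and>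
         (\<forall>\<alpha>\<in>A. \<forall>\<beta>\<in>A. \<forall>z\<in>overlap U x \<alpha> \<beta>. \<forall>p\<^sub>\<beta> y\<^sub>\<alpha> d.
            homogeneous_part (F \<alpha>) d z (p_change U x \<rho> \<alpha> \<beta> z p\<^sub>\<beta>) y\<^sub>\<alpha> =
            homogeneous_part (F \<beta>) d (coord_change U x \<alpha> \<beta> z) p\<^sub>\<beta> (y_change U x \<alpha> \<beta> z y\<^sub>\<alpha>))}"

definition global_scale :: "real \<Rightarrow> ('a \<Rightarrow> 'n series) \<Rightarrow> 'a \<Rightarrow> 'n series" where
  "global_scale c F = (\<lambda>\<alpha>. series_scale c (F \<alpha>))"

definition global_mult :: "('a \<Rightarrow> 'n::finite series) \<Rightarrow> ('a \<Rightarrow> 'n series) \<Rightarrow> 'a \<Rightarrow> 'n series" where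
  "global_mult F G = (\<lambda>\<alpha>. F \<alpha> \<odot> G \<alpha>)"

definition global_bracket ::
    "'a set \<Rightarrow> ('a \<Rightarrow> 'm set) \<Rightarrow> ('a \<Rightarrow> 'm \<Rightarrow> real^'n::finite) \<Rightarrow>
     ('a \<Rightarrow> real^'n \<Rightarrow> real^'n^'n) \<Rightarrow> ('a \<Rightarrow> 'n \<Rightarrow> 'n \<Rightarrow> 'n \<Rightarrow> real^'n \<Rightarrow> real) \<Rightarrow>
     ('a \<Rightarrow> 'n series) \<Rightarrow> ('a \<Rightarrow> 'n series) \<Rightarrow> 'a \<Rightarrow> 'n series" where
  "global_bracket A U x \<omega> \<Gamma> F G =
     (\<lambda>\<alpha>. if \<alpha> \<in> A then local_bracket (x \<alpha> ` U \<alpha>) (\<omega> \<alpha>) (\<Gamma> \<alpha>) (F \<alpha>) (G \<alpha>) else 0)"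


section \<open>Poisson brackets\<close>

text \<open>
  \<open>br\<close> is a Poisson bracket on the real algebra with carrier \<open>C\<close>, scalar multiplication \<open>sc\<close> and
  product \<open>mul\<close>. Linearity and the Leibniz rule in the second argument follow by antisymmetry.
\<close>

definition poisson_bracket_on ::
    "'f::ab_group_add set \<Rightarrow> (real \<Rightarrow> 'f \<Rightarrow> 'f) \<Rightarrow> ('f \<Rightarrow> 'f \<Rightarrow> 'f) \<Rightarrow> ('f \<Rightarrow> 'f \<Rightarrow> 'f) \<Rightarrow> bool" where
  "poisson_bracket_on C sc mul br \<longleftrightarrow>
     (\<forall>f\<in>C. \<forall>g\<in>C. f + g \<in> C \<and> mul f g \<in> C \<and> br f g \<in> C) \<and>
     (\<forall>c. \<forall>f\<in>C. sc c f \<in> C) \<and>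
     (\<forall>f\<in>C. \<forall>g\<in>C. br f g = - br g f) \<and>
     (\<forall>f\<in>C. \<forall>g\<in>C. \<forall>h\<in>C. br (f + g) h = br f h + br g h) \<and>
     (\<forall>c. \<forall>f\<in>C. \<forall>g\<in>C. br (sc c f) g = sc c (br f g)) \<and>
     (\<forall>f\<in>C. \<forall>g\<in>C. \<forall>h\<in>C. br (mul f g) h = mul f (br g h) + mul (br f h) g) \<and>
     (\<forall>f\<in>C. \<forall>g\<in>C. \<forall>h\<in>C. br f (br g h) + br g (br h f) + br h (br f g) = 0)"

end

theory Submission
  imports Defs
begin

text \<open>
  Sending a series to \<open>\<Sum>\<^sub>d t\<^sup>d F\<^sub>d(x, p, y)\<close>, where \<open>F\<^sub>d\<close> is its homogeneous part of degree \<open>d\<close> in \<open>y\<close>, is an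
  injective homomorphism into functions on the total space with values in \<open>\<real>[[t]]\<close>; derivatives
  act on the coefficients, so the Leibniz rule and the symmetry of second derivatives are those
  of calculus.

  The Jacobi identity reduces to the coordinates, where it says that \<open>\<omega>\<^sup>i\<^sup>j\<close> is parallel
  (\<open>p, y, y\<close>), that \<open>R\<close> is the curvature of \<open>\<Gamma>\<close> (\<open>p, p, y\<close>), and that the Bianchi identity holds
  (\<open>p, p, p\<close>). The last one uses that \<open>R\<^sub>m\<^sub>n\<^sub>;\<^sub>i\<^sub>j\<close> is symmetric in \<open>m, n\<close>, because \<open>\<omega>\<close> is parallel.

  With \<open>\<nabla>\<^sub>i = \<partial>/\<partial>x\<^sup>i - \<Gamma>\<^sup>j\<^sub>i\<^sub>l y\<^sup>l \<partial>/\<partial>y\<^sup>j\<close> the bracket is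
  \<open>\<nabla>\<^sub>iF \<partial>G/\<partial>p\<^sub>i - \<partial>F/\<partial>p\<^sub>i \<nabla>\<^sub>iG + \<omega>\<^sup>i\<^sup>j \<partial>F/\<partial>y\<^sup>i \<partial>G/\<partial>y\<^sup>j + 1/2 R\<^sub>m\<^sub>n\<^sub>;\<^sub>i\<^sub>j y\<^sup>m y\<^sup>n \<partial>F/\<partial>p\<^sub>i \<partial>G/\<partial>p\<^sub>j\<close>. Under a change of
  chart everything in it is a tensor except that \<open>\<nabla>\<^sub>i\<close> picks up a term \<open>C\<^sub>i\<^sub>k \<partial>/\<partial>p\<^sub>k\<close>; it drops out since
  \<open>C\<close> is symmetric, which for the affine part of the transition law means \<open>d(\<rho>\<^sup>\<alpha> - \<rho>\<^sup>\<beta>) = 0\<close>.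
\<close>


section \<open>Partial derivatives and smooth functions\<close>

text \<open>A formal series in \<open>y\<close> has no value at a point; the variable
  \<open>fps_X\<close> keeps the degrees apart, and each homogeneous part is an honest polynomial
  function of \<open>y\<close>. The price is that differentiation along \<open>y\<close> lowers the
  degree, so evaluation commutes with it only up to a factor \<open>fps_X\<close>. Identities are
  therefore proved after multiplication by a power of \<open>fps_X\<close>, which cancels because
  real power series form an integral domain. For the brackets of coordinates that power depends only
  on the coordinates involved, so their Jacobi identity becomes one between real numbers, where
  matrix calculus for \<omega>, \<Gamma> and the curvature applies.

  On the whole bundle the algebraic identities are inherited chart by chart. Charts have to be
  compared only to see that operations on compatible families yield compatible families; for the
  bracket this is the second half of the work.\<close>

lemma partial_has_derivative:
  assumes "(f has_derivative f') (at z)"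
  shows "partial i f z = f' (axis i 1)"
proof -
  have f: "(f has_derivative f') (at (z + 0 *\<^sub>R axis i (1::real)))"
    using assms by simp
  have "((\<lambda>t. z + t *\<^sub>R axis i (1::real)) has_derivative (\<lambda>t. t *\<^sub>R axis i 1)) (at 0)"
    by (auto intro!: derivative_eq_intros)
  from has_derivative_compose[OF this f]
  have "((\<lambda>t. f (z + t *\<^sub>R axis i 1)) has_derivative (\<lambda>t. f' (t *\<^sub>R axis i 1))) (at 0)" .
  moreover have "(\<lambda>t. f' (t *\<^sub>R axis i 1)) = (*) (f' (axis i 1))"
    using linear_scale[OF has_derivative_linear[OF assms]] by (auto simp: mult.commute)
  ultimately have "((\<lambda>t. f (z + t *\<^sub>R axis i 1)) has_field_derivative f' (axis i 1)) (at 0)"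
    by (simp add: has_field_derivative_def)
  then show ?thesis
    unfolding partial_def by (rule DERIV_imp_deriv)
qed

lemma vec_eq_sum_axis: "(h::real^'n) = (\<Sum>i\<in>UNIV. h $ i *\<^sub>R axis i 1)"
  by (simp add: vec_eq_iff axis_def if_distrib sum.delta cong: if_cong)

lemma differentiable_has_derivative_partial:
  fixes f :: "real^'n::finite \<Rightarrow> real"
  assumes "f differentiable (at z)"
  shows "(f has_derivative (\<lambda>h. \<Sum>i\<in>UNIV. h $ i * partial i f z)) (at z)"
proof -
  obtain f' where f': "(f has_derivative f') (at z)"
    using assms by (auto simp: differentiable_def)
  have "f' h = (\<Sum>i\<in>UNIV. h $ i * partial i f z)" for h
  proof -
    have l: "linear f'" using f' has_derivative_linear by blast
    have "f' h = f' (\<Sum>i\<in>UNIV. h $ i *\<^sub>R axis i 1)"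
      using vec_eq_sum_axis by metis
    also have "\<dots> = (\<Sum>i\<in>UNIV. h $ i * f' (axis i 1))"
      by (simp add: linear_sum[OF l] linear_scale[OF l])
    finally show ?thesis by (simp add: partial_has_derivative[OF f'])
  qed
  then show ?thesis using f' by (metis (no_types, lifting) ext)
qed

lemma partial_cong:
  assumes "open S" "z \<in> S" "\<And>w. w \<in> S \<Longrightarrow> f w = g w"
  shows "partial i f z = partial i g z"
proof -
  let ?l = "\<lambda>t. z + t *\<^sub>R axis i (1::real)"
  have "isCont ?l 0" by (intro continuous_intros)
  then have "\<forall>\<^sub>F t in nhds 0. ?l t \<in> S"
    using assms(1,2) by (auto simp: continuous_at tendsto_def eventually_nhds_conv_at)
  then have "\<forall>\<^sub>F t in nhds 0. f (?l t) = g (?l t)"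
    by eventually_elim (rule assms(3))
  then show ?thesis
    unfolding partial_def by (rule deriv_cong_ev) simp
qed

lemma differentiable_cong:
  assumes "open S" "z \<in> S" "\<And>w. w \<in> S \<Longrightarrow> f w = g w" "f differentiable (at z)"
  shows "g differentiable (at z)"
  using assms has_derivative_transform_within_open[of f _ z UNIV S g] by (auto simp: differentiable_def)

lemma partial_const [simp]: "partial i (\<lambda>z. c) z = 0"
  by (simp add: partial_def)

lemma partial_add:
  assumes "f differentiable (at z)" "g differentiable (at z)"
  shows "partial i (\<lambda>z. f z + g z) z = partial i f z + partial i g z"
proof -
  obtain f' g' where f: "(f has_derivative f') (at z)" and g: "(g has_derivative g') (at z)"
    using assms by (auto simp: differentiable_def)
  from partial_has_derivative[OF has_derivative_add[OF f g]] partial_has_derivative[OF f] partial_has_derivative[OF g]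
  show ?thesis by simp
qed

lemma partial_minus:
  assumes "f differentiable (at z)"
  shows "partial i (\<lambda>z. - f z) z = - partial i f z"
proof -
  obtain f' where "(f has_derivative f') (at z)"
    using assms by (auto simp: differentiable_def)
  from partial_has_derivative[OF has_derivative_minus[OF this]] partial_has_derivative[OF this]
  show ?thesis by simp
qed

lemma partial_diff:
  assumes "f differentiable (at z)" "g differentiable (at z)"
  shows "partial i (\<lambda>z. f z - g z) z = partial i f z - partial i g z"
proof -
  obtain f' g' where f: "(f has_derivative f') (at z)" and g: "(g has_derivative g') (at z)"
    using assms by (auto simp: differentiable_def)
  from partial_has_derivative[OF has_derivative_diff[OF f g]] partial_has_derivative[OF f] partial_has_derivative[OF g]
  show ?thesis by simp
qed

lemma partial_mult:
  assumes "f differentiable (at z)" "g differentiable (at z)"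
  shows "partial i (\<lambda>z. f z * g z) z = partial i f z * g z + f z * partial i g z"
proof -
  obtain f' g' where "(f has_derivative f') (at z)" "(g has_derivative g') (at z)"
    using assms by (auto simp: differentiable_def)
  then show ?thesis
    by (simp add: partial_has_derivative[OF has_derivative_mult] partial_has_derivative)
qed

lemma differentiable_sum_at:
  assumes "\<And>k. k \<in> K \<Longrightarrow> f k differentiable (at z)"
  shows "(\<lambda>z. \<Sum>k\<in>K. f k z) differentiable (at z)"
  using assms by (induction K rule: infinite_finite_induct) auto

lemma partial_sum:
  assumes "\<And>k. k \<in> K \<Longrightarrow> f k differentiable (at z)"
  shows "partial i (\<lambda>z. \<Sum>k\<in>K. f k z) z = (\<Sum>k\<in>K. partial i (f k) z)"
  using assms
  by (induction K rule: infinite_finite_induct) (simp_all add: partial_add differentiable_sum_at)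

lemma partial_inverse:
  assumes "f differentiable (at z)" "f z \<noteq> 0"
  shows "partial i (\<lambda>z. inverse (f z)) z = - (partial i f z * (inverse (f z) * inverse (f z)))"
proof -
  obtain f' where "(f has_derivative f') (at z)"
    using assms by (auto simp: differentiable_def)
  from partial_has_derivative[OF Deriv.has_derivative_inverse[OF assms(2) this]]
       partial_has_derivative[OF this]
  show ?thesis by (simp add: mult_ac)
qed

lemma differentiable_vec_nth [simp]: "(\<lambda>z. z $ j) differentiable (at (z::real^'n::finite))"
  by (rule bounded_linear_imp_differentiable) (rule bounded_linear_vec_nth)

lemma partial_vec_nth: "partial i (\<lambda>z. z $ j) z = (if i = j then 1 else 0)"
  using partial_has_derivative[OF bounded_linear_imp_has_derivative[OF bounded_linear_vec_nth], of i j z]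
  by (simp add: axis_def)

lemma chain_rule:
  fixes h :: "real^'b::finite \<Rightarrow> real^'c::finite"
  assumes f: "f differentiable (at (h w))" and h: "\<And>b. (\<lambda>w. h w $ b) differentiable (at w)"
  shows chain_rule_differentiable: "(\<lambda>w. f (h w)) differentiable (at w)"
    and chain_rule_partial:
      "partial a (\<lambda>w. f (h w)) w = (\<Sum>b\<in>UNIV. partial b f (h w) * partial a (\<lambda>w. h w $ b) w)"
proof -
  let ?h' = "\<lambda>v. \<chi> b. \<Sum>a\<in>UNIV. v $ a * partial a (\<lambda>w. h w $ b) w"
  have hd: "(h has_derivative ?h') (at w)"
    unfolding has_derivative_componentwise_within[of h]
    using differentiable_has_derivative_partial[OF h]
    by (auto simp: Basis_vec_def inner_axis)
  have D: "((\<lambda>w. f (h w)) has_derivative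
      (\<lambda>v. \<Sum>b\<in>UNIV. ?h' v $ b * partial b f (h w))) (at w)"
    by (rule has_derivative_compose[OF hd differentiable_has_derivative_partial[OF f]])
  then show "(\<lambda>w. f (h w)) differentiable (at w)"
    by (auto simp: differentiable_def)
  show "partial a (\<lambda>w. f (h w)) w = (\<Sum>b\<in>UNIV. partial b f (h w) * partial a (\<lambda>w. h w $ b) w)"
    by (simp add: partial_has_derivative[OF D] axis_def mult.commute if_distrib if_distribR
        sum.delta cong: if_cong)
qed

section \<open>Symmetry of mixed partial derivatives\<close>

lemma DERIV_along_axis:
  assumes "f differentiable (at (u + s *\<^sub>R axis i 1))"
  shows "((\<lambda>s. f (u + s *\<^sub>R axis i 1)) has_field_derivative
           partial i f (u + s *\<^sub>R axis i (1::real))) (at s)"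
proof -
  let ?w = "u + s *\<^sub>R axis i 1"
  obtain f' where f': "(f has_derivative f') (at ?w)"
    using assms by (auto simp: differentiable_def)
  have "((\<lambda>t. u + t *\<^sub>R axis i (1::real)) has_derivative (\<lambda>t. t *\<^sub>R axis i 1)) (at s)"
    by (auto intro!: derivative_eq_intros)
  from has_derivative_compose[OF this f']
  have "((\<lambda>t. f (u + t *\<^sub>R axis i 1)) has_derivative (\<lambda>t. f' (t *\<^sub>R axis i 1))) (at s)" .
  moreover have "(\<lambda>t. f' (t *\<^sub>R axis i 1)) = (*) (partial i f ?w)"
    using linear_scale[OF has_derivative_linear[OF f']] partial_has_derivative[OF f', of i]
    by (auto simp: mult.commute)
  ultimately show ?thesis
    by (simp add: has_field_derivative_def)
qed

text \<open>The mean value theorem along direction \<open>i\<close>, applied to the increment of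
  \<open>f\<close> in direction \<open>j\<close>, turns the second difference into \<open>t\<close>
  times a difference of values of \<open>partial i f\<close> near \<open>z\<close>. The total
  derivative of \<open>partial i f\<close> at \<open>z\<close> evaluates that difference up to
  \<open>e * t\<close>.\<close>

lemma second_difference_estimate:
  fixes f :: "real^'n::finite \<Rightarrow> real"
  assumes S: "open S" "z \<in> S" and f: "\<And>w. w \<in> S \<Longrightarrow> f differentiable (at w)"
    and fi: "partial i f differentiable (at z)" and e: "e > 0"
  shows "\<exists>\<delta>>0. \<forall>t. 0 < t \<and> t < \<delta> \<longrightarrow>
    \<bar>f (z + t *\<^sub>R axis i 1 + t *\<^sub>R axis j 1) - f (z + t *\<^sub>R axis i 1) - f (z + t *\<^sub>R axis j 1) + f z
      - t\<^sup>2 * partial j (partial i f) z\<bar> \<le> e * t\<^sup>2"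
proof -
  obtain L where L: "(partial i f has_derivative L) (at z)"
    using fi by (auto simp: differentiable_def)
  have Llin: "linear L" using L has_derivative_linear by blast
  obtain r where r: "r > 0" "ball z r \<subseteq> S" using S open_contains_ball by blast
  \<comment> \<open>The two points compared below lie within \<open>2 * t\<close> and
    \<open>t\<close> of \<open>z\<close>, so errors of relative size \<open>e/3\<close> add up to
    \<open>e * t\<close>.\<close>
  obtain d where d: "d > 0"
    "\<And>y. norm (y - z) < d \<Longrightarrow> \<bar>partial i f y - partial i f z - L (y - z)\<bar> \<le> e/3 * norm (y - z)"
    using L[unfolded has_derivative_within_alt] e
    by (auto simp: real_norm_def dest: spec[of _ "e/3"])
  define \<delta> where "\<delta> = min r d / 2"
  have "\<bar>f (z + t *\<^sub>R axis i 1 + t *\<^sub>R axis j 1) - f (z + t *\<^sub>R axis i 1) - f (z + t *\<^sub>R axis j 1) + f z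
      - t\<^sup>2 * partial j (partial i f) z\<bar> \<le> e * t\<^sup>2" if t: "0 < t" "t < \<delta>" for t
  proof -
    let ?g = "\<lambda>s. f ((z + t *\<^sub>R axis j 1) + s *\<^sub>R axis i 1) - f (z + s *\<^sub>R axis i 1)"
    let ?g' = "\<lambda>s. partial i f ((z + t *\<^sub>R axis j 1) + s *\<^sub>R axis i 1) - partial i f (z + s *\<^sub>R axis i 1)"
    have n1: "norm (t *\<^sub>R axis j (1::real) + s *\<^sub>R axis i (1::real)) \<le> 2 * t" if "0 \<le> s" "s \<le> t" for s
      using norm_triangle_ineq[of "t *\<^sub>R axis j (1::real)" "s *\<^sub>R axis i (1::real)"] that by simp
    have n2: "norm (s *\<^sub>R axis i (1::real)) \<le> t" if "0 \<le> s" "s \<le> t" for s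
      using that by simp
    have t2: "2 * t < r" "2 * t < d" using t by (auto simp: \<delta>_def)
    have in1: "(z + t *\<^sub>R axis j 1) + s *\<^sub>R axis i 1 \<in> S" if "0 \<le> s" "s \<le> t" for s
    proof (rule r(2)[THEN subsetD])
      have "dist z (z + t *\<^sub>R axis j 1 + s *\<^sub>R axis i 1) = norm (t *\<^sub>R axis j (1::real) + s *\<^sub>R axis i (1::real))"
        by (metis add.assoc add_diff_cancel_left' dist_commute dist_norm)
      then show "z + t *\<^sub>R axis j 1 + s *\<^sub>R axis i 1 \<in> ball z r"
        using n1[OF that] t2 by simp
    qed
    have in2: "z + s *\<^sub>R axis i 1 \<in> S" if "0 \<le> s" "s \<le> t" for s
      using n2[OF that] t2 t(1) by (intro r(2)[THEN subsetD]) (auto simp: dist_norm)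
    have "\<exists>s. 0 < s \<and> s < t \<and> ?g t - ?g 0 = (t - 0) * ?g' s"
      by (rule MVT2) (use t in \<open>auto intro!: DERIV_diff DERIV_along_axis f in1 in2\<close>)
    then obtain s where s: "0 < s" "s < t" and gs: "?g t - ?g 0 = t * ?g' s" by auto
    let ?a = "t *\<^sub>R axis j (1::real) + s *\<^sub>R axis i (1::real)" and ?b = "s *\<^sub>R axis i (1::real)"
    have a: "\<bar>partial i f (z + ?a) - partial i f z - L ?a\<bar> \<le> e/3 * (2 * t)"
      using d(2)[of "z + ?a"] n1[of s] s t2 e
      by (smt (verit, best) add_diff_cancel_left' divide_pos_pos mult_left_mono)
    have b: "\<bar>partial i f (z + ?b) - partial i f z - L ?b\<bar> \<le> e/3 * t"
      using d(2)[of "z + ?b"] n2[of s] s t2 e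
      by (smt (verit, best) add_diff_cancel_left' divide_pos_pos mult_left_mono)
    have "L ?a - L ?b = t * partial j (partial i f) z"
      by (simp add: linear_add[OF Llin] linear_scale[OF Llin] partial_has_derivative[OF L])
    then have "\<bar>(partial i f (z + ?a) - partial i f (z + ?b)) - t * partial j (partial i f) z\<bar> \<le> e * t"
      using a b by linarith
    then have "\<bar>?g' s - t * partial j (partial i f) z\<bar> \<le> e * t"
      by (simp add: add.assoc)
    then have "t * \<bar>?g' s - t * partial j (partial i f) z\<bar> \<le> t * (e * t)"
      using t by (intro mult_left_mono) auto
    then have "\<bar>t * ?g' s - t\<^sup>2 * partial j (partial i f) z\<bar> \<le> e * t\<^sup>2"
      using t by (simp add: power2_eq_square abs_mult right_diff_distrib[symmetric] mult.assoc mult.left_commute)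
    then have "\<bar>(?g t - ?g 0) - t\<^sup>2 * partial j (partial i f) z\<bar> \<le> e * t\<^sup>2"
      using gs by simp
    moreover have "?g t - ?g 0 = f (z + t *\<^sub>R axis i 1 + t *\<^sub>R axis j 1) - f (z + t *\<^sub>R axis i 1) - f (z + t *\<^sub>R axis j 1) + f z"
      by (simp add: add_ac)
    ultimately show ?thesis by simp
  qed
  moreover have "\<delta> > 0" using r d by (auto simp: \<delta>_def)
  ultimately show ?thesis by blast
qed

text \<open>The second difference is symmetric in \<open>i\<close> and \<open>j\<close>, and divided
  by \<open>t\<^sup>2\<close> it approximates both mixed derivatives.\<close>

theorem partial_commute:
  fixes f :: "real^'n::finite \<Rightarrow> real"
  assumes S: "open S" "z \<in> S" and f: "\<And>w. w \<in> S \<Longrightarrow> f differentiable (at w)"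
    and fi: "partial i f differentiable (at z)" and fj: "partial j f differentiable (at z)"
  shows "partial i (partial j f) z = partial j (partial i f) z"
proof (rule ccontr)
  let ?a = "partial j (partial i f) z" and ?b = "partial i (partial j f) z"
  assume "?b \<noteq> ?a"
  \<comment> \<open>With a third of the gap as tolerance, the two estimates bound the gap by two
    thirds of itself.\<close>
  define e where "e = \<bar>?a - ?b\<bar> / 3"
  have e: "e > 0" using \<open>?b \<noteq> ?a\<close> by (simp add: e_def)
  obtain d1 where d1: "d1 > 0" "\<And>t. 0 < t \<and> t < d1 \<Longrightarrow>
    \<bar>f (z + t *\<^sub>R axis i 1 + t *\<^sub>R axis j 1) - f (z + t *\<^sub>R axis i 1) - f (z + t *\<^sub>R axis j 1) + f z
      - t\<^sup>2 * ?a\<bar> \<le> e * t\<^sup>2"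
    using second_difference_estimate[OF S f fi e, of j] by blast
  obtain d2 where d2: "d2 > 0" "\<And>t. 0 < t \<and> t < d2 \<Longrightarrow>
    \<bar>f (z + t *\<^sub>R axis j 1 + t *\<^sub>R axis i 1) - f (z + t *\<^sub>R axis j 1) - f (z + t *\<^sub>R axis i 1) + f z
      - t\<^sup>2 * ?b\<bar> \<le> e * t\<^sup>2"
    using second_difference_estimate[OF S f fj e, of i] by blast
  define t where "t = min d1 d2 / 2"
  have t: "0 < t" "t < d1" "t < d2" using d1(1) d2(1) by (auto simp: t_def)
  have sw: "z + t *\<^sub>R axis j (1::real) + t *\<^sub>R axis i 1 = z + t *\<^sub>R axis i 1 + t *\<^sub>R axis j 1"
    by (simp add: add_ac)
  have "\<bar>t\<^sup>2 * ?a - t\<^sup>2 * ?b\<bar> \<le> 2 * e * t\<^sup>2"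
    using d1(2)[of t] d2(2)[of t] t unfolding sw by (simp add: abs_le_iff)
  then have "t\<^sup>2 * \<bar>?a - ?b\<bar> \<le> t\<^sup>2 * (2 * e)"
    by (simp add: right_diff_distrib[symmetric] abs_mult mult.commute)
  then have "\<bar>?a - ?b\<bar> \<le> 2 * e" using t(1) by simp
  then show False using e by (simp add: e_def)
qed

section \<open>Closure properties of smooth functions, by induction on the order\<close>

fun Ck_on :: "nat \<Rightarrow> (real^'n::finite) set \<Rightarrow> (real^'n \<Rightarrow> real) \<Rightarrow> bool" where
  "Ck_on 0 S f \<longleftrightarrow> f differentiable_on S"
| "Ck_on (Suc k) S f \<longleftrightarrow> f differentiable_on S \<and> (\<forall>i. Ck_on k S (partial i f))"

text \<open>Recursion on the order supplies the induction that a condition on all words of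
  derivatives does not offer. It strips the innermost derivative, which is the last entry of the
  list, hence the case split from the right.\<close>

lemma Ck_on_iff:
  fixes f :: "real^'n::finite \<Rightarrow> real"
  shows "Ck_on k S f \<longleftrightarrow> (\<forall>is. length is \<le> k \<longrightarrow> foldr partial is f differentiable_on S)"
proof (induction k arbitrary: f)
  case (Suc k)
  have "(\<forall>is. length is \<le> Suc k \<longrightarrow> foldr partial is f differentiable_on S) \<longleftrightarrow>
        f differentiable_on S \<and>
        (\<forall>i is. length is \<le> k \<longrightarrow> foldr partial (is @ [i]) f differentiable_on S)"
    (is "?l \<longleftrightarrow> ?r")
  proof
    assume ?l
    then show ?r
      by (metis Suc_le_mono foldr.simps(1) id_apply length_append_singleton list.size(3) zero_le)
  next
    assume r: ?r
    show ?l
    proof (intro allI impI)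
      fix "is" :: "'n list"
      assume "length is \<le> Suc k"
      then show "foldr partial is f differentiable_on S"
        using r by (cases "is" rule: rev_cases) auto
    qed
  qed
  then show ?case using Suc by simp
qed simp

lemma smooth_on_iff_Ck: "smooth_on S f \<longleftrightarrow> (\<forall>k. Ck_on k S f)"
  unfolding smooth_on_def Ck_on_iff by blast

lemma smooth_on_partial: "smooth_on S f \<Longrightarrow> smooth_on S (partial i f)"
  unfolding smooth_on_iff_Ck by (metis Ck_on.simps(2))

lemma smooth_on_imp_differentiable:
  "open S \<Longrightarrow> smooth_on S f \<Longrightarrow> z \<in> S \<Longrightarrow> f differentiable (at z)"
  unfolding smooth_on_iff_Ck by (metis Ck_on.simps(1) differentiable_on_eq_differentiable_at)

lemma smooth_on_partial_commute:
  assumes "open S" "smooth_on S f" "z \<in> S"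
  shows "partial i (partial j f) z = partial j (partial i f) z"
  using assms
  by (intro partial_commute[of S]) (auto intro: smooth_on_imp_differentiable smooth_on_partial)

text \<open>The rules of differentiation hold only at points of \<open>S\<close>, so an equality on
  the open set has to be carried through all orders before they can be used inside an
  induction.\<close>

lemma Ck_on_cong:
  assumes "open S" "\<And>z. z \<in> S \<Longrightarrow> f z = g z" "Ck_on k S f"
  shows "Ck_on k S g"
  using assms(2,3)
proof (induction k arbitrary: f g)
  case 0
  then show ?case
    using differentiable_cong[OF assms(1), of _ f g] assms(1)
    by (simp add: differentiable_on_eq_differentiable_at)
next
  case (Suc k)
  then have "g differentiable_on S"
    using differentiable_cong[OF assms(1), of _ f g] assms(1)
    by (simp add: differentiable_on_eq_differentiable_at)
  moreover have "Ck_on k S (partial i g)" for i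
  proof (rule Suc.IH)
    show "partial i f z = partial i g z" if "z \<in> S" for z
      using partial_cong[OF assms(1) that, of f g i] Suc.prems(1) by blast
    show "Ck_on k S (partial i f)" using Suc.prems(2) by simp
  qed
  ultimately show ?case by simp
qed

lemma Ck_on_Suc_D: "Ck_on (Suc k) S f \<Longrightarrow> Ck_on k S f"
  by (auto simp: Ck_on_iff simp del: Ck_on.simps)

lemma Ck_on_const: "Ck_on k S (\<lambda>z. c)"
proof (induction k arbitrary: c)
  case (Suc k)
  moreover have "partial i (\<lambda>z. c) = (\<lambda>z. 0)" for i :: 'a by auto
  ultimately show ?case by simp
qed simp

lemma Ck_on_add:
  assumes "open S" "Ck_on k S f" "Ck_on k S g"
  shows "Ck_on k S (\<lambda>z. f z + g z)"
  using assms(2,3)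
proof (induction k arbitrary: f g)
  case (Suc k)
  have "Ck_on k S (partial i (\<lambda>z. f z + g z))" for i
    by (rule Ck_on_cong[OF assms(1) _ Suc.IH[of "partial i f" "partial i g"]])
       (use Suc.prems assms(1) in \<open>auto simp: partial_add differentiable_on_eq_differentiable_at\<close>)
  then show ?case using Suc.prems by simp
qed simp

lemma Ck_on_mult:
  assumes "open S" "Ck_on k S f" "Ck_on k S g"
  shows "Ck_on k S (\<lambda>z. f z * g z)"
  using assms(2,3)
proof (induction k arbitrary: f g)
  case (Suc k)
  have "Ck_on k S (\<lambda>z. partial i f z * g z + f z * partial i g z)" for i
    using Suc.prems Ck_on_Suc_D[OF Suc.prems(1)] Ck_on_Suc_D[OF Suc.prems(2)]
    by (intro Ck_on_add[OF assms(1)] Suc.IH) auto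
  then have "Ck_on k S (partial i (\<lambda>z. f z * g z))" for i
    by (rule Ck_on_cong[OF assms(1), rotated])
       (use Suc.prems assms(1) in \<open>auto simp: partial_mult differentiable_on_eq_differentiable_at\<close>)
  then show ?case using Suc.prems by simp
qed simp

text \<open>The derivative is a product of \<open>partial i f\<close> and two copies of
  \<open>inverse (f z)\<close>, which is of order \<open>k\<close> by induction; writing the sign as
  a factor \<open>- 1\<close> leaves only products.\<close>

lemma Ck_on_inverse:
  assumes "open S" "Ck_on k S f" "\<And>z. z \<in> S \<Longrightarrow> f z \<noteq> 0"
  shows "Ck_on k S (\<lambda>z. inverse (f z))"
  using assms(2)
proof (induction k)
  case 0
  then show ?case using assms(3) by simp
next
  case (Suc k)
  have "Ck_on k S (\<lambda>z. inverse (f z))"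
    using Suc.IH Ck_on_Suc_D[OF Suc.prems] .
  then have "Ck_on k S (\<lambda>z. (- 1) * (partial i f z * (inverse (f z) * inverse (f z))))" for i
    using Suc.prems by (intro Ck_on_mult[OF assms(1)] Ck_on_const) auto
  then have "Ck_on k S (partial i (\<lambda>z. inverse (f z)))" for i
    by (rule Ck_on_cong[OF assms(1), rotated])
       (use Suc.prems assms(1,3) in \<open>auto simp: partial_inverse differentiable_on_eq_differentiable_at\<close>)
  then show ?case using Suc.prems assms(3) by simp
qed

lemma smooth_on_cong:
  "open S \<Longrightarrow> (\<And>z. z \<in> S \<Longrightarrow> f z = g z) \<Longrightarrow> smooth_on S f \<Longrightarrow> smooth_on S g"
  unfolding smooth_on_iff_Ck using Ck_on_cong by blast

lemma smooth_on_const [simp]: "smooth_on S (\<lambda>z. c)"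
  by (simp add: smooth_on_iff_Ck Ck_on_const)

lemma smooth_on_add: "open S \<Longrightarrow> smooth_on S f \<Longrightarrow> smooth_on S g \<Longrightarrow> smooth_on S (\<lambda>z. f z + g z)"
  by (simp add: smooth_on_iff_Ck Ck_on_add)

lemma smooth_on_mult: "open S \<Longrightarrow> smooth_on S f \<Longrightarrow> smooth_on S g \<Longrightarrow> smooth_on S (\<lambda>z. f z * g z)"
  by (simp add: smooth_on_iff_Ck Ck_on_mult)

lemma smooth_on_minus: "open S \<Longrightarrow> smooth_on S f \<Longrightarrow> smooth_on S (\<lambda>z. - f z)"
  using smooth_on_mult[of S "\<lambda>z. -1" f] by simp

lemma smooth_on_diff: "open S \<Longrightarrow> smooth_on S f \<Longrightarrow> smooth_on S g \<Longrightarrow> smooth_on S (\<lambda>z. f z - g z)"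
  using smooth_on_add[of S f "\<lambda>z. - g z"] smooth_on_minus[of S g] by simp

lemma smooth_on_inverse:
  "open S \<Longrightarrow> smooth_on S f \<Longrightarrow> (\<And>z. z \<in> S \<Longrightarrow> f z \<noteq> 0) \<Longrightarrow> smooth_on S (\<lambda>z. inverse (f z))"
  by (simp add: smooth_on_iff_Ck Ck_on_inverse)

lemma smooth_on_sum:
  "open S \<Longrightarrow> (\<And>k. k \<in> K \<Longrightarrow> smooth_on S (f k)) \<Longrightarrow> smooth_on S (\<lambda>z. \<Sum>k\<in>K. f k z)"
  by (induction K rule: infinite_finite_induct) (simp_all add: smooth_on_add)

lemma smooth_on_prod:
  "open S \<Longrightarrow> (\<And>k. k \<in> K \<Longrightarrow> smooth_on S (f k)) \<Longrightarrow> smooth_on S (\<lambda>z. \<Prod>k\<in>K. f k z)"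
  by (induction K rule: infinite_finite_induct) (simp_all add: smooth_on_mult)

lemma smooth_on_power: "open S \<Longrightarrow> smooth_on S f \<Longrightarrow> smooth_on S (\<lambda>z. f z ^ n)"
  by (induction n) (simp_all add: smooth_on_mult)

text \<open>The chain rule replaces \<open>f\<close> by its partial derivatives, composed with the
  same \<open>h\<close>; the induction therefore runs over all smooth \<open>f\<close> while
  \<open>h\<close> stays fixed.\<close>

lemma smooth_on_compose:
  fixes h :: "real^'b::finite \<Rightarrow> real^'c::finite"
  assumes S: "open S" and T: "open T" and h: "\<And>j. smooth_on S (\<lambda>w. h w $ j)"
    and hS: "\<And>w. w \<in> S \<Longrightarrow> h w \<in> T" and f: "smooth_on T f"
  shows "smooth_on S (\<lambda>w. f (h w))"
proof -
  have d: "f differentiable (at (h w))" "(\<lambda>w. h w $ j) differentiable (at w)"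
    if "smooth_on T f" "w \<in> S" for f w j
    using that hS h smooth_on_imp_differentiable[OF S] smooth_on_imp_differentiable[OF T] by auto
  have "Ck_on k S (\<lambda>w. f (h w))" for k
    using f
  proof (induction k arbitrary: f)
    case (0 f)
    then show ?case by (simp add: differentiable_at_imp_differentiable_on chain_rule_differentiable d)
  next
    case (Suc k)
    have *: "Ck_on k S (\<lambda>w. partial b f (h w) * partial a (\<lambda>w. h w $ b) w)" for a b
      using Suc.IH[OF smooth_on_partial[OF Suc.prems]] smooth_on_partial[OF h]
      by (intro Ck_on_mult S) (simp_all add: smooth_on_iff_Ck)
    have "Ck_on k S (\<lambda>w. \<Sum>b\<in>B. partial b f (h w) * partial a (\<lambda>w. h w $ b) w)" for a and B :: "'c set"
      by (induction B rule: infinite_finite_induct) (simp_all add: Ck_on_const Ck_on_add S *)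
    note ** = this[where B = UNIV]
    have "Ck_on k S (partial a (\<lambda>w. f (h w)))" for a
      by (rule Ck_on_cong[OF S _ **[of a]])
         (rule chain_rule_partial[symmetric]; rule d[OF Suc.prems]; assumption)
    then show ?case
      using d[OF Suc.prems] by (simp add: differentiable_at_imp_differentiable_on chain_rule_differentiable)
  qed
  then show ?thesis by (simp add: smooth_on_iff_Ck)
qed

lemma smooth_on_vec_nth [simp]: "smooth_on S (\<lambda>z. z $ j)"
  unfolding smooth_on_iff_Ck
proof
  fix k
  have "partial i (\<lambda>z::real^'a. z $ j) = (\<lambda>z. if i = j then 1 else 0)" for i
    by (auto simp: partial_vec_nth)
  moreover have "(\<lambda>z::real^'a. z $ j) differentiable_on S"
    by (rule bounded_linear_imp_differentiable_on) (rule bounded_linear_vec_nth)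
  ultimately show "Ck_on k S (\<lambda>z. z $ j)"
    by (cases k) (simp_all add: Ck_on_const)
qed

section \<open>Smooth dependence of the inverse matrix\<close>

lemma matrix_inv_inverse:
  assumes "invertible (m :: real^'n::finite^'n)"
  shows "m ** matrix_inv m = mat 1" and "matrix_inv m ** m = mat 1"
  using someI_ex[OF assms[unfolded invertible_def]] by (simp_all add: matrix_inv_def)

lemma smooth_on_det:
  fixes m :: "real^'b::finite \<Rightarrow> real^'n::finite^'n"
  assumes "open S" "\<And>i j. smooth_on S (\<lambda>z. m z $ i $ j)"
  shows "smooth_on S (\<lambda>z. det (m z))"
  unfolding det_def using assms by (intro smooth_on_sum smooth_on_mult smooth_on_prod) auto

text \<open>Cramer's rule gives each entry as a quotient of determinants, which are polynomials in
  the entries of \<open>m z\<close>.\<close>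

lemma smooth_on_matrix_inv:
  fixes m :: "real^'b::finite \<Rightarrow> real^'n::finite^'n"
  assumes S: "open S" and m: "\<And>i j. smooth_on S (\<lambda>z. m z $ i $ j)"
    and inv: "\<And>z. z \<in> S \<Longrightarrow> invertible (m z)"
  shows "smooth_on S (\<lambda>z. matrix_inv (m z) $ i $ j)"
proof -
  \<comment> \<open>\<open>m z\<close> with column \<open>i\<close> replaced by the
    \<open>j\<close>-th unit vector.\<close>
  let ?c = "\<lambda>z. \<chi> a b. if b = i then axis j 1 $ a else m z $ a $ b"
  have eq: "matrix_inv (m z) $ i $ j = inverse (det (m z)) * det (?c z)" if "z \<in> S" for z
  proof -
    have d: "det (m z) \<noteq> 0" using inv[OF that] by (simp add: invertible_det_nz)
    have "m z *v column j (matrix_inv (m z)) = axis j 1"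
      using matrix_inv_inverse(1)[OF inv[OF that]]
      by (simp add: matrix_vector_mult_def column_def vec_eq_iff matrix_matrix_mult_def mat_def axis_def)
    then have "column j (matrix_inv (m z)) =
        (\<chi> k. det (\<chi> a b. if b = k then axis j 1 $ a else m z $ a $ b) / det (m z))"
      using cramer[OF d] by blast
    then have "column j (matrix_inv (m z)) $ i = det (?c z) / det (m z)"
      by simp
    then show ?thesis by (simp add: column_def field_simps)
  qed
  have "smooth_on S (\<lambda>z. ?c z $ a $ b)" for a b
    using m by (cases "b = i") auto
  then have "smooth_on S (\<lambda>z. inverse (det (m z)) * det (?c z))"
    using inv m
    by (intro smooth_on_mult smooth_on_inverse smooth_on_det S)
       (auto simp: invertible_det_nz)
  then show ?thesis
    by (rule smooth_on_cong[OF S, rotated]) (simp add: eq)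
qed


section \<open>Polynomials and homogeneous parts\<close>

lemma finite_multiindices_le: "finite {J::'n::finite \<Rightarrow> nat. \<forall>i. J i \<le> I i}"
proof -
  have "{J. \<forall>i. J i \<le> I i} = PiE UNIV (\<lambda>i. {..I i})" by auto
  then show ?thesis by (simp add: finite_PiE)
qed

lemma finite_multiindices_degree: "finite {I::'n::finite \<Rightarrow> nat. sum I UNIV = d}"
proof (rule finite_subset)
  show "{I::'n \<Rightarrow> nat. sum I UNIV = d} \<subseteq> {I. \<forall>i. I i \<le> d}"
    by (auto intro: member_le_sum)
qed (rule finite_multiindices_le)

lemma monom_at_add: "monom_at (\<lambda>i. I i + J i) v = monom_at I v * monom_at J v"
  by (simp add: monom_at_def power_add prod.distrib)

lemma monom_at_0: "monom_at (\<lambda>_. 0) v = 1"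
  by (simp add: monom_at_def)

lemma monom_at_single: "monom_at ((\<lambda>_. 0)(i := 1)) v = v $ i"
proof -
  have "monom_at ((\<lambda>_. 0)(i := 1)) v = (\<Prod>j\<in>UNIV. if j = i then v $ j else 1)"
    unfolding monom_at_def by (rule prod.cong) auto
  then show ?thesis by (simp add: prod.delta)
qed

lemma smooth_on_monom_at:
  "open S \<Longrightarrow> (\<And>i. smooth_on S (\<lambda>w. h w $ i)) \<Longrightarrow> smooth_on S (\<lambda>w. monom_at I (h w))"
  unfolding monom_at_def by (intro smooth_on_prod smooth_on_power)

lemma differentiable_monom_at: "monom_at I differentiable (at v)"
  using smooth_on_imp_differentiable[OF open_UNIV smooth_on_monom_at[of UNIV "\<lambda>w. w" I]] by simp

text \<open>For \<open>I i = 0\<close> the truncated exponent is harmless, since the factor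
  \<open>real (I i)\<close> vanishes.\<close>

lemma partial_monom_at:
  "partial i (monom_at I) v = real (I i) * monom_at (I(i := I i - 1)) v"
proof -
  let ?c = "\<Prod>j\<in>UNIV - {i}. (v $ j) ^ I j"
  have 1: "monom_at I (v + t *\<^sub>R axis i 1) = (v $ i + t) ^ I i * ?c" for t
  proof -
    have "monom_at I (v + t *\<^sub>R axis i 1) =
        ((v + t *\<^sub>R axis i 1) $ i) ^ I i * (\<Prod>j\<in>UNIV - {i}. ((v + t *\<^sub>R axis i 1) $ j) ^ I j)"
      unfolding monom_at_def by (simp add: prod.remove[of UNIV i])
    also have "\<dots> = (v $ i + t) ^ I i * ?c"
      by (auto simp: axis_def intro!: prod.cong)
    finally show ?thesis .
  qed
  have 2: "monom_at (I(i := I i - 1)) v = (v $ i) ^ (I i - 1) * ?c"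
    unfolding monom_at_def by (simp add: prod.remove[of UNIV i])
  have "((\<lambda>t. (v $ i + t) ^ I i * ?c) has_field_derivative real (I i) * ((v $ i) ^ (I i - 1) * ?c)) (at 0)"
    by (auto intro!: derivative_eq_intros)
  then show ?thesis
    unfolding partial_def 1 2 by (rule DERIV_imp_deriv)
qed

lemma sum_multiindex_Suc:
  "sum (J(i := J i + 1)) UNIV = Suc (sum (J::'n::finite \<Rightarrow> nat) UNIV)"
  by (simp add: sum.remove[of UNIV i])

lemma homogeneous_part_0: "homogeneous_part F 0 z p y = F (\<lambda>_. 0) z p"
proof -
  have "{I::'a \<Rightarrow> nat. sum I UNIV = 0} = {\<lambda>_. 0}" by (auto simp: fun_eq_iff)
  then show ?thesis by (simp add: homogeneous_part_def monom_at_0)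
qed

lemma homogeneous_part_add:
  "homogeneous_part (F + G) d z p y = homogeneous_part F d z p y + homogeneous_part G d z p y"
  by (simp add: homogeneous_part_def sum.distrib distrib_right)

lemma homogeneous_part_scale:
  "homogeneous_part (series_scale c F) d z p y = c * homogeneous_part F d z p y"
  by (simp add: homogeneous_part_def series_scale_def sum_distrib_left mult.assoc)

text \<open>Regroups the Cauchy product over multiindices by total degree, where it becomes the
  Cauchy product of power series in one variable. This is what makes evaluation
  multiplicative.\<close>

lemma homogeneous_part_mult:
  "homogeneous_part (F \<odot> G) d z p y =
     (\<Sum>e\<in>{0..d}. homogeneous_part F e z p y * homogeneous_part G (d - e) z p y)"
proof -
  let ?D = "\<lambda>d. {I::'a \<Rightarrow> nat. sum I UNIV = d}"
  let ?L = "\<lambda>I. {J::'a \<Rightarrow> nat. \<forall>i. J i \<le> I i}"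
  have "homogeneous_part (F \<odot> G) d z p y =
    (\<Sum>I\<in>?D d. \<Sum>J\<in>?L I. F J z p * G (\<lambda>i. I i - J i) z p * monom_at I y)"
    by (simp add: homogeneous_part_def series_mult_def sum_distrib_right)
  also have "\<dots> = (\<Sum>(I, J)\<in>Sigma (?D d) ?L. F J z p * G (\<lambda>i. I i - J i) z p * monom_at I y)"
    by (rule sum.Sigma) (auto simp: finite_multiindices_degree finite_multiindices_le)
  also have "\<dots> = (\<Sum>(e, J, K)\<in>Sigma {0..d} (\<lambda>e. ?D e \<times> ?D (d - e)).
      (F J z p * monom_at J y) * (G K z p * monom_at K y))"
  proof (rule sum.reindex_bij_witness[of _ "\<lambda>(e, J, K). (\<lambda>i. J i + K i, J)"
        "\<lambda>(I, J). (sum J UNIV, J, \<lambda>i. I i - J i)"], goal_cases)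
    case (1 a)
    then show ?case by (auto simp: fun_eq_iff)
  next
    case (2 a)
    then show ?case
      by (auto simp: sum_subtractf_nat intro!: sum_mono)
  next
    case (3 b)
    then show ?case by auto
  next
    case (4 b)
    then show ?case by (auto simp: sum.distrib)
  next
    case (5 a)
    then obtain I J where a: "a = (I, J)" "\<And>i. J i \<le> I i" by auto
    then have "I = (\<lambda>i. J i + (I i - J i))" by auto
    then have "monom_at I y = monom_at J y * monom_at (\<lambda>i. I i - J i) y"
      using monom_at_add by metis
    then show ?case by (simp add: a)
  qed
  also have "\<dots> = (\<Sum>e\<in>{0..d}. \<Sum>(J, K)\<in>?D e \<times> ?D (d - e).
      (F J z p * monom_at J y) * (G K z p * monom_at K y))"
    by (subst sum.Sigma) (auto simp: finite_multiindices_degree split_def)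
  also have "\<dots> = (\<Sum>e\<in>{0..d}. homogeneous_part F e z p y * homogeneous_part G (d - e) z p y)"
    by (simp add: homogeneous_part_def sum_product sum.cartesian_product)
  finally show ?thesis .
qed

text \<open>The drop from degree \<open>Suc d\<close> to \<open>d\<close> is the origin of the extra
  factor \<open>fps_X\<close> in derivatives along \<open>y\<close>.\<close>

lemma partial_homogeneous_part_Suc:
  "partial i (homogeneous_part F (Suc d) z p) y = homogeneous_part (deriv_along V (Y i) F) d z p y"
proof -
  let ?D = "\<lambda>d. {I::'a \<Rightarrow> nat. sum I UNIV = d}"
  have "partial i (homogeneous_part F (Suc d) z p) y =
    (\<Sum>I\<in>?D (Suc d). F I z p * (real (I i) * monom_at (I(i := I i - 1)) y))"
    unfolding homogeneous_part_def
    by (simp add: partial_sum differentiable_monom_at partial_mult partial_monom_at)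
  \<comment> \<open>Multiindices with \<open>I i = 0\<close> contribute nothing, and they have to go
    because truncated subtraction would not lower their degree; on the others it is a bijection onto
    degree \<open>d\<close>.\<close>
  also have "\<dots> = (\<Sum>I\<in>{I\<in>?D (Suc d). I i > 0}. F I z p * (real (I i) * monom_at (I(i := I i - 1)) y))"
    by (rule sum.mono_neutral_right) (auto simp: finite_multiindices_degree)
  also have "\<dots> = (\<Sum>J\<in>?D d. (real (J i + 1) * F (J(i := J i + 1)) z p) * monom_at J y)"
  proof (rule sum.reindex_bij_witness[of _ "\<lambda>J. J(i := J i + 1)" "\<lambda>I. I(i := I i - 1)"], goal_cases)
    case (2 I)
    then have "Suc d = sum ((I(i := I i - 1))(i := (I(i := I i - 1)) i + 1)) UNIV" by simp
    then show ?case unfolding sum_multiindex_Suc by simp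
  next
    case (4 J)
    then show ?case using sum_multiindex_Suc[of J i] by simp
  qed (auto simp: mult_ac)
  also have "\<dots> = homogeneous_part (deriv_along V (Y i) F) d z p y"
    by (simp add: homogeneous_part_def)
  finally show ?thesis .
qed

text \<open>Differentiating along a \<open>y\<close> that occurs in the monomial lowers the degree
  and keeps the coefficient up to a positive factor, until in degree 0 the coefficient is the value
  itself. Injectivity of evaluation rests on this.\<close>

lemma homogeneous_part_eq_0_imp:
  "(\<And>y. homogeneous_part F d z p y = 0) \<Longrightarrow> sum I UNIV = d \<Longrightarrow> F I z p = 0"
proof (induction d arbitrary: F I)
  case 0
  then have "I = (\<lambda>_. 0)" by (auto simp: fun_eq_iff)
  then show ?case using 0(1) by (simp add: homogeneous_part_0)
next
  case (Suc d)
  then obtain i where i: "I i > 0" by (metis gr_zeroI nat.distinct(1) sum.neutral)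
  let ?J = "I(i := I i - 1)"
  have IJ: "I = ?J(i := ?J i + 1)" using i by auto
  have "homogeneous_part (deriv_along UNIV (Y i) F) d z p y = 0" for y
  proof -
    have "homogeneous_part F (Suc d) z p = (\<lambda>y. 0)" using Suc.prems(1) by auto
    then show ?thesis
      using partial_homogeneous_part_Suc[of i F d z p y UNIV] by simp
  qed
  moreover have "sum ?J UNIV = d"
    using Suc.prems(2) IJ sum_multiindex_Suc[of ?J i] by simp
  ultimately have "deriv_along UNIV (Y i) F ?J z p = 0" by (rule Suc.IH)
  then have "real (?J i + 1) * F (?J(i := ?J i + 1)) z p = 0" by simp
  then show ?case using IJ i by simp
qed


section \<open>The algebra of local functions\<close>

text \<open>The condition that \<open>local_functions\<close> puts on a single coefficient, isolated
  so that closure can be proved coefficient by coefficient.\<close>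

definition poly_coeff :: "(real^'n::finite) set \<Rightarrow> (real^'n \<Rightarrow> real^'n \<Rightarrow> real) \<Rightarrow> bool" where
  "poly_coeff V f \<longleftrightarrow> (\<exists>N c. finite N \<and> (\<forall>J\<in>N. smooth_on V (c J)) \<and>
     (\<forall>z\<in>V. \<forall>p. f z p = (\<Sum>J\<in>N. c J z * monom_at J p)))"

lemma local_functions_iff:
  "F \<in> local_functions V \<longleftrightarrow> (\<forall>I. poly_coeff V (F I)) \<and> (\<forall>I z p. z \<notin> V \<longrightarrow> F I z p = 0)"
  by (auto simp: local_functions_def poly_coeff_def)

lemma poly_coeff_single: "smooth_on V c \<Longrightarrow> poly_coeff V (\<lambda>z p. c z * monom_at J p)"
  unfolding poly_coeff_def by (intro exI[of _ "{J}"] exI[of _ "\<lambda>_. c"]) simp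

lemma poly_coeff_cong:
  assumes "poly_coeff V f" "\<And>z p. z \<in> V \<Longrightarrow> g z p = f z p"
  shows "poly_coeff V g"
  using assms unfolding poly_coeff_def by metis

lemma poly_coeff_0: "poly_coeff V (\<lambda>z p. 0)"
  unfolding poly_coeff_def by (intro exI[of _ "{}"]) simp

lemma poly_coeff_add:
  assumes V: "open V" and f: "poly_coeff V f" and g: "poly_coeff V g"
  shows "poly_coeff V (\<lambda>z p. f z p + g z p)"
proof -
  obtain N c where N: "finite N" "\<And>J. J \<in> N \<Longrightarrow> smooth_on V (c J)"
    "\<And>z p. z \<in> V \<Longrightarrow> f z p = (\<Sum>J\<in>N. c J z * monom_at J p)"
    using f unfolding poly_coeff_def by blast
  obtain N' c' where N': "finite N'" "\<And>J. J \<in> N' \<Longrightarrow> smooth_on V (c' J)"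
    "\<And>z p. z \<in> V \<Longrightarrow> g z p = (\<Sum>J\<in>N'. c' J z * monom_at J p)"
    using g unfolding poly_coeff_def by blast
  \<comment> \<open>The families \<open>c\<close> and \<open>c'\<close> are arbitrary outside
    \<open>N\<close> and \<open>N'\<close>, so each is extended by zero before the index sets are
    merged.\<close>
  let ?d = "\<lambda>J z. (if J \<in> N then c J z else 0) + (if J \<in> N' then c' J z else 0)"
  have "smooth_on V (\<lambda>z. if J \<in> N then c J z else 0)" for J
    using N(2) by (cases "J \<in> N") auto
  moreover have "smooth_on V (\<lambda>z. if J \<in> N' then c' J z else 0)" for J
    using N'(2) by (cases "J \<in> N'") auto
  ultimately have "smooth_on V (?d J)" for J by (intro smooth_on_add[OF V])
  moreover have "f z p + g z p = (\<Sum>J\<in>N \<union> N'. ?d J z * monom_at J p)" if "z \<in> V" for z p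
  proof -
    have "(\<Sum>J\<in>N \<union> N'. (if J \<in> N then c J z else 0) * monom_at J p) = f z p"
      unfolding N(3)[OF that] using N(1) N'(1) by (intro sum.mono_neutral_cong_right) auto
    moreover have "(\<Sum>J\<in>N \<union> N'. (if J \<in> N' then c' J z else 0) * monom_at J p) = g z p"
      unfolding N'(3)[OF that] using N(1) N'(1) by (intro sum.mono_neutral_cong_right) auto
    ultimately show ?thesis by (simp add: distrib_right sum.distrib)
  qed
  ultimately show ?thesis
    unfolding poly_coeff_def using N(1) N'(1) by (intro exI[of _ "N \<union> N'"] exI[of _ ?d]) simp
qed

lemma poly_coeff_sum:
  "open V \<Longrightarrow> (\<And>k. k \<in> K \<Longrightarrow> poly_coeff V (f k)) \<Longrightarrow> poly_coeff V (\<lambda>z p. \<Sum>k\<in>K. f k z p)"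
  by (induction K rule: infinite_finite_induct) (simp_all add: poly_coeff_0 poly_coeff_add)

lemma poly_coeff_mult:
  assumes V: "open V" and f: "poly_coeff V f" and g: "poly_coeff V g"
  shows "poly_coeff V (\<lambda>z p. f z p * g z p)"
proof -
  obtain N c where N: "finite N" "\<And>J. J \<in> N \<Longrightarrow> smooth_on V (c J)"
    "\<And>z p. z \<in> V \<Longrightarrow> f z p = (\<Sum>J\<in>N. c J z * monom_at J p)"
    using f unfolding poly_coeff_def by blast
  obtain N' c' where N': "finite N'" "\<And>J. J \<in> N' \<Longrightarrow> smooth_on V (c' J)"
    "\<And>z p. z \<in> V \<Longrightarrow> g z p = (\<Sum>J\<in>N'. c' J z * monom_at J p)"
    using g unfolding poly_coeff_def by blast
  have "poly_coeff V (\<lambda>z p. \<Sum>J\<in>N. \<Sum>K\<in>N'. (c J z * c' K z) * monom_at (\<lambda>i. J i + K i) p)"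
    using N(2) N'(2) by (intro poly_coeff_sum poly_coeff_single smooth_on_mult V)
  then show ?thesis
  proof (rule poly_coeff_cong)
    fix z p assume "z \<in> V"
    then show "f z p * g z p = (\<Sum>J\<in>N. \<Sum>K\<in>N'. (c J z * c' K z) * monom_at (\<lambda>i. J i + K i) p)"
      unfolding N(3)[OF \<open>z \<in> V\<close>] N'(3)[OF \<open>z \<in> V\<close>] sum_product
      by (intro sum.cong refl) (simp add: monom_at_add)
  qed
qed

lemma poly_coeff_const_p: "smooth_on V c \<Longrightarrow> poly_coeff V (\<lambda>z p. c z)"
  using poly_coeff_single[of V c "\<lambda>_. 0"] by (simp add: monom_at_0)

lemma poly_coeff_p: "poly_coeff V (\<lambda>z p. p $ i)"
  using poly_coeff_single[of V "\<lambda>_. 1" "(\<lambda>_. 0)(i := 1)"] unfolding monom_at_single by simp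

lemma poly_coeff_differentiable:
  assumes "open V" "poly_coeff V f" "z \<in> V"
  shows "(\<lambda>z. f z p) differentiable (at z)" "(\<lambda>p. f z p) differentiable (at p)"
proof -
  obtain N c where N: "finite N" "\<And>J. J \<in> N \<Longrightarrow> smooth_on V (c J)"
    "\<And>z p. z \<in> V \<Longrightarrow> f z p = (\<Sum>J\<in>N. c J z * monom_at J p)"
    using assms(2) unfolding poly_coeff_def by blast
  have "(\<lambda>z. \<Sum>J\<in>N. c J z * monom_at J p) differentiable (at z)"
    using N(2) assms(1,3) by (intro differentiable_sum_at differentiable_mult) (auto intro: smooth_on_imp_differentiable)
  then show "(\<lambda>z. f z p) differentiable (at z)"
    by (rule differentiable_cong[OF assms(1,3), rotated]) (simp add: N(3))
  have "(\<lambda>p. f z p) = (\<lambda>p. \<Sum>J\<in>N. c J z * monom_at J p)"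
    using N(3) assms(3) by auto
  then show "(\<lambda>p. f z p) differentiable (at p)"
    by (simp add: differentiable_sum_at differentiable_monom_at)
qed

lemma poly_coeff_partial:
  assumes V: "open V" and f: "poly_coeff V f"
  shows "poly_coeff V (\<lambda>z p. partial i (\<lambda>z. f z p) z)" "poly_coeff V (\<lambda>z p. partial i (f z) p)"
proof -
  obtain N c where N: "finite N" "\<And>J. J \<in> N \<Longrightarrow> smooth_on V (c J)"
    "\<And>z p. z \<in> V \<Longrightarrow> f z p = (\<Sum>J\<in>N. c J z * monom_at J p)"
    using f unfolding poly_coeff_def by blast
  have d: "c J differentiable (at z)" if "J \<in> N" "z \<in> V" for J z
    using N(2) V that smooth_on_imp_differentiable by blast
  have "poly_coeff V (\<lambda>z p. \<Sum>J\<in>N. partial i (c J) z * monom_at J p)"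
    using N(2) by (intro poly_coeff_sum poly_coeff_single smooth_on_partial V)
  then show "poly_coeff V (\<lambda>z p. partial i (\<lambda>z. f z p) z)"
  proof (rule poly_coeff_cong)
    fix z p assume z: "z \<in> V"
    have "partial i (\<lambda>z. f z p) z = partial i (\<lambda>z. \<Sum>J\<in>N. c J z * monom_at J p) z"
      by (rule partial_cong[OF V z]) (rule N(3))
    then show "partial i (\<lambda>z. f z p) z = (\<Sum>J\<in>N. partial i (c J) z * monom_at J p)"
      by (simp add: partial_sum partial_mult d z)
  qed
  have "poly_coeff V (\<lambda>z p. \<Sum>J\<in>N. (c J z * real (J i)) * monom_at (J(i := J i - 1)) p)"
    using N(2) by (intro poly_coeff_sum poly_coeff_single smooth_on_mult V) auto
  then show "poly_coeff V (\<lambda>z p. partial i (f z) p)"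
  proof (rule poly_coeff_cong)
    fix z p assume z: "z \<in> V"
    have "f z = (\<lambda>p. \<Sum>J\<in>N. c J z * monom_at J p)"
      using N(3)[OF z] by auto
    then show "partial i (f z) p = (\<Sum>J\<in>N. (c J z * real (J i)) * monom_at (J(i := J i - 1)) p)"
      by (simp add: partial_sum partial_mult differentiable_monom_at partial_monom_at mult.assoc)
  qed
qed

section \<open>Closure of local functions under algebra operations and derivatives\<close>

lemma local_functions_0: "0 \<in> local_functions V"
  by (auto simp: local_functions_iff zero_fun_def poly_coeff_0)

lemma local_functions_add:
  "open V \<Longrightarrow> F \<in> local_functions V \<Longrightarrow> G \<in> local_functions V \<Longrightarrow> F + G \<in> local_functions V"
  by (auto simp: local_functions_iff plus_fun_def poly_coeff_add)

lemma local_functions_sum: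
  "open V \<Longrightarrow> (\<And>k. k \<in> K \<Longrightarrow> F k \<in> local_functions V) \<Longrightarrow> (\<Sum>k\<in>K. F k) \<in> local_functions V"
  by (induction K rule: infinite_finite_induct) (simp_all add: local_functions_0 local_functions_add)

lemma local_functions_mult:
  assumes "open V" "F \<in> local_functions V" "G \<in> local_functions V"
  shows "F \<odot> G \<in> local_functions V"
  using assms unfolding local_functions_iff series_mult_def
  by (auto intro!: poly_coeff_sum poly_coeff_mult)

lemma local_functions_scale:
  assumes "open V" "F \<in> local_functions V"
  shows "series_scale c F \<in> local_functions V"
  using assms unfolding local_functions_iff series_scale_def
  by (auto intro!: poly_coeff_mult poly_coeff_const_p)

lemma local_functions_minus:
  assumes "open V" "F \<in> local_functions V"
  shows "- F \<in> local_functions V"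
  using local_functions_scale[OF assms, of "-1"] by (simp add: series_scale_def fun_Compl_def)

lemma poly_coeff_if_const:
  "poly_coeff V f \<Longrightarrow> poly_coeff V (\<lambda>z p. if z \<in> V \<and> b then f z p else 0)"
  by (rule poly_coeff_cong[where f = "\<lambda>z p. if b then f z p else 0"]) (cases b; auto intro: poly_coeff_0)+

lemma base_fun_local: "smooth_on V f \<Longrightarrow> base_fun V f \<in> local_functions V"
  unfolding local_functions_iff base_fun_def
  using poly_coeff_if_const[OF poly_coeff_const_p[of V f]] by simp

lemma x_fun_local: "x_fun V i \<in> local_functions V"
  by (simp add: x_fun_def base_fun_local)

lemma p_fun_local: "p_fun V i \<in> local_functions V"
  by (auto simp: local_functions_iff p_fun_def intro!: poly_coeff_if_const poly_coeff_p)

lemma y_fun_local: "y_fun V i \<in> local_functions V"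
  unfolding local_functions_iff y_fun_def
  using poly_coeff_if_const[OF poly_coeff_const_p[of V "\<lambda>_. 1"]] by simp

lemma deriv_along_local:
  assumes V: "open V" and F: "F \<in> local_functions V"
  shows "deriv_along V a F \<in> local_functions V"
proof (cases a)
  case (X i)
  then show ?thesis
    using F poly_coeff_if_const[of V _ True] poly_coeff_partial(1)[OF V] by (simp add: local_functions_iff)
next
  case (P i)
  \<comment> \<open>\<open>deriv_along\<close> does not cut off derivatives along \<open>P\<close>
    outside \<open>V\<close>, so their vanishing there has to come from \<open>F\<close>.\<close>
  have "(\<lambda>p. F I z p) = (\<lambda>p. 0)" if "z \<notin> V" for I z
    using F that by (auto simp: local_functions_iff)
  then show ?thesis
    using P F poly_coeff_partial(2)[OF V] by (simp add: local_functions_iff)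
next
  case (Y i)
  then show ?thesis
    using F by (auto simp: local_functions_iff intro!: poly_coeff_mult[OF V] poly_coeff_const_p)
qed


section \<open>Formal power series in \<open>y\<close> as functions on the total space\<close>

lemma UNIV_coord: "(UNIV :: 'n coord set) = range X \<union> (range P \<union> range Y)"
  by (metis UNIV_eq_I UnCI coord.exhaust rangeI)

text \<open>Makes \<open>real^'n coord\<close> a Euclidean space that serves as the total space, so
  that \<open>partial\<close> and \<open>smooth_on\<close> apply to it with a coordinate as
  index.\<close>

instance coord :: (finite) finite
  by standard (simp add: UNIV_coord)

lemma sum_coord:
  "(\<Sum>a\<in>UNIV. f a) = (\<Sum>i\<in>UNIV. f (X i)) + (\<Sum>i\<in>UNIV. f (P i)) + (\<Sum>i\<in>UNIV. f (Y (i::'n::finite)))"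
proof -
  have "(\<Sum>a\<in>UNIV. f a) = sum f (range X) + (sum f (range P) + sum f (range (Y::'n \<Rightarrow> _)))"
    unfolding UNIV_coord by (subst sum.union_disjoint; (subst sum.union_disjoint)?) auto
  moreover have "sum f (range X) = (\<Sum>i\<in>UNIV. f (X (i::'n)))"
    "sum f (range P) = (\<Sum>i\<in>UNIV. f (P (i::'n)))" "sum f (range Y) = (\<Sum>i\<in>UNIV. f (Y (i::'n)))"
    by (auto simp: sum.reindex inj_on_def)
  ultimately show ?thesis by (simp add: add.assoc)
qed

definition xpart :: "real^'n coord \<Rightarrow> real^'n" where "xpart w = (\<chi> i. w $ X i)"
definition ppart :: "real^'n coord \<Rightarrow> real^'n" where "ppart w = (\<chi> i. w $ P i)"
definition ypart :: "real^'n coord \<Rightarrow> real^'n" where "ypart w = (\<chi> i. w $ Y i)"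

definition point :: "real^'n \<Rightarrow> real^'n \<Rightarrow> real^'n \<Rightarrow> real^'n coord" where
  "point z p y = (\<chi> a. case a of X i \<Rightarrow> z $ i | P i \<Rightarrow> p $ i | Y i \<Rightarrow> y $ i)"

lemma part_nth [simp]: "xpart w $ i = w $ X i" "ppart w $ i = w $ P i" "ypart w $ i = w $ Y i"
  by (simp_all add: xpart_def ppart_def ypart_def)

lemma point_nth [simp]: "point z p y $ X i = z $ i" "point z p y $ P i = p $ i" "point z p y $ Y i = y $ i"
  by (simp_all add: point_def)

lemma part_point [simp]: "xpart (point z p y) = z" "ppart (point z p y) = p" "ypart (point z p y) = y"
  by (simp_all add: vec_eq_iff)

lemma part_axis:
  "xpart (w + t *\<^sub>R axis (X i) 1) = xpart w + t *\<^sub>R axis i 1"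
  "ppart (w + t *\<^sub>R axis (X i) 1) = ppart w" "ypart (w + t *\<^sub>R axis (X i) 1) = ypart w"
  "xpart (w + t *\<^sub>R axis (P i) 1) = xpart w"
  "ppart (w + t *\<^sub>R axis (P i) 1) = ppart w + t *\<^sub>R axis i 1" "ypart (w + t *\<^sub>R axis (P i) 1) = ypart w"
  "xpart (w + t *\<^sub>R axis (Y i) 1) = xpart w"
  "ppart (w + t *\<^sub>R axis (Y i) 1) = ppart w" "ypart (w + t *\<^sub>R axis (Y i) 1) = ypart w + t *\<^sub>R axis i 1"
  by (simp_all add: vec_eq_iff axis_def)

lemma partial_coord:
  "partial (X i) (\<lambda>w. f (xpart w) (ppart w) (ypart w)) w = partial i (\<lambda>z. f z (ppart w) (ypart w)) (xpart w)"
  "partial (P i) (\<lambda>w. f (xpart w) (ppart w) (ypart w)) w = partial i (\<lambda>p. f (xpart w) p (ypart w)) (ppart w)"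
  "partial (Y i) (\<lambda>w. f (xpart w) (ppart w) (ypart w)) w = partial i (\<lambda>y. f (xpart w) (ppart w) y) (ypart w)"
  by (simp_all add: partial_def part_axis)

definition total_over :: "(real^'n) set \<Rightarrow> (real^'n coord) set" where
  "total_over V = {w. xpart w \<in> V}"

lemma open_total_over: "open V \<Longrightarrow> open (total_over (V :: (real^'n::finite) set))"
proof -
  assume V: "open V"
  have "continuous_on UNIV (xpart :: real^'n coord \<Rightarrow> real^'n)"
    unfolding xpart_def[abs_def] by (intro continuous_intros)
  from open_vimage[OF V this] show ?thesis by (simp add: total_over_def vimage_def)
qed

lemma smooth_on_xpart:
  fixes V :: "(real^'n::finite) set"
  assumes V: "open V" and f: "smooth_on V f"
  shows "smooth_on (total_over V) (\<lambda>w. f (xpart w))"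
  by (rule smooth_on_compose[OF open_total_over[OF V] V _ _ f]) (simp_all add: total_over_def)

section \<open>Evaluation as an injective homomorphism into power series\<close>

definition eval_series :: "'n::finite series \<Rightarrow> real^'n coord \<Rightarrow> real fps" where
  "eval_series F w = Abs_fps (\<lambda>d. homogeneous_part F d (xpart w) (ppart w) (ypart w))"

lemma eval_series_nth:
  "fps_nth (eval_series F w) d = homogeneous_part F d (xpart w) (ppart w) (ypart w)"
  by (simp add: eval_series_def)

lemma eval_series_add: "eval_series (F + G) w = eval_series F w + eval_series G w"
  by (rule fps_ext) (simp add: eval_series_nth homogeneous_part_add)

lemma eval_series_0 [simp]: "eval_series 0 w = 0"
  by (rule fps_ext) (simp add: eval_series_nth homogeneous_part_def)

lemma eval_series_minus: "eval_series (- F) w = - eval_series F w"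
  using eval_series_add[of F "- F" w] by (simp add: eq_neg_iff_add_eq_0 add.commute)

lemma eval_series_sum: "eval_series (\<Sum>k\<in>K. F k) w = (\<Sum>k\<in>K. eval_series (F k) w)"
  using sum_comp_morphism[of "\<lambda>F. eval_series F w" F K] by (simp add: eval_series_add o_def)

lemma eval_series_scale: "eval_series (series_scale c F) w = fps_const c * eval_series F w"
  by (rule fps_ext) (simp add: eval_series_nth homogeneous_part_scale)

lemma eval_series_mult: "eval_series (F \<odot> G) w = eval_series F w * eval_series G w"
  by (rule fps_ext) (simp add: eval_series_nth homogeneous_part_mult fps_mult_nth)

lemma eval_series_inject:
  assumes "\<And>w. eval_series F w = eval_series G w"
  shows "F = G"
proof -
  have 0: "eval_series (F + - G) w = 0" for w
    using assms unfolding eval_series_add eval_series_minus by simp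
  have "(F + - G) I z p = 0" for I z p
  proof (rule homogeneous_part_eq_0_imp[OF _ refl])
    fix y
    show "homogeneous_part (F + - G) (sum I UNIV) z p y = 0"
      using arg_cong[OF 0[of "point z p y"], of "\<lambda>f. fps_nth f (sum I UNIV)"]
      unfolding eval_series_nth by simp
  qed
  then show ?thesis by (simp add: fun_eq_iff)
qed

lemma eval_series_outside:
  "F \<in> local_functions V \<Longrightarrow> w \<notin> total_over V \<Longrightarrow> eval_series F w = 0"
  by (rule fps_ext) (simp add: eval_series_nth homogeneous_part_def local_functions_iff total_over_def)

text \<open>Outside \<open>V\<close> all local functions vanish by convention, so only points over
  \<open>V\<close> count. All identities for the local bracket are proved through this
  principle.\<close>

lemma local_functions_eqI:
  assumes "F \<in> local_functions V" "G \<in> local_functions V"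
    and "\<And>w. w \<in> total_over V \<Longrightarrow> eval_series F w = eval_series G w"
  shows "F = G"
proof (rule eval_series_inject)
  show "eval_series F w = eval_series G w" for w
    using assms eval_series_outside[of _ V w] by (cases "w \<in> total_over V") auto
qed

lemma smooth_on_eval_series:
  assumes V: "open V" and F: "F \<in> local_functions V"
  shows "smooth_on (total_over V) (\<lambda>w. fps_nth (eval_series F w) d)"
proof -
  note W = open_total_over[OF V]
  have "smooth_on (total_over V) (\<lambda>w. F I (xpart w) (ppart w))" for I
  proof -
    obtain N c where N: "finite N" "\<And>J. J \<in> N \<Longrightarrow> smooth_on V (c J)"
      "\<And>z p. z \<in> V \<Longrightarrow> F I z p = (\<Sum>J\<in>N. c J z * monom_at J p)"
      using F unfolding local_functions_iff poly_coeff_def by metis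
    have "smooth_on (total_over V) (\<lambda>w. \<Sum>J\<in>N. c J (xpart w) * monom_at J (ppart w))"
      by (intro smooth_on_sum smooth_on_mult smooth_on_xpart smooth_on_monom_at V W N(2)) simp_all
    then show ?thesis
      by (rule smooth_on_cong[OF W, rotated]) (simp add: N(3) total_over_def)
  qed
  then show ?thesis
    unfolding eval_series_nth homogeneous_part_def
    by (intro smooth_on_sum smooth_on_mult smooth_on_monom_at W) simp_all
qed

lemma differentiable_eval_series:
  "open V \<Longrightarrow> F \<in> local_functions V \<Longrightarrow> w \<in> total_over V \<Longrightarrow>
    (\<lambda>w. fps_nth (eval_series F w) d) differentiable (at w)"
  using smooth_on_imp_differentiable[OF open_total_over smooth_on_eval_series] by blast

lemma eval_series_base:
  fixes V :: "(real^'n::finite) set"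
  assumes "w \<in> total_over V"
  shows "eval_series (base_fun V f) w = fps_const (f (xpart w))"
proof (rule fps_ext)
  fix d
  have "fps_nth (eval_series (base_fun V f) w) d =
      (\<Sum>I\<in>{I::'n \<Rightarrow> nat. sum I UNIV = d}. if I = (\<lambda>_. 0) then f (xpart w) else 0)"
    using assms unfolding eval_series_nth homogeneous_part_def
    by (intro sum.cong refl) (auto simp: base_fun_def monom_at_0 total_over_def)
  then show "fps_nth (eval_series (base_fun V f) w) d = fps_nth (fps_const (f (xpart w))) d"
    by (simp add: sum.delta finite_multiindices_degree)
qed

lemma eval_series_p:
  fixes V :: "(real^'n::finite) set"
  assumes "w \<in> total_over V"
  shows "eval_series (p_fun V i) w = fps_const (w $ P i)"
proof (rule fps_ext)
  fix d
  have "fps_nth (eval_series (p_fun V i) w) d =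
      (\<Sum>I\<in>{I::'n \<Rightarrow> nat. sum I UNIV = d}. if I = (\<lambda>_. 0) then w $ P i else 0)"
    using assms unfolding eval_series_nth homogeneous_part_def
    by (intro sum.cong refl) (auto simp: p_fun_def monom_at_0 total_over_def)
  then show "fps_nth (eval_series (p_fun V i) w) d = fps_nth (fps_const (w $ P i)) d"
    by (simp add: sum.delta finite_multiindices_degree)
qed

lemma eval_series_y:
  assumes "w \<in> total_over V"
  shows "eval_series (y_fun V i) w = fps_X * fps_const (w $ Y i)"
proof (rule fps_ext)
  fix d
  have "fps_nth (eval_series (y_fun V i) w) d =
      (\<Sum>I\<in>{I. sum I UNIV = d}. if I = (\<lambda>_. 0)(i := 1) then w $ Y i else 0)"
    using assms unfolding eval_series_nth homogeneous_part_def
    by (intro sum.cong refl) (auto simp: y_fun_def monom_at_single[unfolded One_nat_def] total_over_def)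
  then show "fps_nth (eval_series (y_fun V i) w) d = fps_nth (fps_X * fps_const (w $ Y i)) d"
    by (auto simp: sum.delta finite_multiindices_degree sum_multiindex_Suc[of "\<lambda>_. 0", simplified])
qed


section \<open>Derivations\<close>

definition fps_partial :: "'n::finite coord \<Rightarrow> (real^'n coord \<Rightarrow> real fps) \<Rightarrow> real^'n coord \<Rightarrow> real fps" where
  "fps_partial a \<Phi> w = Abs_fps (\<lambda>d. partial a (\<lambda>w. fps_nth (\<Phi> w) d) w)"

lemma fps_partial_add:
  assumes "\<And>d. (\<lambda>w. fps_nth (\<Phi> w) d) differentiable (at w)" "\<And>d. (\<lambda>w. fps_nth (\<Psi> w) d) differentiable (at w)"
  shows "fps_partial a (\<lambda>w. \<Phi> w + \<Psi> w) w = fps_partial a \<Phi> w + fps_partial a \<Psi> w"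
  by (rule fps_ext) (simp add: fps_partial_def partial_add assms)

lemma fps_partial_mult:
  assumes "\<And>d. (\<lambda>w. fps_nth (\<Phi> w) d) differentiable (at w)" "\<And>d. (\<lambda>w. fps_nth (\<Psi> w) d) differentiable (at w)"
  shows "fps_partial a (\<lambda>w. \<Phi> w * \<Psi> w) w = fps_partial a \<Phi> w * \<Psi> w + \<Phi> w * fps_partial a \<Psi> w"
  by (rule fps_ext)
     (simp add: fps_partial_def fps_mult_nth partial_sum partial_mult assms sum.distrib)

lemma fps_partial_cong:
  assumes "open S" "w \<in> S" "\<And>w. w \<in> S \<Longrightarrow> \<Phi> w = \<Psi> w"
  shows "fps_partial a \<Phi> w = fps_partial a \<Psi> w"
proof (rule fps_ext)
  fix d
  have "partial a (\<lambda>w. fps_nth (\<Phi> w) d) w = partial a (\<lambda>w. fps_nth (\<Psi> w) d) w"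
    by (rule partial_cong[OF assms(1,2)]) (simp add: assms(3))
  then show "fps_nth (fps_partial a \<Phi> w) d = fps_nth (fps_partial a \<Psi> w) d"
    by (simp add: fps_partial_def)
qed

text \<open>
  The degree in \<open>y\<close> is recorded by powers of \<open>fps_X\<close>, so a derivative along \<open>y\<close> of the
  evaluated series carries one factor \<open>fps_X\<close> too many.
\<close>

definition weight :: "'n coord \<Rightarrow> real fps" where
  "weight a = (case a of Y i \<Rightarrow> fps_X | _ \<Rightarrow> 1)"

lemma weight_nonzero: "weight a \<noteq> 0"
  by (simp add: weight_def split: coord.split)

lemma weight_simps [simp]: "weight (X i) = 1" "weight (P i) = 1" "weight (Y i) = fps_X"
  by (simp_all add: weight_def)

text \<open>Links the formal derivatives, which shift or differentiate coefficients, with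
  derivatives of calculus on the total space.\<close>

lemma weight_deriv_along:
  assumes V: "open V" and F: "F \<in> local_functions V" and w: "w \<in> total_over V"
  shows "weight a * eval_series (deriv_along V a F) w = fps_partial a (eval_series F) w"
proof (rule fps_ext)
  fix d
  have z: "xpart w \<in> V" using w by (simp add: total_over_def)
  have pc: "poly_coeff V (F I)" for I using F by (simp add: local_functions_iff)
  note diff = poly_coeff_differentiable[OF V pc z]
  let ?h = "homogeneous_part F d"
  have "fps_nth (fps_partial a (eval_series F) w) d = partial a (\<lambda>w. ?h (xpart w) (ppart w) (ypart w)) w"
    by (simp add: fps_partial_def eval_series_nth)
  also have "\<dots> = fps_nth (weight a * eval_series (deriv_along V a F) w) d"
  proof (cases a)
    case (X i)
    have "partial i (\<lambda>z. ?h z (ppart w) (ypart w)) (xpart w) =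
        homogeneous_part (deriv_along V (X i) F) d (xpart w) (ppart w) (ypart w)"
      unfolding homogeneous_part_def by (simp add: partial_sum partial_mult diff z)
    then show ?thesis using X by (simp add: partial_coord eval_series_nth)
  next
    case (P i)
    have "partial i (\<lambda>p. ?h (xpart w) p (ypart w)) (ppart w) =
        homogeneous_part (deriv_along V (P i) F) d (xpart w) (ppart w) (ypart w)"
      unfolding homogeneous_part_def by (simp add: partial_sum partial_mult diff)
    then show ?thesis using P by (simp add: partial_coord eval_series_nth)
  next
    case (Y i)
    have *: "partial a (\<lambda>w. ?h (xpart w) (ppart w) (ypart w)) w = partial i (\<lambda>y. ?h (xpart w) (ppart w) y) (ypart w)"
      unfolding Y partial_coord ..
    show ?thesis
    proof (cases d)
      \<comment> \<open>In degree 0 both sides vanish: the homogeneous part does not depend on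
        \<open>y\<close>, and \<open>fps_X\<close> has no constant term.\<close>
      case 0
      have "(\<lambda>y. ?h (xpart w) (ppart w) y) = (\<lambda>y. F (\<lambda>_. 0) (xpart w) (ppart w))"
        unfolding 0 homogeneous_part_0 ..
      then show ?thesis unfolding * using 0 Y by simp
    next
      case (Suc e)
      then show ?thesis
        unfolding * using Y partial_homogeneous_part_Suc[of i F e "xpart w" "ppart w" "ypart w" V]
        by (simp add: eval_series_nth)
    qed
  qed
  finally show "fps_nth (weight a * eval_series (deriv_along V a F) w) d =
    fps_nth (fps_partial a (eval_series F) w) d" ..
qed

context
  fixes V :: "(real^'n::finite) set"
  assumes V: "open V"
begin

lemma deriv_along_add:
  assumes F: "F \<in> local_functions V" and G: "G \<in> local_functions V" and w: "w \<in> total_over V"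
  shows "eval_series (deriv_along V a (F + G)) w = eval_series (deriv_along V a F) w + eval_series (deriv_along V a G) w"
proof -
  have "weight a * eval_series (deriv_along V a (F + G)) w =
      weight a * (eval_series (deriv_along V a F) w + eval_series (deriv_along V a G) w)"
    unfolding distrib_left weight_deriv_along[OF V local_functions_add[OF V F G] w]
      weight_deriv_along[OF V F w] weight_deriv_along[OF V G w] eval_series_add[abs_def]
    by (intro fps_partial_add differentiable_eval_series[OF V _ w] F G)
  then show ?thesis using weight_nonzero[of a] by simp
qed

text \<open>The product rule of calculus differentiates one factor at a time, so both terms carry
  the same factor \<open>weight a\<close>, which cancels.\<close>

lemma deriv_along_mult:
  assumes F: "F \<in> local_functions V" and G: "G \<in> local_functions V" and w: "w \<in> total_over V"
  shows "eval_series (deriv_along V a (F \<odot> G)) w =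
    eval_series (deriv_along V a F) w * eval_series G w + eval_series F w * eval_series (deriv_along V a G) w"
proof -
  have "weight a * eval_series (deriv_along V a (F \<odot> G)) w =
      weight a * eval_series (deriv_along V a F) w * eval_series G w +
      eval_series F w * (weight a * eval_series (deriv_along V a G) w)"
    unfolding weight_deriv_along[OF V local_functions_mult[OF V F G] w]
      weight_deriv_along[OF V F w] weight_deriv_along[OF V G w] eval_series_mult[abs_def]
    by (intro fps_partial_mult differentiable_eval_series[OF V _ w] F G)
  also have "\<dots> = weight a * (eval_series (deriv_along V a F) w * eval_series G w +
      eval_series F w * eval_series (deriv_along V a G) w)"
    by (simp add: algebra_simps)
  finally show ?thesis using weight_nonzero[of a] by simp
qed

lemma deriv_along_scale:
  assumes F: "F \<in> local_functions V" and w: "w \<in> total_over V"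
  shows "eval_series (deriv_along V a (series_scale c F)) w = fps_const c * eval_series (deriv_along V a F) w"
proof -
  have "weight a * eval_series (deriv_along V a (series_scale c F)) w =
      weight a * (fps_const c * eval_series (deriv_along V a F) w)"
    unfolding weight_deriv_along[OF V local_functions_scale[OF V F] w] mult.left_commute[of "weight a"]
      weight_deriv_along[OF V F w] eval_series_scale[abs_def]
    by (subst fps_partial_mult) (auto intro: differentiable_eval_series[OF V F w] simp: fps_partial_def fps_zero_def)
  then show ?thesis using weight_nonzero[of a] by simp
qed

lemma deriv_along_0: "deriv_along V a 0 = 0"
  by (cases a) (simp_all add: fun_eq_iff partial_def)

lemma deriv_along_sum:
  assumes "\<And>k. k \<in> K \<Longrightarrow> F k \<in> local_functions V" and w: "w \<in> total_over V"
  shows "eval_series (deriv_along V a (\<Sum>k\<in>K. F k)) w = (\<Sum>k\<in>K. eval_series (deriv_along V a (F k)) w)"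
  using assms(1)
proof (induction K rule: infinite_finite_induct)
  case (insert k K)
  then show ?case
    unfolding sum.insert[OF insert.hyps]
    by (subst deriv_along_add) (auto intro: w local_functions_sum V)
qed (simp_all add: deriv_along_0)

text \<open>Iterating \<open>weight_deriv_along\<close> produces the factor
  \<open>weight b * weight a\<close> in either order, so symmetry of the mixed derivatives of the
  smooth coefficients survives its cancellation.\<close>

lemma deriv_along_commute:
  assumes F: "F \<in> local_functions V" and w: "w \<in> total_over V"
  shows "eval_series (deriv_along V a (deriv_along V b F)) w = eval_series (deriv_along V b (deriv_along V a F)) w"
proof -
  note W = open_total_over[OF V]
  have 2: "weight b * (weight a * eval_series (deriv_along V a (deriv_along V b F)) w) =
      fps_partial a (fps_partial b (eval_series F)) w" for a b
  proof -
    have "fps_partial a (fps_partial b (eval_series F)) w =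
      fps_partial a (\<lambda>w. weight b * eval_series (deriv_along V b F) w) w"
      by (rule fps_partial_cong[OF W w]) (simp add: weight_deriv_along[OF V F])
    also have "\<dots> = weight b * fps_partial a (eval_series (deriv_along V b F)) w"
      by (subst fps_partial_mult)
         (auto intro: differentiable_eval_series[OF V deriv_along_local[OF V F] w] simp: fps_partial_def fps_zero_def)
    finally show ?thesis
      by (simp add: weight_deriv_along[OF V deriv_along_local[OF V F] w])
  qed
  have "fps_partial a (fps_partial b (eval_series F)) w = fps_partial b (fps_partial a (eval_series F)) w"
    by (rule fps_ext)
       (simp add: fps_partial_def smooth_on_partial_commute[OF W smooth_on_eval_series[OF V F] w])
  then have "weight b * weight a * eval_series (deriv_along V a (deriv_along V b F)) w =
      weight b * weight a * eval_series (deriv_along V b (deriv_along V a F)) w"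
    using 2[of b a] 2[of a b] by (simp add: mult_ac)
  then show ?thesis using weight_nonzero[of a] weight_nonzero[of b] by simp
qed

end


section \<open>The Jacobi identity\<close>

text \<open>The relabellings used in the Jacobi identity: the first two bring the cyclic terms to
  the common factor \<open>f a * g c * h d\<close>, the third matches the two kinds of terms with
  second derivatives.\<close>

lemma sum4_permute:
  fixes t :: "'i::finite \<Rightarrow> 'i \<Rightarrow> 'i \<Rightarrow> 'i \<Rightarrow> 'r::comm_monoid_add"
  shows "(\<Sum>a\<in>UNIV. \<Sum>b\<in>UNIV. \<Sum>c\<in>UNIV. \<Sum>d\<in>UNIV. t a b c d) = (\<Sum>a\<in>UNIV. \<Sum>b\<in>UNIV. \<Sum>c\<in>UNIV. \<Sum>d\<in>UNIV. t c b d a)"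
    and "(\<Sum>a\<in>UNIV. \<Sum>b\<in>UNIV. \<Sum>c\<in>UNIV. \<Sum>d\<in>UNIV. t a b c d) = (\<Sum>a\<in>UNIV. \<Sum>b\<in>UNIV. \<Sum>c\<in>UNIV. \<Sum>d\<in>UNIV. t d b a c)"
    and "(\<Sum>a\<in>UNIV. \<Sum>b\<in>UNIV. \<Sum>c\<in>UNIV. \<Sum>d\<in>UNIV. t a b c d) = (\<Sum>a\<in>UNIV. \<Sum>b\<in>UNIV. \<Sum>c\<in>UNIV. \<Sum>d\<in>UNIV. t c d b a)"
proof -
  have r: "(\<Sum>(a, b, c, d)\<in>UNIV. t a b c d) = (\<Sum>q\<in>UNIV. case \<sigma> q of (a, b, c, d) \<Rightarrow> t a b c d)"
    if "bij \<sigma>" for \<sigma> :: "'i \<times> 'i \<times> 'i \<times> 'i \<Rightarrow> 'i \<times> 'i \<times> 'i \<times> 'i"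
    by (rule sum.reindex_bij_betw[OF that, symmetric])
  have b1: "bij (\<lambda>(a, b, c, d). (c, b, d, a) :: 'i \<times> 'i \<times> 'i \<times> 'i)"
    by (rule o_bij[of "\<lambda>(a, b, c, d). (d, b, a, c)"]) auto
  have b2: "bij (\<lambda>(a, b, c, d). (d, b, a, c) :: 'i \<times> 'i \<times> 'i \<times> 'i)"
    by (rule o_bij[of "\<lambda>(a, b, c, d). (c, b, d, a)"]) auto
  have b3: "bij (\<lambda>(a, b, c, d). (c, d, b, a) :: 'i \<times> 'i \<times> 'i \<times> 'i)"
    by (rule o_bij[of "\<lambda>(a, b, c, d). (d, c, a, b)"]) auto
  show "(\<Sum>a\<in>UNIV. \<Sum>b\<in>UNIV. \<Sum>c\<in>UNIV. \<Sum>d\<in>UNIV. t a b c d) = (\<Sum>a\<in>UNIV. \<Sum>b\<in>UNIV. \<Sum>c\<in>UNIV. \<Sum>d\<in>UNIV. t c b d a)"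
    "(\<Sum>a\<in>UNIV. \<Sum>b\<in>UNIV. \<Sum>c\<in>UNIV. \<Sum>d\<in>UNIV. t a b c d) = (\<Sum>a\<in>UNIV. \<Sum>b\<in>UNIV. \<Sum>c\<in>UNIV. \<Sum>d\<in>UNIV. t d b a c)"
    "(\<Sum>a\<in>UNIV. \<Sum>b\<in>UNIV. \<Sum>c\<in>UNIV. \<Sum>d\<in>UNIV. t a b c d) = (\<Sum>a\<in>UNIV. \<Sum>b\<in>UNIV. \<Sum>c\<in>UNIV. \<Sum>d\<in>UNIV. t c d b a)"
    using r[OF b1] r[OF b2] r[OF b3]
    by (simp_all add: sum.cartesian_product split_def)
qed

text \<open>
  The Jacobi identity at one point: \<open>f\<close>, \<open>g\<close>, \<open>h\<close> are the first and \<open>f2\<close>, \<open>g2\<close>, \<open>h2\<close> the second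
  derivatives of the three functions, and \<open>d\<pi> b\<close> is the derivative of the bivector \<open>\<pi>\<close>
  in direction \<open>b\<close>. The terms with second derivatives cancel because \<open>\<pi>\<close> is antisymmetric.
\<close>

lemma jacobi_from_schouten:
  fixes \<pi> :: "'i::finite \<Rightarrow> 'i \<Rightarrow> 'r::comm_ring_1"
  assumes skew: "\<And>a b. \<pi> a b = - \<pi> b a"
    and sym: "\<And>a b. f2 a b = f2 b a" "\<And>a b. g2 a b = g2 b a" "\<And>a b. h2 a b = h2 b a"
    and schouten: "\<And>a b c. (\<Sum>d\<in>UNIV. \<pi> a d * d\<pi> d b c + \<pi> b d * d\<pi> d c a + \<pi> c d * d\<pi> d a b) = 0"
  defines "D \<equiv> \<lambda>g g2 h h2 b. \<Sum>c\<in>UNIV. \<Sum>d\<in>UNIV. d\<pi> b c d * g c * h d + \<pi> c d * g2 b c * h d + \<pi> c d * g c * h2 b d"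
  defines "B \<equiv> \<lambda>f k. \<Sum>a\<in>UNIV. \<Sum>b\<in>UNIV. \<pi> a b * f a * k b"
  shows "B f (D g g2 h h2) + B g (D h h2 f f2) + B h (D f f2 g g2) = 0"
proof -
  let ?S = "\<lambda>t. \<Sum>a\<in>UNIV. \<Sum>b\<in>UNIV. \<Sum>c\<in>UNIV. \<Sum>d\<in>UNIV. t a b c d"
  define T1 where "T1 f g h = ?S (\<lambda>a b c d. \<pi> a b * d\<pi> b c d * f a * g c * h d)" for f g h
  define T2 where "T2 f g2 h = ?S (\<lambda>a b c d. \<pi> a b * \<pi> c d * f a * g2 b c * h d)" for f g2 h
  define T3 where "T3 f g h2 = ?S (\<lambda>a b c d. \<pi> a b * \<pi> c d * f a * g c * h2 b d)" for f g h2
  have B: "B f (D g g2 h h2) = T1 f g h + T2 f g2 h + T3 f g h2" for f g g2 h h2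
    by (simp add: B_def D_def T1_def T2_def T3_def sum_distrib_left sum.distrib distrib_left mult_ac)
  \<comment> \<open>Relabelling the indices costs one transposition of \<open>\<pi>\<close>, hence
    the sign; \<open>h2\<close> absorbs its own transposition.\<close>
  have T3: "T3 f g h2 = - T2 g h2 f" if "\<And>a b. h2 a b = h2 b a" for f g h2
  proof -
    have "T2 g h2 f = ?S (\<lambda>a b c d. \<pi> c d * \<pi> b a * g c * h2 d b * f a)"
      unfolding T2_def by (rule sum4_permute(3))
    also have "\<dots> = ?S (\<lambda>a b c d. - (\<pi> a b * \<pi> c d * f a * g c * h2 b d))"
    proof (intro sum.cong refl)
      fix a b c d
      show "\<pi> c d * \<pi> b a * g c * h2 d b * f a = - (\<pi> a b * \<pi> c d * f a * g c * h2 b d)"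
        unfolding skew[of b a] that[of d b] by (simp add: mult_ac)
    qed
    finally show ?thesis by (simp add: T3_def sum_negf)
  qed
  have "T1 g h f = ?S (\<lambda>a b c d. \<pi> c b * d\<pi> b d a * g c * h d * f a)"
    unfolding T1_def by (rule sum4_permute(1))
  moreover have "T1 h f g = ?S (\<lambda>a b c d. \<pi> d b * d\<pi> b a c * h d * f a * g c)"
    unfolding T1_def by (rule sum4_permute(2))
  ultimately have "T1 f g h + T1 g h f + T1 h f g =
    ?S (\<lambda>a b c d. f a * g c * h d * (\<pi> a b * d\<pi> b c d + \<pi> c b * d\<pi> b d a + \<pi> d b * d\<pi> b a c))"
    by (simp add: T1_def sum.distrib[symmetric] algebra_simps)
  also have "\<dots> = (\<Sum>a\<in>UNIV. \<Sum>c\<in>UNIV. \<Sum>d\<in>UNIV. f a * g c * h d *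
      (\<Sum>b\<in>UNIV. \<pi> a b * d\<pi> b c d + \<pi> c b * d\<pi> b d a + \<pi> d b * d\<pi> b a c))"
    unfolding sum_distrib_left
    by (rule sum.cong[OF refl], subst sum.swap, rule sum.cong[OF refl], rule sum.swap)
  also have "\<dots> = 0" by (simp only: schouten) simp
  finally have "T1 f g h + T1 g h f + T1 h f g = 0" .
  \<comment> \<open>By \<open>T3\<close> the six sums with second derivatives cancel in pairs across
    the three cyclic terms.\<close>
  then show ?thesis
    unfolding B T3[OF sym(1)] T3[OF sym(2)] T3[OF sym(3)] by (simp add: algebra_simps)
qed


section \<open>Matrix calculus\<close>

lemma matrix_ring_simps:
  fixes A B :: "real^'n::finite^'m::finite" and C E :: "real^'k::finite^'n"
  shows "(A + B) ** C = A ** C + B ** C" "A ** (C + E) = A ** C + A ** E"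
    "(A - B) ** C = A ** C - B ** C" "A ** (C - E) = A ** C - A ** E"
    "(- A) ** C = - (A ** C)" "A ** (- C) = - (A ** C)"
  by (simp_all add: vec_eq_iff matrix_matrix_mult_def sum.distrib sum_subtractf sum_negf algebra_simps)

lemma matrix_vector_simps:
  fixes A B :: "real^'n::finite^'m::finite"
  shows "(A + B) *v v = A *v v + B *v v" "(A - B) *v v = A *v v - B *v v" "(- A) *v v = - (A *v v)"
  by (simp_all add: vec_eq_iff matrix_vector_mult_def sum.distrib sum_subtractf sum_negf algebra_simps)

lemma transpose_simps:
  fixes A B :: "real^'n::finite^'m::finite"
  shows "transpose (A + B) = transpose A + transpose B" "transpose (A - B) = transpose A - transpose B"
    "transpose (- A) = - transpose A"
  by (simp_all add: vec_eq_iff transpose_def)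

lemma inner_transpose_mult:
  fixes A B :: "real^'n::finite^'m::finite"
  shows "y \<bullet> ((transpose A ** B) *v v) = (A *v y) \<bullet> (B *v v)"
  using dot_lmul_matrix[of y "transpose A" "B *v v"] transpose_matrix_vector[of "transpose A" y]
  by (simp add: matrix_vector_mul_assoc)

definition matrix_partial :: "'n::finite \<Rightarrow> (real^'n \<Rightarrow> real^'k^'m) \<Rightarrow> real^'n \<Rightarrow> real^'k^'m" where
  "matrix_partial i M z = (\<chi> a b. partial i (\<lambda>z. M z $ a $ b) z)"

definition matrix_smooth_on :: "(real^'n::finite) set \<Rightarrow> (real^'n \<Rightarrow> real^'k^'m) \<Rightarrow> bool" where
  "matrix_smooth_on S M \<longleftrightarrow> (\<forall>a b. smooth_on S (\<lambda>z. M z $ a $ b))"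

context
  fixes S :: "(real^'n::finite) set"
  assumes S: "open S"
begin

lemma matrix_smooth_on_differentiable:
  "matrix_smooth_on S M \<Longrightarrow> z \<in> S \<Longrightarrow> (\<lambda>z. M z $ a $ b) differentiable (at z)"
  using smooth_on_imp_differentiable[OF S] by (simp add: matrix_smooth_on_def)

lemma matrix_smooth_on_partial: "matrix_smooth_on S M \<Longrightarrow> matrix_smooth_on S (matrix_partial i M)"
  using smooth_on_partial[of S] by (simp add: matrix_smooth_on_def matrix_partial_def)

lemma matrix_smooth_on_mult:
  "matrix_smooth_on S M \<Longrightarrow> matrix_smooth_on S N \<Longrightarrow> matrix_smooth_on S (\<lambda>z. M z ** N z)"
  by (auto simp: matrix_smooth_on_def matrix_matrix_mult_def intro!: smooth_on_sum smooth_on_mult S)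

lemma matrix_smooth_on_add:
  "matrix_smooth_on S M \<Longrightarrow> matrix_smooth_on S N \<Longrightarrow> matrix_smooth_on S (\<lambda>z. M z + N z)"
  by (auto simp: matrix_smooth_on_def intro!: smooth_on_add S)

lemma matrix_smooth_on_diff:
  "matrix_smooth_on S M \<Longrightarrow> matrix_smooth_on S N \<Longrightarrow> matrix_smooth_on S (\<lambda>z. M z - N z)"
  by (auto simp: matrix_smooth_on_def intro!: smooth_on_diff S)

lemma matrix_smooth_on_transpose:
  "matrix_smooth_on S M \<Longrightarrow> matrix_smooth_on S (\<lambda>z. transpose (M z))"
  by (simp add: matrix_smooth_on_def transpose_def)

lemma matrix_partial_mult:
  assumes "matrix_smooth_on S M" "matrix_smooth_on S N" "z \<in> S"
  shows "matrix_partial i (\<lambda>z. M z ** N z) z = matrix_partial i M z ** N z + M z ** matrix_partial i N z"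
  using matrix_smooth_on_differentiable[OF assms(1,3)] matrix_smooth_on_differentiable[OF assms(2,3)]
  by (simp add: matrix_partial_def matrix_matrix_mult_def vec_eq_iff partial_sum partial_mult sum.distrib)

lemma matrix_partial_add:
  assumes "matrix_smooth_on S M" "matrix_smooth_on S N" "z \<in> S"
  shows "matrix_partial i (\<lambda>z. M z + N z) z = matrix_partial i M z + matrix_partial i N z"
  using matrix_smooth_on_differentiable[OF assms(1,3)] matrix_smooth_on_differentiable[OF assms(2,3)]
  by (simp add: matrix_partial_def vec_eq_iff partial_add)

lemma matrix_partial_diff:
  assumes "matrix_smooth_on S M" "matrix_smooth_on S N" "z \<in> S"
  shows "matrix_partial i (\<lambda>z. M z - N z) z = matrix_partial i M z - matrix_partial i N z"
  using matrix_smooth_on_differentiable[OF assms(1,3)] matrix_smooth_on_differentiable[OF assms(2,3)]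
  by (simp add: matrix_partial_def vec_eq_iff partial_diff)

lemma matrix_partial_transpose:
  "matrix_partial i (\<lambda>z. transpose (M z)) z = transpose (matrix_partial i M z)"
  by (simp add: matrix_partial_def vec_eq_iff transpose_def)

lemma matrix_partial_cong:
  assumes "z \<in> S" "\<And>z. z \<in> S \<Longrightarrow> M z = N z"
  shows "matrix_partial i M z = matrix_partial i N z"
proof -
  have "partial i (\<lambda>z. M z $ a $ b) z = partial i (\<lambda>z. N z $ a $ b) z" for a b
    by (rule partial_cong[OF S assms(1)]) (simp add: assms(2))
  then show ?thesis by (simp add: matrix_partial_def)
qed

lemma matrix_partial_commute:
  assumes "matrix_smooth_on S M" "z \<in> S"
  shows "matrix_partial i (matrix_partial j M) z = matrix_partial j (matrix_partial i M) z"
  using assms smooth_on_partial_commute[OF S] by (simp add: matrix_partial_def matrix_smooth_on_def)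

end

lemma matrix_partial_const [simp]: "matrix_partial i (\<lambda>z. C) z = 0"
  by (simp add: matrix_partial_def vec_eq_iff)


section \<open>Symplectic connections in one chart\<close>

text \<open>The connection one-form with values in matrices, upper index as row. Curvature becomes a
  commutator expression and index computations become matrix algebra.\<close>

definition conn_matrix :: "('n \<Rightarrow> 'n \<Rightarrow> 'n \<Rightarrow> real^'n \<Rightarrow> real) \<Rightarrow> 'n::finite \<Rightarrow> real^'n \<Rightarrow> real^'n^'n" where
  "conn_matrix \<Gamma> i z = (\<chi> a b. \<Gamma> a i b z)"

definition curv_matrix :: "('n \<Rightarrow> 'n \<Rightarrow> 'n \<Rightarrow> real^'n \<Rightarrow> real) \<Rightarrow> 'n::finite \<Rightarrow> 'n \<Rightarrow> real^'n \<Rightarrow> real^'n^'n" where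
  "curv_matrix \<Gamma> i j z = (\<chi> k l. curvature \<Gamma> k l i j z)"

lemma curv_matrix_eq:
  "curv_matrix \<Gamma> i j z =
    matrix_partial i (conn_matrix \<Gamma> j) z + conn_matrix \<Gamma> i z ** conn_matrix \<Gamma> j z
    - matrix_partial j (conn_matrix \<Gamma> i) z - conn_matrix \<Gamma> j z ** conn_matrix \<Gamma> i z"
  by (simp add: vec_eq_iff curv_matrix_def curvature_def matrix_partial_def conn_matrix_def
      matrix_matrix_mult_def mult.commute)

lemma curv_matrix_skew: "curv_matrix \<Gamma> j i z = - curv_matrix \<Gamma> i j z"
  by (simp add: curv_matrix_eq)

lemma curvature_low_matrix: "curvature_low \<omega> \<Gamma> m n i j z = (\<omega> z ** curv_matrix \<Gamma> i j z) $ m $ n"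
  by (simp add: curvature_low_def matrix_matrix_mult_def curv_matrix_def)

locale symplectic_chart =
  fixes V :: "(real^'n::finite) set"
    and \<omega> :: "real^'n \<Rightarrow> real^'n^'n"
    and \<Gamma> :: "'n \<Rightarrow> 'n \<Rightarrow> 'n \<Rightarrow> real^'n \<Rightarrow> real"
  assumes open_V: "open V"
    and smooth_\<omega>: "\<And>i j. smooth_on V (\<lambda>z. \<omega> z $ i $ j)"
    and smooth_\<Gamma>: "\<And>k i j. smooth_on V (\<Gamma> k i j)"
    and \<omega>_skew: "\<And>z i j. z \<in> V \<Longrightarrow> \<omega> z $ i $ j = - \<omega> z $ j $ i"
    and \<omega>_invertible: "\<And>z. z \<in> V \<Longrightarrow> invertible (\<omega> z)"
    and \<omega>_parallel: "\<And>z i j k. z \<in> V \<Longrightarrow> partial i (\<lambda>z. \<omega> z $ j $ k) z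
          - (\<Sum>l\<in>UNIV. \<Gamma> l i j z * \<omega> z $ l $ k) - (\<Sum>l\<in>UNIV. \<Gamma> l i k z * \<omega> z $ j $ l) = 0"
begin

abbreviation "G \<equiv> conn_matrix \<Gamma>"
abbreviation "R \<equiv> curv_matrix \<Gamma>"
abbreviation "W \<equiv> \<lambda>z. matrix_inv (\<omega> z)"

lemma matrix_smooth_\<omega>: "matrix_smooth_on V \<omega>"
  by (simp add: matrix_smooth_on_def smooth_\<omega>)

lemma matrix_smooth_G: "matrix_smooth_on V (G i)"
  by (simp add: matrix_smooth_on_def conn_matrix_def smooth_\<Gamma>)

lemma matrix_smooth_W: "matrix_smooth_on V W"
  using smooth_on_matrix_inv[OF open_V smooth_\<omega> \<omega>_invertible] by (simp add: matrix_smooth_on_def)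

lemma matrix_smooth_R: "matrix_smooth_on V (R i j)"
  unfolding curv_matrix_eq[abs_def]
  by (intro matrix_smooth_on_diff matrix_smooth_on_add matrix_smooth_on_mult matrix_smooth_on_partial
      open_V matrix_smooth_G)

lemma transpose_\<omega>: "z \<in> V \<Longrightarrow> transpose (\<omega> z) = - \<omega> z"
  by (simp add: vec_eq_iff transpose_def) (use \<omega>_skew in blast)

lemma transpose_W:
  assumes "z \<in> V"
  shows "transpose (W z) = - W z"
proof -
  note inv = matrix_inv_inverse[OF \<omega>_invertible[OF assms]]
  have "transpose (W z) ** transpose (\<omega> z) = mat 1"
    using inv(1) by (metis matrix_transpose_mul transpose_mat)
  then have "(- transpose (W z)) ** \<omega> z = mat 1"
    by (simp add: transpose_\<omega>[OF assms] matrix_ring_simps)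
  then have "- transpose (W z) = W z"
    using inv(1) by (metis matrix_mul_assoc matrix_mul_lid matrix_mul_rid)
  then show ?thesis by (metis minus_minus)
qed

lemma partial_\<omega>:
  assumes "z \<in> V"
  shows "matrix_partial i \<omega> z = transpose (G i z) ** \<omega> z + \<omega> z ** G i z"
  using \<omega>_parallel[OF assms]
  by (simp add: vec_eq_iff matrix_partial_def matrix_matrix_mult_def transpose_def conn_matrix_def
      algebra_simps)

text \<open>Differentiate \<open>\<omega> z ** W z = mat 1\<close> and insert that \<omega> is
  parallel: the inverse is parallel as well.\<close>

lemma partial_W:
  assumes "z \<in> V"
  shows "matrix_partial i W z = - (G i z ** W z + W z ** transpose (G i z))"
proof -
  note inv = matrix_inv_inverse[OF \<omega>_invertible]
  have "matrix_partial i (\<lambda>z. \<omega> z ** W z) z = matrix_partial i (\<lambda>z. mat 1) z"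
    by (rule matrix_partial_cong[OF open_V assms]) (rule inv(1))
  then have "matrix_partial i \<omega> z ** W z + \<omega> z ** matrix_partial i W z = 0"
    by (simp add: matrix_partial_mult[OF open_V matrix_smooth_\<omega> matrix_smooth_W assms])
  then have "W z ** (matrix_partial i \<omega> z ** W z + \<omega> z ** matrix_partial i W z) = W z ** 0"
    by simp
  then have "W z ** transpose (G i z) ** (\<omega> z ** W z) + (W z ** \<omega> z) ** G i z ** W z + (W z ** \<omega> z) ** matrix_partial i W z = 0"
    by (simp add: partial_\<omega>[OF assms] matrix_ring_simps matrix_mul_assoc add.assoc)
  then show ?thesis
    by (simp add: inv[OF assms] add_eq_0_iff add.commute)
qed

lemma partial2_\<omega>:
  assumes "z \<in> V"
  shows "matrix_partial j (matrix_partial i \<omega>) z =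
    transpose (matrix_partial j (G i) z) ** \<omega> z + transpose (G i z) ** (transpose (G j z) ** \<omega> z + \<omega> z ** G j z)
    + ((transpose (G j z) ** \<omega> z + \<omega> z ** G j z) ** G i z + \<omega> z ** matrix_partial j (G i) z)"
proof -
  have "matrix_partial j (matrix_partial i \<omega>) z = matrix_partial j (\<lambda>z. transpose (G i z) ** \<omega> z + \<omega> z ** G i z) z"
    by (rule matrix_partial_cong[OF open_V assms]) (rule partial_\<omega>)
  then show ?thesis
    by (simp add: matrix_partial_add[OF open_V _ _ assms] matrix_partial_mult[OF open_V _ _ assms]
        matrix_smooth_on_mult[OF open_V] matrix_smooth_on_transpose[OF open_V] matrix_smooth_G matrix_smooth_\<omega>
        matrix_partial_transpose[OF open_V] partial_\<omega>[OF assms])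
qed

text \<open>Equality of the mixed second derivatives of the parallel form gives
  \<open>transpose R ** \<omega> + \<omega> ** R = 0\<close>: the curvature matrices lie in the
  symplectic Lie algebra. Antisymmetry of \<omega> turns this into symmetry of the product.\<close>

lemma \<omega>_R_symmetric:
  assumes "z \<in> V"
  shows "transpose (\<omega> z ** R i j z) = \<omega> z ** R i j z"
proof -
  have "matrix_partial i (matrix_partial j \<omega>) z - matrix_partial j (matrix_partial i \<omega>) z = 0"
    using matrix_partial_commute[OF open_V matrix_smooth_\<omega> assms] by simp
  then have "transpose (R i j z) ** \<omega> z + \<omega> z ** R i j z = 0"
    unfolding partial2_\<omega>[OF assms] curv_matrix_eq
    by (simp add: matrix_ring_simps matrix_mul_assoc transpose_simps matrix_transpose_mul algebra_simps)
  then have "transpose (R i j z) ** \<omega> z = - (\<omega> z ** R i j z)"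
    by (simp only: eq_neg_iff_add_eq_0)
  then show ?thesis
    by (simp only: matrix_transpose_mul transpose_\<omega>[OF assms] matrix_ring_simps minus_minus)
qed

text \<open>The Jacobi identity for the operators \<open>\<partial>_i + G i\<close>, whose
  commutators are the curvature matrices; the connection acts on the matrix indices only, not on the
  form indices. Second derivatives of \<open>G\<close> cancel in pairs.\<close>

lemma bianchi:
  assumes "z \<in> V"
  shows "(matrix_partial i (R j k) z + G i z ** R j k z - R j k z ** G i z)
    + (matrix_partial j (R k i) z + G j z ** R k i z - R k i z ** G j z)
    + (matrix_partial k (R i j) z + G k z ** R i j z - R i j z ** G k z) = 0"
proof -
  have "matrix_partial i (R j k) z =
    matrix_partial i (matrix_partial j (G k)) z
    + (matrix_partial i (G j) z ** G k z + G j z ** matrix_partial i (G k) z)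
    - matrix_partial i (matrix_partial k (G j)) z
    - (matrix_partial i (G k) z ** G j z + G k z ** matrix_partial i (G j) z)" for i j k
    unfolding curv_matrix_eq[abs_def]
    by (simp add: matrix_partial_add[OF open_V _ _ assms] matrix_partial_diff[OF open_V _ _ assms]
        matrix_partial_mult[OF open_V _ _ assms] matrix_smooth_on_diff[OF open_V] matrix_smooth_on_add[OF open_V]
        matrix_smooth_on_mult[OF open_V] matrix_smooth_on_partial[OF open_V] matrix_smooth_G)
  note * = this
  note c = matrix_partial_commute[OF open_V matrix_smooth_G assms]
  show ?thesis
    unfolding * curv_matrix_eq
    using c[of i j k] c[of i k j] c[of j k i]
    by (simp add: matrix_ring_simps matrix_mul_assoc algebra_simps)
qed

end


section \<open>The bracket in one chart\<close>

lemma fps_const_sum: "(\<Sum>k\<in>K. fps_const (f k)) = fps_const (\<Sum>k\<in>K. f k :: real)"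
  by (induction K rule: infinite_finite_induct) simp_all

lemma fps_partial_X_power:
  "fps_partial a (\<lambda>w. fps_X ^ k * \<Phi> w) w = fps_X ^ k * fps_partial a \<Phi> w"
  by (rule fps_ext) (simp add: fps_partial_def fps_X_power_mult_nth)

lemma fps_partial_const: "fps_partial a (\<lambda>w. fps_const (f w)) w = fps_const (partial a f w)"
  by (rule fps_ext) (simp add: fps_partial_def)

lemma matrix_vector_nth: "((M::real^'n::finite^'m) *v y) $ k = (\<Sum>l\<in>UNIV. M $ k $ l * y $ l)"
  by (simp add: matrix_vector_mult_def)

lemma quadratic_form_eq:
  "y \<bullet> ((M::real^'n::finite^'n) *v y) = (\<Sum>m\<in>UNIV. \<Sum>n\<in>UNIV. M $ m $ n * y $ m * y $ n)"
  by (simp add: inner_vec_def matrix_vector_nth sum_distrib_left mult_ac)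

lemma partial_cmult:
  "f differentiable (at z) \<Longrightarrow> partial i (\<lambda>z. c * f z) z = c * partial i f z"
  using partial_mult[of "\<lambda>_. c" z f i] by simp

text \<open>Symmetry makes the two terms of the product rule equal, which absorbs the factor 1/2 in
  the bracket of \<open>p\<close> with \<open>p\<close>.\<close>

lemma partial_quadratic_form:
  assumes "transpose (M::real^'n::finite^'n) = M"
  shows "partial d (\<lambda>y. 1/2 * (y \<bullet> (M *v y))) y = (M *v y) $ d"
proof -
  have "transpose M $ n $ m = M $ n $ m" for m n
    using assms by simp
  then have sym: "M $ m $ n = M $ n $ m" for m n
    by (simp add: transpose_def)
  have "partial d (\<lambda>y. 1/2 * (y \<bullet> (M *v y))) y =
    1/2 * (\<Sum>m\<in>UNIV. \<Sum>n\<in>UNIV. (if d = m then M $ m $ n * y $ n else 0) + (if d = n then M $ m $ n * y $ m else 0))"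
  proof -
    have "partial d (\<lambda>y. M $ m $ n * y $ m * y $ n) y =
        (if d = m then M $ m $ n * y $ n else 0) + (if d = n then M $ m $ n * y $ m else 0)" for m n
      by (simp add: partial_mult partial_vec_nth)
    moreover have "(\<lambda>y. M $ m $ n * y $ m * y $ n) differentiable (at y)" for m n
      by simp
    ultimately show ?thesis
      unfolding quadratic_form_eq
      by (simp only: partial_cmult differentiable_sum_at partial_sum)
  qed
  also have "\<dots> = 1/2 * ((\<Sum>n\<in>UNIV. M $ d $ n * y $ n) + (\<Sum>m\<in>UNIV. M $ m $ d * y $ m))"
  proof -
    have "(\<Sum>m\<in>UNIV. \<Sum>n\<in>UNIV. if d = m then M $ m $ n * y $ n else 0) =
        (\<Sum>m\<in>UNIV. if d = m then \<Sum>n\<in>UNIV. M $ m $ n * y $ n else 0)"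
      by (intro sum.cong refl) auto
    then show ?thesis by (simp add: sum.distrib sum.delta)
  qed
  also have "\<dots> = (M *v y) $ d"
    using sym[of _ d] by (simp add: matrix_vector_nth)
  finally show ?thesis .
qed

text \<open>What remains of the evaluated coordinate brackets once the power of \<open>fps_X\<close>
  is split off; with these values the Schouten condition is calculus of real functions.\<close>

fun bracket_value ::
    "(real^'n::finite \<Rightarrow> real^'n^'n) \<Rightarrow> ('n \<Rightarrow> 'n \<Rightarrow> 'n \<Rightarrow> real^'n \<Rightarrow> real) \<Rightarrow>
     'n coord \<Rightarrow> 'n coord \<Rightarrow> real^'n coord \<Rightarrow> real" where
  "bracket_value \<omega> \<Gamma> (X i) (X j) w = 0"
| "bracket_value \<omega> \<Gamma> (X i) (Y j) w = 0"
| "bracket_value \<omega> \<Gamma> (Y i) (X j) w = 0"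
| "bracket_value \<omega> \<Gamma> (X i) (P j) w = (if i = j then 1 else 0)"
| "bracket_value \<omega> \<Gamma> (P i) (X j) w = - (if i = j then 1 else 0)"
| "bracket_value \<omega> \<Gamma> (Y i) (Y j) w = matrix_inv (\<omega> (xpart w)) $ i $ j"
| "bracket_value \<omega> \<Gamma> (P i) (Y j) w = (conn_matrix \<Gamma> i (xpart w) *v ypart w) $ j"
| "bracket_value \<omega> \<Gamma> (Y i) (P j) w = - (conn_matrix \<Gamma> j (xpart w) *v ypart w) $ i"
| "bracket_value \<omega> \<Gamma> (P i) (P j) w =
     1/2 * (ypart w \<bullet> ((\<omega> (xpart w) ** curv_matrix \<Gamma> i j (xpart w)) *v ypart w))"

text \<open>
  The bracket of the coordinates \<open>a\<close> and \<open>b\<close> is homogeneous in \<open>y\<close> of degree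
  \<open>excess a + excess b - 2\<close>.
\<close>

fun excess :: "'n coord \<Rightarrow> nat" where
  "excess (X i) = 0" | "excess (P i) = 2" | "excess (Y i) = 1"

lemma bracket_value_fun:
  "bracket_value \<omega> \<Gamma> (Y i) (Y j) = (\<lambda>w. matrix_inv (\<omega> (xpart w)) $ i $ j)"
  "bracket_value \<omega> \<Gamma> (P i) (Y j) = (\<lambda>w. (conn_matrix \<Gamma> i (xpart w) *v ypart w) $ j)"
  "bracket_value \<omega> \<Gamma> (Y i) (P j) = (\<lambda>w. - bracket_value \<omega> \<Gamma> (P j) (Y i) w)"
  "bracket_value \<omega> \<Gamma> (P i) (P j) =
     (\<lambda>w. 1/2 * (ypart w \<bullet> ((\<omega> (xpart w) ** curv_matrix \<Gamma> i j (xpart w)) *v ypart w)))"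
  by auto

context symplectic_chart
begin

lemma smooth_curvature_low: "smooth_on V (curvature_low \<omega> \<Gamma> m n i j)"
  using matrix_smooth_on_mult[OF open_V matrix_smooth_\<omega> matrix_smooth_R]
  unfolding curvature_low_matrix[abs_def] matrix_smooth_on_def by blast

lemma coord_bracket_local: "coord_bracket V \<omega> \<Gamma> a b \<in> local_functions V"
  using matrix_smooth_W
  by (cases a; cases b)
     (auto simp: matrix_smooth_on_def intro!: local_functions_0 base_fun_local local_functions_minus
       local_functions_sum local_functions_scale local_functions_mult y_fun_local smooth_\<Gamma>
       smooth_curvature_low open_V)

lemma eval_coord_bracket_PY:
  assumes "w \<in> total_over V"
  shows "eval_series (\<Sum>l\<in>UNIV. base_fun V (\<Gamma> j i l) \<odot> y_fun V l) w =
    fps_X * fps_const ((G i (xpart w) *v ypart w) $ j)"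
  using assms
  by (simp add: eval_series_sum eval_series_mult eval_series_base eval_series_y mult.left_commute
      sum_distrib_left[symmetric] fps_const_sum matrix_vector_nth conn_matrix_def)

lemma eval_coord_bracket_PP:
  assumes "w \<in> total_over V"
  shows "eval_series (coord_bracket V \<omega> \<Gamma> (P i) (P j)) w =
    fps_X\<^sup>2 * fps_const (1/2 * (ypart w \<bullet> ((\<omega> (xpart w) ** R i j (xpart w)) *v ypart w)))"
proof -
  have "eval_series (coord_bracket V \<omega> \<Gamma> (P i) (P j)) w =
    fps_const (1/2) * (\<Sum>m\<in>UNIV. \<Sum>n\<in>UNIV. fps_X\<^sup>2 * fps_const (curvature_low \<omega> \<Gamma> m n i j (xpart w) * w $ Y m * w $ Y n))"
    using assms
    by (simp add: eval_series_scale eval_series_sum eval_series_mult eval_series_base eval_series_y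
        power2_eq_square mult_ac flip: fps_const_mult)
  also have "\<dots> = fps_X\<^sup>2 * (fps_const (1/2) * (\<Sum>m\<in>UNIV. \<Sum>n\<in>UNIV. fps_const (curvature_low \<omega> \<Gamma> m n i j (xpart w) * w $ Y m * w $ Y n)))"
    by (simp add: sum_distrib_left mult.left_commute)
  finally show ?thesis
    by (simp add: fps_const_sum quadratic_form_eq curvature_low_matrix)
qed

text \<open>The factor \<open>fps_X\<^sup>2\<close> stands in for the exponent -2, which as a
  natural number would be truncated for the vanishing brackets of \<open>x\<close> with
  \<open>x\<close> and with \<open>y\<close>.\<close>

lemma eval_coord_bracket:
  assumes "w \<in> total_over V"
  shows "fps_X\<^sup>2 * eval_series (coord_bracket V \<omega> \<Gamma> a b) w =
    fps_X ^ (excess a + excess b) * fps_const (bracket_value \<omega> \<Gamma> a b w)"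
proof (cases a; cases b)
  fix i j assume "a = P i" "b = P j"
  then show ?thesis
    using eval_coord_bracket_PP[OF assms, of i j] by (simp del: coord_bracket.simps add: power_add[symmetric])
qed (use assms in \<open>simp_all add: eval_series_base eval_series_minus eval_coord_bracket_PY
      power3_eq_cube power2_eq_square mult.assoc flip: fps_const_neg\<close>)

lemma bracket_value_skew:
  assumes "w \<in> total_over V"
  shows "bracket_value \<omega> \<Gamma> a b w = - bracket_value \<omega> \<Gamma> b a w"
proof (cases a; cases b)
  fix i j assume ab: "a = Y i" "b = Y j"
  have "transpose (W (xpart w)) $ i $ j = (- W (xpart w)) $ i $ j"
    using transpose_W assms by (simp add: total_over_def)
  then show ?thesis using ab by (simp add: transpose_def)
next
  fix i j assume "a = P i" "b = P j"
  then show ?thesis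
    by (simp add: curv_matrix_skew[of \<Gamma> j i] matrix_ring_simps matrix_vector_simps)
qed auto

lemma coord_bracket_skew:
  assumes "w \<in> total_over V"
  shows "eval_series (coord_bracket V \<omega> \<Gamma> a b) w = - eval_series (coord_bracket V \<omega> \<Gamma> b a) w"
proof -
  have "fps_X\<^sup>2 * eval_series (coord_bracket V \<omega> \<Gamma> a b) w = fps_X\<^sup>2 * (- eval_series (coord_bracket V \<omega> \<Gamma> b a) w)"
    using eval_coord_bracket[OF assms, of a b] eval_coord_bracket[OF assms, of b a]
      bracket_value_skew[OF assms, of a b]
    by (simp add: add.commute flip: fps_const_neg)
  then show ?thesis by (simp only: mult_cancel_left) simp
qed

lemma eval_deriv_coord_bracket:
  assumes w: "w \<in> total_over V"
  shows "weight d * (fps_X\<^sup>2 * eval_series (deriv_along V d (coord_bracket V \<omega> \<Gamma> b c)) w) =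
    fps_X ^ (excess b + excess c) * fps_const (partial d (bracket_value \<omega> \<Gamma> b c) w)"
proof -
  have "weight d * (fps_X\<^sup>2 * eval_series (deriv_along V d (coord_bracket V \<omega> \<Gamma> b c)) w) =
      fps_partial d (\<lambda>w. fps_X\<^sup>2 * eval_series (coord_bracket V \<omega> \<Gamma> b c) w) w"
    unfolding mult.left_commute[of "weight d"] weight_deriv_along[OF open_V coord_bracket_local w]
      fps_partial_X_power ..
  also have "\<dots> = fps_partial d (\<lambda>w. fps_X ^ (excess b + excess c) * fps_const (bracket_value \<omega> \<Gamma> b c w)) w"
    by (rule fps_partial_cong[OF open_total_over[OF open_V] w]) (rule eval_coord_bracket)
  also have "\<dots> = fps_X ^ (excess b + excess c) * fps_const (partial d (bracket_value \<omega> \<Gamma> b c) w)"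
    unfolding fps_partial_X_power fps_partial_const ..
  finally show ?thesis .
qed


subsection \<open>The Schouten condition\<close>

lemma partial_P_bracket_value: "partial (P d) (bracket_value \<omega> \<Gamma> b c) w = 0"
  by (cases b; cases c) (simp_all add: partial_def part_axis)

lemma partial_bracket_value_X:
  "partial a (bracket_value \<omega> \<Gamma> (X i) c) w = 0" "partial a (bracket_value \<omega> \<Gamma> c (X i)) w = 0"
  by (cases c; simp add: partial_def)+

lemma partial_bracket_value_YY:
  "partial (X d) (bracket_value \<omega> \<Gamma> (Y j) (Y k)) w = matrix_partial d W (xpart w) $ j $ k"
  "partial (Y d) (bracket_value \<omega> \<Gamma> (Y j) (Y k)) w = 0"
  unfolding bracket_value_fun
  using partial_coord(1)[of d "\<lambda>z p y. W z $ j $ k" w] partial_coord(3)[of d "\<lambda>z p y. W z $ j $ k" w]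
  by (simp_all add: matrix_partial_def)

lemma partial_bracket_value_PY:
  assumes "w \<in> total_over V"
  shows "partial (X d) (bracket_value \<omega> \<Gamma> (P j) (Y k)) w = (matrix_partial d (G j) (xpart w) *v ypart w) $ k"
    and "partial (Y d) (bracket_value \<omega> \<Gamma> (P j) (Y k)) w = G j (xpart w) $ k $ d"
proof -
  have z: "xpart w \<in> V" using assms by (simp add: total_over_def)
  note diff = matrix_smooth_on_differentiable[OF open_V matrix_smooth_G z]
  show "partial (X d) (bracket_value \<omega> \<Gamma> (P j) (Y k)) w = (matrix_partial d (G j) (xpart w) *v ypart w) $ k"
    unfolding bracket_value_fun
    using partial_coord(1)[of d "\<lambda>z p y. (G j z *v y) $ k" w]
    by (simp add: matrix_vector_nth partial_sum partial_mult diff matrix_partial_def)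
  show "partial (Y d) (bracket_value \<omega> \<Gamma> (P j) (Y k)) w = G j (xpart w) $ k $ d"
    unfolding bracket_value_fun
    using partial_coord(3)[of d "\<lambda>z p y. (G j z *v y) $ k" w]
    by (simp add: matrix_vector_nth partial_sum partial_mult partial_vec_nth if_distrib sum.delta cong: if_cong)
qed

lemma partial_bracket_value_YP:
  assumes "w \<in> total_over V"
  shows "partial a (bracket_value \<omega> \<Gamma> (Y j) (P k)) w = - partial a (bracket_value \<omega> \<Gamma> (P k) (Y j)) w"
proof -
  note W = open_total_over[OF open_V]
  have "smooth_on (total_over V) (\<lambda>w. \<Sum>l\<in>UNIV. \<Gamma> j k l (xpart w) * w $ Y l)"
    by (intro smooth_on_sum smooth_on_mult smooth_on_xpart smooth_\<Gamma> open_V W smooth_on_vec_nth)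
  then have "bracket_value \<omega> \<Gamma> (P k) (Y j) differentiable (at w)"
    unfolding bracket_value_fun
    using smooth_on_imp_differentiable[OF W _ assms] by (simp add: matrix_vector_nth conn_matrix_def)
  then show ?thesis unfolding bracket_value_fun(3) by (rule partial_minus)
qed

lemma partial_bracket_value_PP:
  assumes "w \<in> total_over V"
  shows "partial (X d) (bracket_value \<omega> \<Gamma> (P j) (P k)) w =
      1/2 * (ypart w \<bullet> (matrix_partial d (\<lambda>z. \<omega> z ** R j k z) (xpart w) *v ypart w))"
    and "partial (Y d) (bracket_value \<omega> \<Gamma> (P j) (P k)) w = ((\<omega> (xpart w) ** R j k (xpart w)) *v ypart w) $ d"
proof -
  have z: "xpart w \<in> V" using assms by (simp add: total_over_def)
  note diff = matrix_smooth_on_differentiable[OF open_V matrix_smooth_on_mult[OF open_V matrix_smooth_\<omega> matrix_smooth_R] z]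
  show "partial (X d) (bracket_value \<omega> \<Gamma> (P j) (P k)) w =
      1/2 * (ypart w \<bullet> (matrix_partial d (\<lambda>z. \<omega> z ** R j k z) (xpart w) *v ypart w))"
  proof -
    let ?y = "ypart w"
    have d: "(\<lambda>z. (\<omega> z ** R j k z) $ m $ n * ?y $ m * ?y $ n) differentiable (at (xpart w))" for m n
      using diff by simp
    have "partial d (\<lambda>z. (\<omega> z ** R j k z) $ m $ n * ?y $ m * ?y $ n) (xpart w) =
        matrix_partial d (\<lambda>z. \<omega> z ** R j k z) (xpart w) $ m $ n * ?y $ m * ?y $ n" for m n
      using diff by (simp add: partial_mult matrix_partial_def)
    then have "partial d (\<lambda>z. 1/2 * (?y \<bullet> ((\<omega> z ** R j k z) *v ?y))) (xpart w) =
        1/2 * (?y \<bullet> (matrix_partial d (\<lambda>z. \<omega> z ** R j k z) (xpart w) *v ?y))"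
      unfolding quadratic_form_eq
      by (simp only: partial_cmult differentiable_sum_at partial_sum d)
    then show ?thesis
      unfolding bracket_value_fun
      using partial_coord(1)[of d "\<lambda>z p y. 1/2 * (y \<bullet> ((\<omega> z ** R j k z) *v y))" w] by simp
  qed
  show "partial (Y d) (bracket_value \<omega> \<Gamma> (P j) (P k)) w = ((\<omega> (xpart w) ** R j k (xpart w)) *v ypart w) $ d"
    unfolding bracket_value_fun
    using partial_coord(3)[of d "\<lambda>z p y. 1/2 * (y \<bullet> ((\<omega> z ** R j k z) *v y))" w]
    unfolding partial_quadratic_form[OF \<omega>_R_symmetric[OF z]] by simp
qed

text \<open>The nested bracket \<open>{a, {b, c}}\<close> of three coordinates: the Hamiltonian
  vector field of \<open>a\<close> applied to the bracket of \<open>b\<close> and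
  \<open>c\<close>.\<close>

definition hamiltonian :: "'n coord \<Rightarrow> 'n coord \<Rightarrow> 'n coord \<Rightarrow> real^'n coord \<Rightarrow> real" where
  "hamiltonian a b c w = (\<Sum>d\<in>UNIV. bracket_value \<omega> \<Gamma> a d w * partial d (bracket_value \<omega> \<Gamma> b c) w)"

text \<open>Brackets with an \<open>x\<close> are constant, \<open>X i\<close> pairs only with a
  \<open>P\<close>, and no coordinate bracket depends on \<open>p\<close>.\<close>

lemma hamiltonian_X:
  "hamiltonian (X i) b c w = 0" "hamiltonian b (X i) c w = 0" "hamiltonian b c (X i) w = 0"
  by (simp_all add: hamiltonian_def sum_coord partial_P_bracket_value partial_bracket_value_X)

text \<open>On functions of \<open>x\<close> and \<open>y\<close>, bracketing with a
  \<open>p\<close> is minus the horizontal derivative along the connection.\<close>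

lemma hamiltonian_P:
  "hamiltonian (P i) b c w = - partial (X i) (bracket_value \<omega> \<Gamma> b c) w
     + (\<Sum>d\<in>UNIV. (G i (xpart w) *v ypart w) $ d * partial (Y d) (bracket_value \<omega> \<Gamma> b c) w)"
proof -
  have "(\<Sum>d\<in>UNIV. (if i = d then 1 else 0) * partial (X d) (bracket_value \<omega> \<Gamma> b c) w) =
      (\<Sum>d\<in>UNIV. if i = d then partial (X d) (bracket_value \<omega> \<Gamma> b c) w else 0)"
    by (intro sum.cong) auto
  then show ?thesis
    by (simp add: hamiltonian_def sum_coord partial_P_bracket_value sum_negf sum.delta)
qed

lemma hamiltonian_Y:
  "hamiltonian (Y i) b c w = (\<Sum>d\<in>UNIV. W (xpart w) $ i $ d * partial (Y d) (bracket_value \<omega> \<Gamma> b c) w)"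
  by (simp add: hamiltonian_def sum_coord partial_P_bracket_value)

lemma hamiltonian_cyclic:
  assumes w: "w \<in> total_over V"
  shows "hamiltonian a b c w + hamiltonian b c a w + hamiltonian c a b w = 0"
proof -
  define z where "z = xpart w"
  define y where "y = ypart w"
  have z: "z \<in> V" using w by (simp add: total_over_def z_def)
  note simps = z_def[symmetric] y_def[symmetric]
  have vec: "(\<Sum>d\<in>UNIV. (A *v v) $ d * B $ k $ d) = ((B ** A) *v v) $ k" for A B :: "real^'n^'n" and v k
    unfolding matrix_vector_mul_assoc[symmetric] matrix_vector_nth[of B] by (simp add: mult.commute)
  have YYY: "hamiltonian (Y i) (Y j) (Y k) w = 0" for i j k
    by (simp add: hamiltonian_Y partial_bracket_value_YY)
  have PYY: "hamiltonian (P i) (Y j) (Y k) w + hamiltonian (Y j) (Y k) (P i) w + hamiltonian (Y k) (P i) (Y j) w = 0"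
    for i j k
  proof -
    have 1: "hamiltonian (P i) (Y j) (Y k) w = - matrix_partial i W z $ j $ k"
      by (simp add: hamiltonian_P partial_bracket_value_YY simps)
    have 2: "hamiltonian (Y j) (Y k) (P i) w = - (W z ** transpose (G i z)) $ j $ k"
      by (simp add: hamiltonian_Y partial_bracket_value_YP[OF w] partial_bracket_value_PY[OF w] simps
          matrix_matrix_mult_def transpose_def sum_negf)
    have "transpose (W z) $ d $ k = (- W z) $ d $ k" for d
      using transpose_W[OF z] by simp
    then have "W z $ k $ d = - W z $ d $ k" for d
      by (simp add: transpose_def)
    then have 3: "hamiltonian (Y k) (P i) (Y j) w = - (G i z ** W z) $ j $ k"
      by (simp add: hamiltonian_Y partial_bracket_value_PY[OF w] simps
          matrix_matrix_mult_def sum_negf mult.commute)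
    show ?thesis unfolding 1 2 3 partial_W[OF z] by simp
  qed
  have PPY: "hamiltonian (P i) (P j) (Y k) w + hamiltonian (P j) (Y k) (P i) w + hamiltonian (Y k) (P i) (P j) w = 0"
    for i j k
  proof -
    have 1: "hamiltonian (P i) (P j) (Y k) w = ((- matrix_partial i (G j) z + G j z ** G i z) *v y) $ k" for i j
      by (simp add: hamiltonian_P partial_bracket_value_PY[OF w] simps vec matrix_vector_simps)
    have 2: "hamiltonian (P j) (Y k) (P i) w = - hamiltonian (P j) (P i) (Y k) w"
      by (simp add: hamiltonian_P partial_bracket_value_YP[OF w] sum_negf)
    \<comment> \<open>Contraction with \<open>W\<close> undoes the lowering of the curvature index,
      so this term is the curvature applied to \<open>y\<close>, and the other two terms are minus
      its expression in \<Gamma>.\<close>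
    have "hamiltonian (Y k) (P i) (P j) w = ((W z ** (\<omega> z ** R i j z)) *v y) $ k"
      unfolding matrix_vector_mul_assoc[symmetric, of "W z"]
      by (simp add: hamiltonian_Y partial_bracket_value_PP[OF w] simps matrix_vector_nth[of "W z"])
    then have 3: "hamiltonian (Y k) (P i) (P j) w = (R i j z *v y) $ k"
      by (simp add: matrix_mul_assoc matrix_inv_inverse[OF \<omega>_invertible[OF z]])
    show ?thesis
      unfolding 2 1 3 curv_matrix_eq by (simp add: matrix_vector_simps)
  qed
  have PPP: "hamiltonian (P i) (P j) (P k) w + hamiltonian (P j) (P k) (P i) w + hamiltonian (P k) (P i) (P j) w = 0"
    for i j k
  proof -
    \<comment> \<open>The derivative of \<omega> contributes -1/2 times the pairing of
      \<open>G i z *v y\<close> with \<open>?S *v y\<close>, the vertical part of the horizontal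
      derivative the full pairing. The remaining half is, by symmetry of \<open>?S\<close>, the term
      with \<open>R j k z ** G i z\<close>.\<close>
    have 1: "hamiltonian (P i) (P j) (P k) w =
      - 1/2 * (y \<bullet> ((\<omega> z ** (matrix_partial i (R j k) z + G i z ** R j k z - R j k z ** G i z)) *v y))" for i j k
    proof -
      let ?S = "\<omega> z ** R j k z"
      have "(G i z *v y) \<bullet> (?S *v y) = y \<bullet> ((transpose ?S ** G i z) *v y)"
        unfolding inner_transpose_mult by (simp add: inner_commute)
      then have sym: "(G i z *v y) \<bullet> (?S *v y) = y \<bullet> ((?S ** G i z) *v y)"
        by (simp add: \<omega>_R_symmetric[OF z])
      have "hamiltonian (P i) (P j) (P k) w =
          - (1/2 * (y \<bullet> (matrix_partial i (\<lambda>z. \<omega> z ** R j k z) z *v y))) + (G i z *v y) \<bullet> (?S *v y)"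
        by (simp add: hamiltonian_P partial_bracket_value_PP[OF w] simps inner_vec_def)
      also have "matrix_partial i (\<lambda>z. \<omega> z ** R j k z) z =
          transpose (G i z) ** ?S + \<omega> z ** (G i z ** R j k z + matrix_partial i (R j k) z)"
        by (simp add: matrix_partial_mult[OF open_V matrix_smooth_\<omega> matrix_smooth_R z] partial_\<omega>[OF z]
            matrix_ring_simps matrix_mul_assoc)
      finally show ?thesis
        using sym inner_transpose_mult[of y "G i z" ?S y]
        by (simp add: matrix_vector_simps inner_add_right inner_diff_right matrix_ring_simps matrix_mul_assoc field_simps)
    qed
    show ?thesis
      unfolding 1 distrib_left[symmetric] inner_add_right[symmetric] matrix_vector_simps(1)[symmetric]
        matrix_ring_simps(2)[symmetric] bianchi[OF z] by simp
  qed
  \<comment> \<open>The mixed types were treated in one cyclic position only; the others are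
    rotations of it.\<close>
  have rotate: "s + t + r = 0 \<and> t + r + s = 0" if "r + s + t = 0" for r s t :: real
    using that by simp
  show ?thesis
    by (cases a; cases b; cases c;
        simp add: hamiltonian_X YYY PPP PPY PYY rotate[OF PPY] rotate[OF PYY])
qed

text \<open>Carries \<open>hamiltonian_cyclic\<close> over to power series: after scaling, every
  summand has the same power of \<open>fps_X\<close>, whatever \<open>d\<close> is.\<close>

lemma schouten:
  assumes w: "w \<in> total_over V"
  shows "(\<Sum>d\<in>UNIV.
      eval_series (coord_bracket V \<omega> \<Gamma> a d) w * eval_series (deriv_along V d (coord_bracket V \<omega> \<Gamma> b c)) w
    + eval_series (coord_bracket V \<omega> \<Gamma> b d) w * eval_series (deriv_along V d (coord_bracket V \<omega> \<Gamma> c a)) w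
    + eval_series (coord_bracket V \<omega> \<Gamma> c d) w * eval_series (deriv_along V d (coord_bracket V \<omega> \<Gamma> a b)) w) = 0"
proof -
  let ?e = "\<lambda>a b. eval_series (coord_bracket V \<omega> \<Gamma> a b) w"
  let ?d = "\<lambda>d a b. eval_series (deriv_along V d (coord_bracket V \<omega> \<Gamma> a b)) w"
  let ?n = "excess a + excess b + excess c"
  \<comment> \<open>The exponent 4 is one \<open>fps_X\<^sup>2\<close> for each of the two
    coordinate brackets.\<close>
  have tm: "fps_X ^ 4 * (?e a d * ?d d b c) =
      fps_X ^ (excess a + excess b + excess c) * fps_const (bracket_value \<omega> \<Gamma> a d w * partial d (bracket_value \<omega> \<Gamma> b c) w)"
    for a b c d
  proof -
    have "weight d * (fps_X ^ 4 * (?e a d * ?d d b c)) =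
        (fps_X\<^sup>2 * ?e a d) * (weight d * (fps_X\<^sup>2 * ?d d b c))"
      by (simp add: power2_eq_square power4_eq_xxxx mult_ac)
    also have "\<dots> = fps_X ^ excess d * (fps_X ^ (excess a + excess b + excess c) *
        fps_const (bracket_value \<omega> \<Gamma> a d w * partial d (bracket_value \<omega> \<Gamma> b c) w))"
      unfolding eval_coord_bracket[OF w] eval_deriv_coord_bracket[OF w]
      by (simp add: power_add mult_ac flip: fps_const_mult)
    \<comment> \<open>\<open>fps_X ^ excess d\<close> equals \<open>weight d\<close> for
      \<open>X\<close> and \<open>Y\<close>; for \<open>P\<close> it does not, but there the
      derivative of the bracket is zero.\<close>
    also have "\<dots> = weight d * (fps_X ^ (excess a + excess b + excess c) *
        fps_const (bracket_value \<omega> \<Gamma> a d w * partial d (bracket_value \<omega> \<Gamma> b c) w))"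
      by (cases d) (simp_all add: partial_P_bracket_value)
    finally show ?thesis using weight_nonzero[of d] by (simp only: mult_cancel_left) simp
  qed
  have ham: "fps_X ^ 4 * (\<Sum>d\<in>UNIV. ?e a d * ?d d b c) =
      fps_X ^ (excess a + excess b + excess c) * fps_const (hamiltonian a b c w)" for a b c
    unfolding sum_distrib_left tm by (simp add: hamiltonian_def fps_const_sum flip: sum_distrib_left)
  have "fps_X ^ 4 * (\<Sum>d\<in>UNIV. ?e a d * ?d d b c + ?e b d * ?d d c a + ?e c d * ?d d a b) =
      fps_X ^ ?n * fps_const (hamiltonian a b c w + hamiltonian b c a w + hamiltonian c a b w)"
    unfolding sum.distrib distrib_left ham fps_const_add[symmetric] by (simp add: add_ac)
  then show ?thesis by (simp add: hamiltonian_cyclic[OF w])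
qed


subsection \<open>The Poisson bracket of local functions\<close>

abbreviation "lbr \<equiv> local_bracket V \<omega> \<Gamma>"

lemma local_bracket_local:
  "F \<in> local_functions V \<Longrightarrow> H \<in> local_functions V \<Longrightarrow> lbr F H \<in> local_functions V"
  unfolding local_bracket_def
  by (intro local_functions_sum local_functions_mult coord_bracket_local deriv_along_local open_V)

lemma eval_local_bracket:
  "eval_series (lbr F H) w = (\<Sum>a\<in>UNIV. \<Sum>b\<in>UNIV. eval_series (coord_bracket V \<omega> \<Gamma> a b) w *
     eval_series (deriv_along V a F) w * eval_series (deriv_along V b H) w)"
  by (simp add: local_bracket_def eval_series_sum eval_series_mult)

lemma eval_deriv_local_bracket:
  assumes F: "F \<in> local_functions V" and H: "H \<in> local_functions V" and w: "w \<in> total_over V"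
  shows "eval_series (deriv_along V b (lbr F H)) w = (\<Sum>c\<in>UNIV. \<Sum>d\<in>UNIV.
     eval_series (deriv_along V b (coord_bracket V \<omega> \<Gamma> c d)) w * eval_series (deriv_along V c F) w * eval_series (deriv_along V d H) w
   + eval_series (coord_bracket V \<omega> \<Gamma> c d) w * eval_series (deriv_along V b (deriv_along V c F)) w * eval_series (deriv_along V d H) w
   + eval_series (coord_bracket V \<omega> \<Gamma> c d) w * eval_series (deriv_along V c F) w * eval_series (deriv_along V b (deriv_along V d H)) w)"
proof -
  note loc = coord_bracket_local deriv_along_local[OF open_V F] deriv_along_local[OF open_V H]
    local_functions_mult[OF open_V] local_functions_sum[OF open_V]
  show ?thesis
    unfolding local_bracket_def
    by (simp add: deriv_along_sum[OF open_V _ w] deriv_along_mult[OF open_V _ _ w] loc eval_series_mult distrib_right)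
qed

lemmas local_closed = local_functions_add[OF open_V] local_functions_mult[OF open_V] local_bracket_local
  local_functions_minus[OF open_V] local_functions_scale[OF open_V] local_functions_0

lemma local_bracket_skew:
  assumes f: "f \<in> local_functions V" and g: "g \<in> local_functions V"
  shows "lbr f g = - lbr g f"
proof (rule local_functions_eqI)
  fix w assume w: "w \<in> total_over V"
  have "eval_series (lbr f g) w = (\<Sum>b\<in>UNIV. \<Sum>a\<in>UNIV. eval_series (coord_bracket V \<omega> \<Gamma> a b) w *
   eval_series (deriv_along V a f) w * eval_series (deriv_along V b g) w)"
    unfolding eval_local_bracket by (rule sum.swap)
  also have "\<dots> = (\<Sum>b\<in>UNIV. \<Sum>a\<in>UNIV. - (eval_series (coord_bracket V \<omega> \<Gamma> b a) w *
   eval_series (deriv_along V b g) w * eval_series (deriv_along V a f) w))"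
    by (intro sum.cong refl) (subst coord_bracket_skew[OF w], simp add: mult_ac)
  also have "\<dots> = eval_series (- lbr g f) w"
    by (simp add: eval_series_minus eval_local_bracket sum_negf)
  finally show "eval_series (lbr f g) w = eval_series (- lbr g f) w" .
qed (intro local_closed f g)+

lemma local_bracket_add:
  assumes f: "f \<in> local_functions V" and g: "g \<in> local_functions V" and h: "h \<in> local_functions V"
  shows "lbr (f + g) h = lbr f h + lbr g h"
proof (rule local_functions_eqI)
  fix w assume w: "w \<in> total_over V"
  show "eval_series (lbr (f + g) h) w = eval_series (lbr f h + lbr g h) w"
    unfolding eval_series_add eval_local_bracket deriv_along_add[OF open_V f g w] sum.distrib[symmetric]
    by (simp add: distrib_left distrib_right)
qed (intro local_closed f g h)+

lemma local_bracket_mult: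
  assumes f: "f \<in> local_functions V" and g: "g \<in> local_functions V" and h: "h \<in> local_functions V"
  shows "lbr (f \<odot> g) h = f \<odot> lbr g h + lbr f h \<odot> g"
proof (rule local_functions_eqI)
  fix w assume w: "w \<in> total_over V"
  show "eval_series (lbr (f \<odot> g) h) w = eval_series (f \<odot> lbr g h + lbr f h \<odot> g) w"
    unfolding eval_series_add eval_series_mult eval_local_bracket deriv_along_mult[OF open_V f g w]
      sum_distrib_left sum_distrib_right sum.distrib[symmetric]
    by (simp add: algebra_simps)
qed (intro local_closed f g h)+

lemma local_bracket_scale:
  assumes f: "f \<in> local_functions V" and g: "g \<in> local_functions V"
  shows "lbr (series_scale c f) g = series_scale c (lbr f g)"
proof (rule local_functions_eqI)
  fix w assume w: "w \<in> total_over V"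
  show "eval_series (lbr (series_scale c f) g) w = eval_series (series_scale c (lbr f g)) w"
    unfolding eval_series_scale eval_local_bracket deriv_along_scale[OF open_V f w] sum_distrib_left
    by (simp add: mult_ac)
qed (intro local_closed f g)+

text \<open>At each point over \<open>V\<close> this is \<open>jacobi_from_schouten\<close> in the
  ring of real power series.\<close>

lemma local_bracket_jacobi:
  assumes f: "f \<in> local_functions V" and g: "g \<in> local_functions V" and h: "h \<in> local_functions V"
  shows "lbr f (lbr g h) + lbr g (lbr h f) + lbr h (lbr f g) = 0"
proof (rule local_functions_eqI)
  fix w assume w: "w \<in> total_over V"
  note comm = deriv_along_commute[OF open_V _ w]
  show "eval_series (lbr f (lbr g h) + lbr g (lbr h f) + lbr h (lbr f g)) w = eval_series 0 w"
    unfolding eval_series_add eval_local_bracket[of _ "lbr _ _"]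
      eval_deriv_local_bracket[OF f g w] eval_deriv_local_bracket[OF g h w] eval_deriv_local_bracket[OF h f w]
      eval_series_0
    by (rule jacobi_from_schouten[where d\<pi> = "\<lambda>d b c. eval_series (deriv_along V d (coord_bracket V \<omega> \<Gamma> b c)) w"])
       (rule coord_bracket_skew[OF w] comm[OF f] comm[OF g] comm[OF h] schouten[OF w])+
qed (intro local_closed f g h)+

theorem local_poisson_bracket:
  "poisson_bracket_on (local_functions V) series_scale (\<odot>) lbr"
  unfolding poisson_bracket_on_def
  by (intro conjI ballI allI)
     (rule local_closed local_bracket_skew local_bracket_add local_bracket_mult local_bracket_scale
       local_bracket_jacobi; assumption)+

section \<open>Brackets of the coordinate functions\<close>

lemma eval_deriv_x_fun:
  assumes w: "w \<in> total_over V"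
  shows "eval_series (deriv_along V a (x_fun V i)) w = (if a = X i then 1 else 0)"
proof -
  have "weight a * eval_series (deriv_along V a (x_fun V i)) w = fps_partial a (\<lambda>w. fps_const (w $ X i)) w"
    unfolding weight_deriv_along[OF open_V x_fun_local w]
    by (rule fps_partial_cong[OF open_total_over[OF open_V] w]) (simp add: x_fun_def eval_series_base)
  then show ?thesis
    using weight_nonzero[of a] by (cases "a = X i") (simp_all add: fps_partial_const partial_vec_nth)
qed

lemma eval_deriv_p_fun:
  assumes w: "w \<in> total_over V"
  shows "eval_series (deriv_along V a (p_fun V i)) w = (if a = P i then 1 else 0)"
proof -
  have "weight a * eval_series (deriv_along V a (p_fun V i)) w = fps_partial a (\<lambda>w. fps_const (w $ P i)) w"
    unfolding weight_deriv_along[OF open_V p_fun_local w]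
    by (rule fps_partial_cong[OF open_total_over[OF open_V] w]) (simp add: eval_series_p)
  then show ?thesis
    using weight_nonzero[of a] by (cases "a = P i") (simp_all add: fps_partial_const partial_vec_nth)
qed

lemma eval_deriv_y_fun:
  assumes w: "w \<in> total_over V"
  shows "eval_series (deriv_along V a (y_fun V i)) w = (if a = Y i then 1 else 0)"
proof -
  have "weight a * eval_series (deriv_along V a (y_fun V i)) w = fps_partial a (\<lambda>w. fps_X ^ 1 * fps_const (w $ Y i)) w"
    unfolding weight_deriv_along[OF open_V y_fun_local w]
    by (rule fps_partial_cong[OF open_total_over[OF open_V] w]) (simp add: eval_series_y)
  then show ?thesis
    unfolding fps_partial_X_power fps_partial_const
    using weight_nonzero[of a] by (cases "a = Y i") (simp_all add: partial_vec_nth)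
qed

lemma local_bracket_of_coordinates:
  assumes F: "F \<in> local_functions V" and H: "H \<in> local_functions V"
    and "\<And>w c. w \<in> total_over V \<Longrightarrow> eval_series (deriv_along V c F) w = (if c = a then 1 else 0)"
    and "\<And>w c. w \<in> total_over V \<Longrightarrow> eval_series (deriv_along V c H) w = (if c = b then 1 else 0)"
  shows "lbr F H = coord_bracket V \<omega> \<Gamma> a b"
proof (rule local_functions_eqI[OF local_bracket_local[OF F H] coord_bracket_local])
  fix w assume w: "w \<in> total_over V"
  let ?e = "\<lambda>c d. eval_series (coord_bracket V \<omega> \<Gamma> c d) w"
  have "eval_series (lbr F H) w = (\<Sum>c\<in>UNIV. \<Sum>d\<in>UNIV. if d = b then if c = a then ?e c d else 0 else 0)"
    unfolding eval_local_bracket assms(3)[OF w] assms(4)[OF w]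
    by (intro sum.cong refl) auto
  then show "eval_series (lbr F H) w = ?e a b"
    by (simp only: sum.delta finite UNIV_I if_True)
qed

lemma local_bracket_coordinates:
  "lbr (x_fun V i) (p_fun V j) = coord_bracket V \<omega> \<Gamma> (X i) (P j)"
  "lbr (y_fun V i) (y_fun V j) = coord_bracket V \<omega> \<Gamma> (Y i) (Y j)"
  "lbr (p_fun V i) (y_fun V j) = coord_bracket V \<omega> \<Gamma> (P i) (Y j)"
  "lbr (p_fun V i) (p_fun V j) = coord_bracket V \<omega> \<Gamma> (P i) (P j)"
  "lbr (x_fun V i) (x_fun V j) = coord_bracket V \<omega> \<Gamma> (X i) (X j)"
  "lbr (x_fun V i) (y_fun V j) = coord_bracket V \<omega> \<Gamma> (X i) (Y j)"
  by (rule local_bracket_of_coordinates;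
      simp only: x_fun_local p_fun_local y_fun_local eval_deriv_x_fun eval_deriv_p_fun eval_deriv_y_fun)+

end


section \<open>Change of coordinates\<close>

context symplectic_chart
begin

text \<open>The operator \<open>\<nabla>\<close> after evaluation; the factor \<open>fps_X\<close>
  belongs to the linear function of \<open>y\<close> in its vertical part.\<close>

definition horizontal :: "'n \<Rightarrow> 'n series \<Rightarrow> real^'n coord \<Rightarrow> real fps" where
  "horizontal k F w = eval_series (deriv_along V (X k) F) w
     - (\<Sum>j\<in>UNIV. fps_X * fps_const ((G k (xpart w) *v ypart w) $ j) * eval_series (deriv_along V (Y j) F) w)"

lemma eval_local_bracket_horizontal:
  assumes w: "w \<in> total_over V"
  shows "eval_series (lbr F H) w =
    (\<Sum>k\<in>UNIV. horizontal k F w * eval_series (deriv_along V (P k) H) w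
              - eval_series (deriv_along V (P k) F) w * horizontal k H w)
  + (\<Sum>i\<in>UNIV. \<Sum>j\<in>UNIV. fps_const (W (xpart w) $ i $ j)
      * eval_series (deriv_along V (Y i) F) w * eval_series (deriv_along V (Y j) H) w)
  + (\<Sum>i\<in>UNIV. \<Sum>j\<in>UNIV. fps_X\<^sup>2 * fps_const (1/2 * (ypart w \<bullet> ((\<omega> (xpart w) ** R i j (xpart w)) *v ypart w)))
      * eval_series (deriv_along V (P i) F) w * eval_series (deriv_along V (P j) H) w)"
proof -
  let ?D = "\<lambda>a F. eval_series (deriv_along V a F) w"
  let ?g = "\<lambda>k j. fps_X * fps_const ((G k (xpart w) *v ypart w) $ j)"
  have delta: "(\<Sum>i\<in>UNIV. \<Sum>j\<in>UNIV. fps_const (if i = j then 1 else 0) * f i * h j) = (\<Sum>k\<in>UNIV. f k * h k)"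
    for f h :: "'n \<Rightarrow> real fps"
  proof -
    have "(\<Sum>j\<in>UNIV. fps_const (if i = j then 1 else 0) * f i * h j) = (\<Sum>j\<in>UNIV. if i = j then f i * h j else 0)" for i
      by (intro sum.cong) auto
    then show ?thesis by (simp add: sum.delta)
  qed
  have 1: "(\<Sum>i\<in>UNIV. \<Sum>j\<in>UNIV. ?g j i * ?D (Y i) F * ?D (P j) H) = (\<Sum>k\<in>UNIV. (\<Sum>j\<in>UNIV. ?g k j * ?D (Y j) F) * ?D (P k) H)"
    by (subst sum.swap) (simp add: sum_distrib_right)
  have 2: "(\<Sum>i\<in>UNIV. \<Sum>j\<in>UNIV. ?g i j * ?D (P i) F * ?D (Y j) H) = (\<Sum>k\<in>UNIV. ?D (P k) F * (\<Sum>j\<in>UNIV. ?g k j * ?D (Y j) H))"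
    by (simp add: sum_distrib_left mult_ac)
  have "eval_series (lbr F H) w =
      (\<Sum>i\<in>UNIV. \<Sum>j\<in>UNIV. fps_const (if i = j then 1 else 0) * ?D (X i) F * ?D (P j) H)
    - (\<Sum>i\<in>UNIV. \<Sum>j\<in>UNIV. fps_const (if i = j then 1 else 0) * ?D (P i) F * ?D (X j) H)
    + (\<Sum>i\<in>UNIV. \<Sum>j\<in>UNIV. ?g i j * ?D (P i) F * ?D (Y j) H)
    - (\<Sum>i\<in>UNIV. \<Sum>j\<in>UNIV. ?g j i * ?D (Y i) F * ?D (P j) H)
    + (\<Sum>i\<in>UNIV. \<Sum>j\<in>UNIV. fps_const (W (xpart w) $ i $ j) * ?D (Y i) F * ?D (Y j) H)
    + (\<Sum>i\<in>UNIV. \<Sum>j\<in>UNIV. fps_X\<^sup>2 * fps_const (1/2 * (ypart w \<bullet> ((\<omega> (xpart w) ** R i j (xpart w)) *v ypart w)))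
      * ?D (P i) F * ?D (P j) H)"
    unfolding eval_local_bracket sum_coord sum.distrib eval_coord_bracket_PP[OF w]
    by (simp add: eval_series_base[OF w] eval_series_minus eval_coord_bracket_PY[OF w] sum_negf
        del: coord_bracket.simps(9) deriv_along.simps flip: fps_const_neg)
  then show ?thesis
    unfolding delta 1 2
    by (simp add: horizontal_def left_diff_distrib right_diff_distrib sum_subtractf mult.assoc)
qed

end

lemma sum_delta_mult:
  fixes f :: "'n::finite \<Rightarrow> 'r::comm_ring_1"
  shows "(\<Sum>i\<in>UNIV. (if k = i then 1 else 0) * f i) = f k" "(\<Sum>i\<in>UNIV. f i * (if k = i then 1 else 0)) = f k"
    "(\<Sum>i\<in>UNIV. c * ((if k = i then 1 else 0) * f i)) = c * f k"
proof -
  have "(\<Sum>i\<in>UNIV. (if k = i then 1 else 0) * f i) = (\<Sum>i\<in>UNIV. if k = i then f i else 0)"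
    by (intro sum.cong) auto
  then show "(\<Sum>i\<in>UNIV. (if k = i then 1 else 0) * f i) = f k" by simp
  then show "(\<Sum>i\<in>UNIV. f i * (if k = i then 1 else 0)) = f k"
      and "(\<Sum>i\<in>UNIV. c * ((if k = i then 1 else 0) * f i)) = c * f k"
    by (simp_all add: mult.commute sum_distrib_left[symmetric])
qed

lemma fps_partial_chain:
  fixes h :: "real^'n::finite coord \<Rightarrow> real^'n coord"
  assumes "\<And>d. (\<lambda>w. fps_nth (\<Phi> w) d) differentiable (at (h u))"
    and "\<And>b. (\<lambda>u. h u $ b) differentiable (at u)"
  shows "fps_partial a (\<lambda>u. \<Phi> (h u)) u = (\<Sum>b\<in>UNIV. fps_partial b \<Phi> (h u) * fps_const (partial a (\<lambda>u. h u $ b) u))"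
  by (rule fps_ext) (simp add: fps_partial_def fps_sum_nth chain_rule_partial[OF assms])

lemma partial_xpart:
  "partial (X k) (\<lambda>u. f (xpart u)) u = partial k f (xpart u)"
  "partial (P k) (\<lambda>u. f (xpart u)) u = 0" "partial (Y k) (\<lambda>u. f (xpart u)) u = 0"
  using partial_coord[of k "\<lambda>z p y. f z" u] by simp_all

text \<open>
  The bracket in horizontal form under a change of coordinates with Jacobian matrix \<open>J\<close>:
  \<open>h\<close>, \<open>v\<close>, \<open>e\<close> are the horizontal derivatives and the derivatives along \<open>p\<close> and \<open>y\<close>,
  and \<open>h'\<close>, \<open>v'\<close>, \<open>e'\<close> those in the other chart.
  The symmetric matrix \<open>C\<close> is the derivative of \<open>p\<close> along the base.
\<close>

lemma horizontal_bracket_invariant: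
  fixes J C w w' r r' :: "'n::finite \<Rightarrow> 'n \<Rightarrow> 'r::comm_ring_1"
  assumes C: "\<And>i k. C i k = C k i"
    and h: "\<And>k. h1 k + (\<Sum>i\<in>UNIV. C k i * v1 i) = (\<Sum>j\<in>UNIV. J j k * h1' j)"
           "\<And>k. h2 k + (\<Sum>i\<in>UNIV. C k i * v2 i) = (\<Sum>j\<in>UNIV. J j k * h2' j)"
    and v: "\<And>j. (\<Sum>k\<in>UNIV. J j k * v1 k) = v1' j" "\<And>j. (\<Sum>k\<in>UNIV. J j k * v2 k) = v2' j"
    and e: "\<And>k. e1 k = (\<Sum>j\<in>UNIV. J j k * e1' j)" "\<And>k. e2 k = (\<Sum>j\<in>UNIV. J j k * e2' j)"
    and w: "\<And>p q. w' p q = (\<Sum>i\<in>UNIV. \<Sum>j\<in>UNIV. J p i * J q j * w i j)"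
    and r: "\<And>i j. r i j = (\<Sum>p\<in>UNIV. \<Sum>q\<in>UNIV. J p i * J q j * r' p q)"
  shows "(\<Sum>k\<in>UNIV. h1 k * v2 k - v1 k * h2 k) + (\<Sum>i\<in>UNIV. \<Sum>j\<in>UNIV. w i j * e1 i * e2 j)
      + (\<Sum>i\<in>UNIV. \<Sum>j\<in>UNIV. r i j * v1 i * v2 j)
    = (\<Sum>k\<in>UNIV. h1' k * v2' k - v1' k * h2' k) + (\<Sum>i\<in>UNIV. \<Sum>j\<in>UNIV. w' i j * e1' i * e2' j)
      + (\<Sum>i\<in>UNIV. \<Sum>j\<in>UNIV. r' i j * v1' i * v2' j)"
proof -
  \<comment> \<open>A symmetric matrix pairs \<open>v1\<close> and \<open>v2\<close> symmetrically,
    so its contribution drops out of the antisymmetric expression in \<open>h\<close> and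
    \<open>v\<close>.\<close>
  have C_cancel: "(\<Sum>k\<in>UNIV. (\<Sum>i\<in>UNIV. C k i * v1 i) * v2 k) = (\<Sum>k\<in>UNIV. v1 k * (\<Sum>i\<in>UNIV. C k i * v2 i))"
    unfolding sum_distrib_left sum_distrib_right
    by (subst sum.swap) (intro sum.cong refl, simp add: C mult_ac)
  have J1: "(\<Sum>k\<in>UNIV. (\<Sum>j\<in>UNIV. J j k * h1' j) * v2 k) = (\<Sum>j\<in>UNIV. h1' j * v2' j)"
    unfolding v[symmetric] sum_distrib_left sum_distrib_right
    by (subst sum.swap) (simp add: mult_ac)
  have J2: "(\<Sum>k\<in>UNIV. v1 k * (\<Sum>j\<in>UNIV. J j k * h2' j)) = (\<Sum>j\<in>UNIV. v1' j * h2' j)"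
    unfolding v[symmetric] sum_distrib_left sum_distrib_right
    by (subst sum.swap) (simp add: mult_ac)
  have h': "h1 k = (\<Sum>j\<in>UNIV. J j k * h1' j) - (\<Sum>i\<in>UNIV. C k i * v1 i)"
      "h2 k = (\<Sum>j\<in>UNIV. J j k * h2' j) - (\<Sum>i\<in>UNIV. C k i * v2 i)" for k
    using h[of k] by (simp_all add: eq_diff_eq)
  have "(\<Sum>k\<in>UNIV. h1 k * v2 k - v1 k * h2 k) = (\<Sum>k\<in>UNIV. h1' k * v2' k - v1' k * h2' k)"
    unfolding h' left_diff_distrib right_diff_distrib sum_subtractf C_cancel J1 J2 by simp
  moreover have "(\<Sum>i\<in>UNIV. \<Sum>j\<in>UNIV. w i j * e1 i * e2 j) = (\<Sum>p\<in>UNIV. \<Sum>q\<in>UNIV. w' p q * e1' p * e2' q)"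
  proof -
    have "(\<Sum>i\<in>UNIV. \<Sum>j\<in>UNIV. w i j * e1 i * e2 j) =
        (\<Sum>i\<in>UNIV. \<Sum>j\<in>UNIV. \<Sum>p\<in>UNIV. \<Sum>q\<in>UNIV. J p i * J q j * w i j * e1' p * e2' q)"
      unfolding e mult.assoc unfolding sum_product unfolding sum_distrib_left
      by (intro sum.cong refl) (simp add: mult_ac)
    also have "\<dots> = (\<Sum>p\<in>UNIV. \<Sum>q\<in>UNIV. \<Sum>i\<in>UNIV. \<Sum>j\<in>UNIV. J p i * J q j * w i j * e1' p * e2' q)"
      unfolding sum.cartesian_product UNIV_Times_UNIV
      by (rule sum.reindex_bij_witness[of _ "\<lambda>(p, q, i, j). (i, j, p, q)" "\<lambda>(p, q, i, j). (i, j, p, q)"]) auto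
    finally show ?thesis unfolding w sum_distrib_right .
  qed
  moreover have "(\<Sum>i\<in>UNIV. \<Sum>j\<in>UNIV. r i j * v1 i * v2 j) = (\<Sum>p\<in>UNIV. \<Sum>q\<in>UNIV. r' p q * v1' p * v2' q)"
  proof -
    have "(\<Sum>i\<in>UNIV. \<Sum>j\<in>UNIV. r i j * v1 i * v2 j) =
        (\<Sum>i\<in>UNIV. \<Sum>j\<in>UNIV. \<Sum>p\<in>UNIV. \<Sum>q\<in>UNIV. J p i * J q j * r' p q * v1 i * v2 j)"
      unfolding r sum_distrib_right ..
    also have "\<dots> = (\<Sum>p\<in>UNIV. \<Sum>q\<in>UNIV. \<Sum>i\<in>UNIV. \<Sum>j\<in>UNIV. J p i * J q j * r' p q * v1 i * v2 j)"
      unfolding sum.cartesian_product UNIV_Times_UNIV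
      by (rule sum.reindex_bij_witness[of _ "\<lambda>(p, q, i, j). (i, j, p, q)" "\<lambda>(p, q, i, j). (i, j, p, q)"]) auto
    finally show ?thesis
      unfolding v[symmetric] mult.assoc unfolding sum_product unfolding sum_distrib_left
      by (simp add: mult_ac)
  qed
  ultimately show ?thesis by simp
qed

text \<open>\<open>S\<close> is the overlap in the coordinates of the first chart, \<open>c\<close>
  the change of coordinates and \<open>J\<close> its Jacobian; the tensor and connection laws are
  put in matrix form.\<close>

locale symplectic_chart_change =
  a: symplectic_chart Va \<omega>a \<Gamma>a + b: symplectic_chart Vb \<omega>b \<Gamma>b
  for Va Vb :: "(real^'n::finite) set" and \<omega>a \<Gamma>a \<omega>b \<Gamma>b +
  fixes S :: "(real^'n) set" and c :: "real^'n \<Rightarrow> real^'n" and J :: "real^'n \<Rightarrow> real^'n^'n"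
    and \<rho>a \<rho>b :: "real^'n \<Rightarrow> real^'n"
  assumes open_S: "open S" and S_Va: "S \<subseteq> Va" and c_Vb: "\<And>z. z \<in> S \<Longrightarrow> c z \<in> Vb"
    and smooth_c: "\<And>j. smooth_on S (\<lambda>z. c z $ j)"
    and J_eq: "\<And>z i j. J z $ j $ i = partial i (\<lambda>z. c z $ j) z"
    and \<omega>_change: "\<And>z. z \<in> S \<Longrightarrow> \<omega>a z = transpose (J z) ** \<omega>b (c z) ** J z"
    and \<Gamma>_change: "\<And>z i. z \<in> S \<Longrightarrow> J z ** conn_matrix \<Gamma>a i z =
      matrix_partial i J z + (\<Sum>p\<in>UNIV. J z $ p $ i *\<^sub>R conn_matrix \<Gamma>b p (c z)) ** J z"
    and smooth_\<rho>a: "\<And>i. smooth_on Va (\<lambda>z. \<rho>a z $ i)" and smooth_\<rho>b: "\<And>i. smooth_on Vb (\<lambda>z. \<rho>b z $ i)"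
    and d\<rho>a: "\<And>z i j. z \<in> Va \<Longrightarrow> \<omega>a z $ i $ j = partial i (\<lambda>z. \<rho>a z $ j) z - partial j (\<lambda>z. \<rho>a z $ i) z"
    and d\<rho>b: "\<And>z i j. z \<in> Vb \<Longrightarrow> \<omega>b z $ i $ j = partial i (\<lambda>z. \<rho>b z $ j) z - partial j (\<lambda>z. \<rho>b z $ i) z"
begin

text \<open>The difference of the two potentials, in the coordinates of the first chart; it is the
  affine part of the law for \<open>p\<close>.\<close>

definition \<theta> :: "real^'n \<Rightarrow> real^'n" where
  "\<theta> z = (\<chi> i. \<rho>a z $ i - (\<Sum>j\<in>UNIV. \<rho>b (c z) $ j * J z $ j $ i))"

lemma matrix_smooth_J: "matrix_smooth_on S J"
  unfolding matrix_smooth_on_def J_eq[abs_def] using smooth_on_partial[OF smooth_c] by blast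

lemma partial_J_commute: "z \<in> S \<Longrightarrow> partial k (\<lambda>z. J z $ j $ i) z = partial i (\<lambda>z. J z $ j $ k) z"
  unfolding J_eq[abs_def] using smooth_on_partial_commute[OF open_S smooth_c] by blast

lemma smooth_on_comp_c: "smooth_on Vb f \<Longrightarrow> smooth_on S (\<lambda>z. f (c z))"
  using smooth_on_compose[OF open_S b.open_V smooth_c c_Vb] by blast

lemma partial_comp_c:
  assumes "smooth_on Vb f" "z \<in> S"
  shows "partial i (\<lambda>z. f (c z)) z = (\<Sum>p\<in>UNIV. partial p f (c z) * J z $ p $ i)"
  unfolding J_eq
  using assms smooth_on_imp_differentiable[OF open_S smooth_c]
  by (intro chain_rule_partial) (auto intro: smooth_on_imp_differentiable[OF b.open_V] c_Vb)

lemma smooth_J: "smooth_on S (\<lambda>z. J z $ j $ i)"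
  using matrix_smooth_J by (simp add: matrix_smooth_on_def)

lemma smooth_\<theta>: "smooth_on S (\<lambda>z. \<theta> z $ i)"
proof -
  have "smooth_on S (\<lambda>z. \<rho>a z $ i)"
    using smooth_\<rho>a S_Va unfolding smooth_on_def by (blast intro: differentiable_on_subset)
  then show ?thesis
    unfolding \<theta>_def vec_lambda_beta
    by (intro smooth_on_diff smooth_on_sum smooth_on_mult smooth_on_comp_c[of "\<lambda>z. \<rho>b z $ j" for j] open_S smooth_J smooth_\<rho>b)
qed

text \<open>The exterior derivative of \<open>\<theta>\<close> is \<open>\<omega>a\<close> minus the
  pullback of \<open>\<omega>b\<close>, which is zero; second derivatives of \<open>c\<close> drop
  out by their symmetry.\<close>

lemma partial_\<theta>_commute:
  assumes z: "z \<in> S"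
  shows "partial k (\<lambda>z. \<theta> z $ i) z = partial i (\<lambda>z. \<theta> z $ k) z"
proof -
  have za: "z \<in> Va" using z S_Va by blast
  have da: "(\<lambda>z. \<rho>a z $ i) differentiable (at z)" for i
    by (rule smooth_on_imp_differentiable[OF a.open_V smooth_\<rho>a za])
  have db: "(\<lambda>z. \<rho>b (c z) $ j) differentiable (at z)" for j
    by (rule smooth_on_imp_differentiable[OF open_S smooth_on_comp_c[OF smooth_\<rho>b] z])
  have dJ: "(\<lambda>z. J z $ j $ i) differentiable (at z)" for i j
    by (rule smooth_on_imp_differentiable[OF open_S smooth_J z])
  have p: "partial k (\<lambda>z. \<theta> z $ i) z = partial k (\<lambda>z. \<rho>a z $ i) z
      - (\<Sum>j\<in>UNIV. \<Sum>p\<in>UNIV. partial p (\<lambda>z. \<rho>b z $ j) (c z) * J z $ p $ k * J z $ j $ i)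
      - (\<Sum>j\<in>UNIV. \<rho>b (c z) $ j * partial k (\<lambda>z. J z $ j $ i) z)" for i k
    unfolding \<theta>_def vec_lambda_beta
    by (simp add: partial_diff partial_sum partial_mult da db dJ differentiable_sum_at
        partial_comp_c[OF smooth_\<rho>b z] sum.distrib sum_distrib_right)
  have "(\<Sum>j\<in>UNIV. \<Sum>p\<in>UNIV. partial p (\<lambda>z. \<rho>b z $ j) (c z) * J z $ p $ i * J z $ j $ k) =
      (\<Sum>j\<in>UNIV. \<Sum>p\<in>UNIV. partial j (\<lambda>z. \<rho>b z $ p) (c z) * J z $ p $ k * J z $ j $ i)"
    by (subst sum.swap) (simp add: mult_ac)
  then have "partial k (\<lambda>z. \<theta> z $ i) z - partial i (\<lambda>z. \<theta> z $ k) z =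
      \<omega>a z $ k $ i - (\<Sum>j\<in>UNIV. \<Sum>p\<in>UNIV. \<omega>b (c z) $ p $ j * J z $ p $ k * J z $ j $ i)"
    unfolding p d\<rho>a[OF za] d\<rho>b[OF c_Vb[OF z]] partial_J_commute[OF z, of k _ i]
    by (simp add: left_diff_distrib sum_subtractf)
  also have "\<dots> = 0"
    unfolding \<omega>_change[OF z]
    by (simp add: matrix_matrix_mult_def transpose_def sum_distrib_right sum_distrib_left mult_ac)
  finally show ?thesis by simp
qed

lemma W_change:
  assumes z: "z \<in> S"
  shows "matrix_inv (\<omega>b (c z)) = J z ** matrix_inv (\<omega>a z) ** transpose (J z)"
proof -
  have za: "z \<in> Va" using z S_Va by blast
  note ia = matrix_inv_inverse[OF a.\<omega>_invertible[OF za]]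
  note ib = matrix_inv_inverse[OF b.\<omega>_invertible[OF c_Vb[OF z]]]
  \<comment> \<open>A right inverse of \<open>transpose (J z)\<close>, hence for square matrices
    also a left inverse; invertibility of the Jacobian comes from that of
    \<open>\<omega>a\<close>.\<close>
  let ?K = "\<omega>b (c z) ** J z ** matrix_inv (\<omega>a z)"
  have "transpose (J z) ** ?K = mat 1"
    using ia(1) unfolding \<omega>_change[OF z] by (simp add: matrix_mul_assoc)
  then have "?K ** transpose (J z) = mat 1"
    by (rule matrix_left_right_inverse1)
  then have "matrix_inv (\<omega>b (c z)) ** (?K ** transpose (J z)) = matrix_inv (\<omega>b (c z))"
    by simp
  then show ?thesis by (simp add: matrix_mul_assoc ib)
qed


section \<open>Transformation of the curvature\<close>

lemma sum_scaleR_mult: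
  fixes g h :: "'n \<Rightarrow> real" and A B :: "'n \<Rightarrow> real^'n^'n"
  shows "(\<Sum>p\<in>UNIV. g p *\<^sub>R A p) ** (\<Sum>q\<in>UNIV. h q *\<^sub>R B q) = (\<Sum>p\<in>UNIV. \<Sum>q\<in>UNIV. (g p * h q) *\<^sub>R (A p ** B q))"
proof -
  have 1: "(\<Sum>p\<in>UNIV. g p *\<^sub>R A p) ** C = (\<Sum>p\<in>UNIV. g p *\<^sub>R (A p ** C))" for C
  proof -
    have "linear (\<lambda>M::real^'n^'n. M ** C)"
      by (rule linearI) (simp add: matrix_ring_simps, simp add: vec_eq_iff matrix_matrix_mult_def sum_distrib_left mult.assoc)
    then show ?thesis
      using linear_sum[of "\<lambda>M. M ** C" "\<lambda>p. g p *\<^sub>R A p" UNIV] by (simp add: linear_scale[of "\<lambda>M. M ** C"])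
  qed
  have 2: "C ** (\<Sum>q\<in>UNIV. h q *\<^sub>R B q) = (\<Sum>q\<in>UNIV. h q *\<^sub>R (C ** B q))" for C
  proof -
    have "linear (\<lambda>M::real^'n^'n. C ** M)"
      by (rule linearI) (simp add: matrix_ring_simps, simp add: vec_eq_iff matrix_matrix_mult_def sum_distrib_left mult_ac)
    then show ?thesis
      using linear_sum[of "\<lambda>M. C ** M" "\<lambda>q. h q *\<^sub>R B q" UNIV] by (simp add: linear_scale[of "\<lambda>M. C ** M"])
  qed
  show ?thesis
    unfolding 1 2 scaleR_sum_right scaleR_scaleR by (subst sum.swap) (simp add: mult.commute)
qed

text \<open>The connection form of the second chart pulled back along \<open>c\<close>, still in the
  frame of the second chart; the change of frame by \<open>J\<close> is a separate step.\<close>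

definition pullback_conn :: "'n \<Rightarrow> real^'n \<Rightarrow> real^'n^'n" where
  "pullback_conn i z = (\<Sum>p\<in>UNIV. J z $ p $ i *\<^sub>R conn_matrix \<Gamma>b p (c z))"

lemma matrix_smooth_pullback_conn: "matrix_smooth_on S (pullback_conn i)"
proof -
  have "smooth_on S (\<lambda>z. \<Sum>p\<in>UNIV. J z $ p $ i * \<Gamma>b j p k (c z))" for j k
    by (intro smooth_on_sum smooth_on_mult open_S smooth_J smooth_on_comp_c b.smooth_\<Gamma>)
  then show ?thesis
    by (simp add: matrix_smooth_on_def pullback_conn_def conn_matrix_def)
qed

text \<open>Forming the curvature commutes with pullback: the terms with derivatives of
  \<open>J\<close> are symmetric in \<open>i\<close> and \<open>j\<close> and cancel.\<close>

lemma pullback_curvature: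
  assumes z: "z \<in> S"
  shows "matrix_partial i (pullback_conn j) z + pullback_conn i z ** pullback_conn j z
      - matrix_partial j (pullback_conn i) z - pullback_conn j z ** pullback_conn i z
    = (\<Sum>p\<in>UNIV. \<Sum>q\<in>UNIV. (J z $ p $ i * J z $ q $ j) *\<^sub>R curv_matrix \<Gamma>b p q (c z))"
proof -
  let ?D = "\<lambda>i j. \<Sum>p\<in>UNIV. \<Sum>q\<in>UNIV. (J z $ p $ i * J z $ q $ j) *\<^sub>R
      (matrix_partial p (conn_matrix \<Gamma>b q) (c z) + conn_matrix \<Gamma>b p (c z) ** conn_matrix \<Gamma>b q (c z))"
  have dJ: "(\<lambda>z. J z $ j $ i) differentiable (at z)" for i j
    by (rule smooth_on_imp_differentiable[OF open_S smooth_J z])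
  have dG: "(\<lambda>z. \<Gamma>b k q l (c z)) differentiable (at z)" for k q l
    by (rule smooth_on_imp_differentiable[OF open_S smooth_on_comp_c[OF b.smooth_\<Gamma>] z])
  have "matrix_partial i (pullback_conn j) z =
      (\<Sum>q\<in>UNIV. partial i (\<lambda>z. J z $ q $ j) z *\<^sub>R conn_matrix \<Gamma>b q (c z))
    + (\<Sum>p\<in>UNIV. \<Sum>q\<in>UNIV. (J z $ p $ i * J z $ q $ j) *\<^sub>R matrix_partial p (conn_matrix \<Gamma>b q) (c z))" for i j
  proof -
    have "partial i (\<lambda>z. \<Sum>q\<in>UNIV. J z $ q $ j * \<Gamma>b k q l (c z)) z =
        (\<Sum>q\<in>UNIV. partial i (\<lambda>z. J z $ q $ j) z * \<Gamma>b k q l (c z))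
      + (\<Sum>q\<in>UNIV. \<Sum>p\<in>UNIV. J z $ p $ i * J z $ q $ j * partial p (\<Gamma>b k q l) (c z))" for k l
      by (simp add: partial_sum partial_mult dJ dG partial_comp_c[OF b.smooth_\<Gamma> z] sum.distrib
          sum_distrib_left mult_ac)
    then show ?thesis
      by (subst sum.swap)
         (simp add: vec_eq_iff matrix_partial_def pullback_conn_def conn_matrix_def)
  qed
  then have "matrix_partial i (pullback_conn j) z + pullback_conn i z ** pullback_conn j z =
      (\<Sum>q\<in>UNIV. partial i (\<lambda>z. J z $ q $ j) z *\<^sub>R conn_matrix \<Gamma>b q (c z)) + ?D i j" for i j
    by (simp add: pullback_conn_def sum_scaleR_mult scaleR_add_right sum.distrib)
  note * = this
  have "matrix_partial i (pullback_conn j) z + pullback_conn i z ** pullback_conn j z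
      - matrix_partial j (pullback_conn i) z - pullback_conn j z ** pullback_conn i z = ?D i j - ?D j i"
    using *[of i j] *[of j i] partial_J_commute[OF z, of i _ j] by (simp add: algebra_simps)
  also have "?D j i = (\<Sum>p\<in>UNIV. \<Sum>q\<in>UNIV. (J z $ p $ i * J z $ q $ j) *\<^sub>R
      (matrix_partial q (conn_matrix \<Gamma>b p) (c z) + conn_matrix \<Gamma>b q (c z) ** conn_matrix \<Gamma>b p (c z)))"
    by (subst sum.swap) (simp add: mult.commute)
  finally show ?thesis
    unfolding sum_subtractf[symmetric] scaleR_diff_right[symmetric]
    by (simp add: curv_matrix_eq diff_diff_eq)
qed

text \<open>The connection law says that \<open>J\<close> intertwines the operators
  \<open>\<partial>_i + G i\<close> of the first chart with the pulled back ones, hence also their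
  commutators, which are the curvatures.\<close>

lemma R_change:
  assumes z: "z \<in> S"
  shows "J z ** curv_matrix \<Gamma>a i j z =
    (\<Sum>p\<in>UNIV. \<Sum>q\<in>UNIV. (J z $ p $ i * J z $ q $ j) *\<^sub>R curv_matrix \<Gamma>b p q (c z)) ** J z"
proof -
  let ?G = "conn_matrix \<Gamma>a" and ?B = "pullback_conn"
  have za: "z \<in> Va" using z S_Va by blast
  have law: "J z ** ?G i z = matrix_partial i J z + ?B i z ** J z" if "z \<in> S" for i z
    using \<Gamma>_change[OF that] by (simp add: pullback_conn_def)
  have smG: "matrix_smooth_on S (?G i)" for i
    using a.matrix_smooth_G S_Va unfolding matrix_smooth_on_def smooth_on_def
    by (blast intro: differentiable_on_subset)
  have 1: "matrix_partial j J z ** ?G i z + J z ** matrix_partial j (?G i) z =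
      matrix_partial j (matrix_partial i J) z + (matrix_partial j (?B i) z ** J z + ?B i z ** matrix_partial j J z)" for i j
  proof -
    have "matrix_partial j (\<lambda>z. J z ** ?G i z) z = matrix_partial j (\<lambda>z. matrix_partial i J z + ?B i z ** J z) z"
      by (rule matrix_partial_cong[OF open_S z]) (rule law)
    then show ?thesis
      by (simp add: matrix_partial_add[OF open_S _ _ z] matrix_partial_mult[OF open_S _ _ z]
          matrix_smooth_on_mult[OF open_S] matrix_smooth_on_partial[OF open_S] matrix_smooth_J smG
          matrix_smooth_pullback_conn)
  qed
  have 2: "J z ** (?G j z ** ?G i z) = matrix_partial j J z ** ?G i z + ?B j z ** matrix_partial i J z
      + ?B j z ** ?B i z ** J z" for i j
  proof -
    have "J z ** (?G j z ** ?G i z) = (matrix_partial j J z + ?B j z ** J z) ** ?G i z"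
      by (simp add: matrix_mul_assoc law[OF z])
    also have "\<dots> = matrix_partial j J z ** ?G i z + ?B j z ** (J z ** ?G i z)"
      by (simp add: matrix_ring_simps matrix_mul_assoc)
    finally show ?thesis
      by (simp add: law[OF z] matrix_ring_simps matrix_mul_assoc)
  qed
  \<comment> \<open>Solved for the term that occurs in the curvature; the products with
    \<open>?G\<close> on the right then cancel against those in \<open>2\<close>.\<close>
  have 1: "J z ** matrix_partial j (?G i) z = matrix_partial j (matrix_partial i J) z
      + (matrix_partial j (?B i) z ** J z + ?B i z ** matrix_partial j J z) - matrix_partial j J z ** ?G i z" for i j
    using 1[of j i] by (simp add: eq_diff_eq add.commute)
  have "J z ** curv_matrix \<Gamma>a i j z =
      J z ** matrix_partial i (?G j) z + J z ** (?G i z ** ?G j z)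
    - J z ** matrix_partial j (?G i) z - J z ** (?G j z ** ?G i z)"
    by (simp add: curv_matrix_eq matrix_ring_simps)
  also have "\<dots> = (matrix_partial i (?B j) z + ?B i z ** ?B j z
      - matrix_partial j (?B i) z - ?B j z ** ?B i z) ** J z"
    using matrix_partial_commute[OF open_S matrix_smooth_J z, of i j]
    unfolding 1 2 by (simp add: matrix_ring_simps algebra_simps)
  finally show ?thesis unfolding pullback_curvature[OF z] .
qed

lemma curvature_form_change:
  assumes z: "z \<in> S"
  shows "y \<bullet> ((\<omega>a z ** curv_matrix \<Gamma>a i j z) *v y) =
    (\<Sum>p\<in>UNIV. \<Sum>q\<in>UNIV. J z $ p $ i * J z $ q $ j *
       ((J z *v y) \<bullet> ((\<omega>b (c z) ** curv_matrix \<Gamma>b p q (c z)) *v (J z *v y))))"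
proof -
  let ?R = "\<lambda>p q. curv_matrix \<Gamma>b p q (c z)" and ?y = "J z *v y"
  have "linear (\<lambda>M::real^'n^'n. ?y \<bullet> (\<omega>b (c z) *v (M *v ?y)))"
    by (rule linearI)
       (simp_all add: matrix_vector_simps matrix_vector_right_distrib inner_add_right
          scaleR_matrix_vector_assoc[symmetric] matrix_vector_mult_scaleR)
  note lin = this
  have "\<omega>a z ** curv_matrix \<Gamma>a i j z = transpose (J z) ** (\<omega>b (c z) ** (J z ** curv_matrix \<Gamma>a i j z))"
    by (simp add: \<omega>_change[OF z] matrix_mul_assoc)
  then have "y \<bullet> ((\<omega>a z ** curv_matrix \<Gamma>a i j z) *v y) =
      ?y \<bullet> (\<omega>b (c z) *v ((\<Sum>p\<in>UNIV. \<Sum>q\<in>UNIV. (J z $ p $ i * J z $ q $ j) *\<^sub>R ?R p q) *v ?y))"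
    unfolding R_change[OF z] by (simp add: inner_transpose_mult matrix_vector_mul_assoc)
  also have "\<dots> = (\<Sum>p\<in>UNIV. \<Sum>q\<in>UNIV. J z $ p $ i * J z $ q $ j * (?y \<bullet> (\<omega>b (c z) *v (?R p q *v ?y))))"
    by (simp add: linear_sum[OF lin] linear_scale[OF lin])
  finally show ?thesis by (simp add: matrix_vector_mul_assoc matrix_mul_assoc)
qed


text \<open>
  The transition laws give \<open>p\<^sub>\<alpha>\<close> in terms of \<open>p\<^sub>\<beta>\<close> but \<open>y\<^sub>\<beta>\<close> in terms of \<open>y\<^sub>\<alpha>\<close>, so both charts are
  compared over the mixed coordinates \<open>(x\<^sub>\<alpha>, p\<^sub>\<beta>, y\<^sub>\<alpha>)\<close>.
\<close>

definition to_a :: "real^'n coord \<Rightarrow> real^'n coord" where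
  "to_a u = point (xpart u) (\<chi> i. (\<Sum>j\<in>UNIV. ppart u $ j * J (xpart u) $ j $ i) + \<theta> (xpart u) $ i) (ypart u)"

definition to_b :: "real^'n coord \<Rightarrow> real^'n coord" where
  "to_b u = point (c (xpart u)) (ppart u) (J (xpart u) *v ypart u)"

text \<open>The gluing condition of \<open>global_functions\<close>, all degrees in \<open>y\<close>
  collected in one power series.\<close>

definition agree :: "'n series \<Rightarrow> 'n series \<Rightarrow> bool" where
  "agree F F' \<longleftrightarrow> (\<forall>u\<in>total_over S. eval_series F (to_a u) = eval_series F' (to_b u))"

context
  fixes u
  assumes u: "u \<in> total_over S"
begin

lemma base_point: "xpart u \<in> S"
  using u by (simp add: total_over_def)

lemma to_a_in: "to_a u \<in> total_over Va" and to_b_in: "to_b u \<in> total_over Vb"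
  using base_point S_Va c_Vb by (auto simp: total_over_def to_a_def to_b_def)

lemma differentiable_base: "smooth_on S f \<Longrightarrow> (\<lambda>u. f (xpart u)) differentiable (at u)"
  using smooth_on_imp_differentiable[OF open_total_over[OF open_S] smooth_on_xpart[OF open_S] u] .

lemmas differentiable_J = differentiable_base[OF smooth_J]
lemmas differentiable_\<theta> = differentiable_base[OF smooth_\<theta>]
lemmas differentiable_c = differentiable_base[OF smooth_c]

lemma to_a_differentiable: "(\<lambda>u. to_a u $ b) differentiable (at u)"
  by (cases b) (simp_all add: to_a_def differentiable_sum_at differentiable_J differentiable_\<theta>)

lemma to_b_differentiable: "(\<lambda>u. to_b u $ b) differentiable (at u)"
  by (cases b) (simp_all add: to_b_def matrix_vector_nth differentiable_sum_at differentiable_J differentiable_c)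

lemma partial_to_a:
  "partial (X k) (\<lambda>u. to_a u $ X i) u = (if k = i then 1 else 0)"
  "partial (X k) (\<lambda>u. to_a u $ P i) u =
     (\<Sum>j\<in>UNIV. ppart u $ j * partial k (\<lambda>z. J z $ j $ i) (xpart u)) + partial k (\<lambda>z. \<theta> z $ i) (xpart u)"
  "partial (X k) (\<lambda>u. to_a u $ Y i) u = 0"
  "partial (P k) (\<lambda>u. to_a u $ X i) u = 0"
  "partial (P k) (\<lambda>u. to_a u $ P i) u = J (xpart u) $ k $ i"
  "partial (P k) (\<lambda>u. to_a u $ Y i) u = 0"
  "partial (Y k) (\<lambda>u. to_a u $ X i) u = 0"
  "partial (Y k) (\<lambda>u. to_a u $ P i) u = 0"
  "partial (Y k) (\<lambda>u. to_a u $ Y i) u = (if k = i then 1 else 0)"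
  by (simp_all add: to_a_def partial_add partial_sum partial_mult differentiable_sum_at differentiable_J
      differentiable_\<theta> partial_vec_nth partial_xpart(1)[of _ "\<lambda>z. J z $ _ $ _"] partial_xpart(2)[of _ "\<lambda>z. J z $ _ $ _"]
      partial_xpart(3)[of _ "\<lambda>z. J z $ _ $ _"] partial_xpart[of _ "\<lambda>z. \<theta> z $ _"] if_distrib if_distribR sum.delta cong: if_cong)

lemma partial_to_b:
  "partial (X k) (\<lambda>u. to_b u $ X j) u = J (xpart u) $ j $ k"
  "partial (X k) (\<lambda>u. to_b u $ P j) u = 0"
  "partial (X k) (\<lambda>u. to_b u $ Y j) u = (matrix_partial k J (xpart u) *v ypart u) $ j"
  "partial (P k) (\<lambda>u. to_b u $ X j) u = 0"
  "partial (P k) (\<lambda>u. to_b u $ P j) u = (if k = j then 1 else 0)"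
  "partial (P k) (\<lambda>u. to_b u $ Y j) u = 0"
  "partial (Y k) (\<lambda>u. to_b u $ X j) u = 0"
  "partial (Y k) (\<lambda>u. to_b u $ P j) u = 0"
  "partial (Y k) (\<lambda>u. to_b u $ Y j) u = J (xpart u) $ j $ k"
  by (simp_all add: to_b_def matrix_vector_nth matrix_partial_def partial_sum partial_mult differentiable_J
      partial_vec_nth partial_xpart[of _ "\<lambda>z. c z $ _"] partial_xpart(1)[of _ "\<lambda>z. J z $ _ $ _"] partial_xpart(2)[of _ "\<lambda>z. J z $ _ $ _"]
      partial_xpart(3)[of _ "\<lambda>z. J z $ _ $ _"] J_eq[symmetric] if_distrib if_distribR sum.delta cong: if_cong)

text \<open>Differentiates the gluing condition along a mixed coordinate, with the chain rule on
  both sides; the transformation laws of all derivatives are its instances.\<close>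

lemma agree_derivative:
  assumes F: "F \<in> local_functions Va" and F': "F' \<in> local_functions Vb" and eq: "agree F F'"
  shows "(\<Sum>b\<in>UNIV. weight b * eval_series (deriv_along Va b F) (to_a u) * fps_const (partial a (\<lambda>u. to_a u $ b) u))
    = (\<Sum>b\<in>UNIV. weight b * eval_series (deriv_along Vb b F') (to_b u) * fps_const (partial a (\<lambda>u. to_b u $ b) u))"
proof -
  have "fps_partial a (\<lambda>u. eval_series F (to_a u)) u = fps_partial a (\<lambda>u. eval_series F' (to_b u)) u"
    by (rule fps_partial_cong[OF open_total_over[OF open_S] u]) (use eq in \<open>simp add: agree_def\<close>)
  then show ?thesis
    unfolding weight_deriv_along[OF a.open_V F to_a_in] weight_deriv_along[OF b.open_V F' to_b_in]
      fps_partial_chain[OF differentiable_eval_series[OF a.open_V F to_a_in] to_a_differentiable]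
      fps_partial_chain[OF differentiable_eval_series[OF b.open_V F' to_b_in] to_b_differentiable] .
qed

text \<open>The laws run in opposite directions: \<open>to_a\<close> changes \<open>p\<close> and
  keeps \<open>y\<close>, whereas \<open>to_b\<close> keeps \<open>p\<close> and changes
  \<open>y\<close>.\<close>

lemma agree_vertical:
  assumes F: "F \<in> local_functions Va" and F': "F' \<in> local_functions Vb" and eq: "agree F F'"
  shows "(\<Sum>i\<in>UNIV. fps_const (J (xpart u) $ k $ i) * eval_series (deriv_along Va (P i) F) (to_a u))
      = eval_series (deriv_along Vb (P k) F') (to_b u)"
    and "eval_series (deriv_along Va (Y k) F) (to_a u) =
      (\<Sum>j\<in>UNIV. fps_const (J (xpart u) $ j $ k) * eval_series (deriv_along Vb (Y j) F') (to_b u))"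
proof -
  note simps = sum_coord partial_to_a partial_to_b if_distrib[of fps_const] sum_delta_mult
  show "(\<Sum>i\<in>UNIV. fps_const (J (xpart u) $ k $ i) * eval_series (deriv_along Va (P i) F) (to_a u))
      = eval_series (deriv_along Vb (P k) F') (to_b u)"
    using agree_derivative[OF F F' eq, of "P k"]
    by (simp add: simps mult.commute del: deriv_along.simps cong: if_cong)
  have "fps_X * eval_series (deriv_along Va (Y k) F) (to_a u) =
      fps_X * (\<Sum>j\<in>UNIV. fps_const (J (xpart u) $ j $ k) * eval_series (deriv_along Vb (Y j) F') (to_b u))"
    using agree_derivative[OF F F' eq, of "Y k"]
    by (simp add: simps sum_distrib_left mult_ac del: deriv_along.simps cong: if_cong)
  then show "eval_series (deriv_along Va (Y k) F) (to_a u) =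
      (\<Sum>j\<in>UNIV. fps_const (J (xpart u) $ j $ k) * eval_series (deriv_along Vb (Y j) F') (to_b u))"
    by (simp only: mult_cancel_left) simp
qed

text \<open>The matrix \<open>C\<close>: the derivative of the first chart's \<open>p\<close> along
  the base, with the second chart's \<open>p\<close> held fixed.\<close>

definition vertical_shift :: "'n \<Rightarrow> 'n \<Rightarrow> real" where
  "vertical_shift k i = (\<Sum>j\<in>UNIV. ppart u $ j * partial k (\<lambda>z. J z $ j $ i) (xpart u)) + partial k (\<lambda>z. \<theta> z $ i) (xpart u)"

text \<open>Moving along the base at fixed \<open>y\<close> of the first chart also moves
  \<open>y\<close> of the second through the derivative of \<open>J\<close>. The inhomogeneous term
  in the law for \<Gamma> removes exactly this, so only the shift in \<open>p\<close>
  remains.\<close>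

lemma agree_horizontal:
  assumes F: "F \<in> local_functions Va" and F': "F' \<in> local_functions Vb" and eq: "agree F F'"
  shows "a.horizontal k F (to_a u) + (\<Sum>i\<in>UNIV. fps_const (vertical_shift k i) * eval_series (deriv_along Va (P i) F) (to_a u))
    = (\<Sum>j\<in>UNIV. fps_const (J (xpart u) $ j $ k) * b.horizontal j F' (to_b u))"
proof -
  define z where "z = xpart u"
  define y where "y = ypart u"
  have z: "z \<in> S" using base_point by (simp add: z_def)
  let ?Y = "\<lambda>j. eval_series (deriv_along Vb (Y j) F') (to_b u)"
  let ?X = "\<lambda>j. eval_series (deriv_along Vb (X j) F') (to_b u)"
  note simps = sum_coord partial_to_a partial_to_b if_distrib[of fps_const] sum_delta_mult
  have X: "eval_series (deriv_along Va (X k) F) (to_a u)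
      + (\<Sum>i\<in>UNIV. fps_const (vertical_shift k i) * eval_series (deriv_along Va (P i) F) (to_a u))
    = (\<Sum>j\<in>UNIV. fps_const (J z $ j $ k) * ?X j)
      + (\<Sum>j\<in>UNIV. fps_X * fps_const ((matrix_partial k J z *v y) $ j) * ?Y j)"
    using agree_derivative[OF F F' eq, of "X k"]
    by (simp add: simps vertical_shift_def z_def y_def mult_ac del: deriv_along.simps cong: if_cong)
  have fc: "(\<Sum>j\<in>UNIV. fps_const (f j) * fps_const (g j)) = fps_const (\<Sum>j\<in>UNIV. f j * g j)" for f g :: "'n \<Rightarrow> real"
    by (simp add: fps_const_sum)
  have "(\<Sum>j\<in>UNIV. fps_X * fps_const ((a.G k z *v y) $ j) * eval_series (deriv_along Va (Y j) F) (to_a u))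
      = (\<Sum>j\<in>UNIV. \<Sum>l\<in>UNIV. fps_X * (fps_const (J z $ l $ j) * fps_const ((a.G k z *v y) $ j)) * ?Y l)"
    unfolding agree_vertical(2)[OF F F' eq] z_def[symmetric] sum_distrib_left
    by (simp add: mult_ac del: deriv_along.simps flip: fps_const_mult)
  also have "\<dots> = (\<Sum>l\<in>UNIV. fps_X * (\<Sum>j\<in>UNIV. fps_const (J z $ l $ j) * fps_const ((a.G k z *v y) $ j)) * ?Y l)"
    by (subst sum.swap) (simp add: sum_distrib_left sum_distrib_right)
  also have "\<dots> = (\<Sum>l\<in>UNIV. fps_X * fps_const (((J z ** a.G k z) *v y) $ l) * ?Y l)"
    unfolding fc matrix_vector_mul_assoc[symmetric] matrix_vector_nth[of "J z"] ..
  also have "\<dots> = (\<Sum>l\<in>UNIV. fps_X * fps_const ((matrix_partial k J z *v y) $ l) * ?Y l)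
      + (\<Sum>l\<in>UNIV. fps_X * fps_const ((pullback_conn k z *v (J z *v y)) $ l) * ?Y l)"
    by (simp add: \<Gamma>_change[OF z] pullback_conn_def[symmetric] matrix_vector_simps matrix_vector_mul_assoc
        distrib_left distrib_right sum.distrib flip: fps_const_add)
  finally have 1: "a.horizontal k F (to_a u)
      + (\<Sum>i\<in>UNIV. fps_const (vertical_shift k i) * eval_series (deriv_along Va (P i) F) (to_a u))
    = (\<Sum>j\<in>UNIV. fps_const (J z $ j $ k) * ?X j)
      - (\<Sum>l\<in>UNIV. fps_X * fps_const ((pullback_conn k z *v (J z *v y)) $ l) * ?Y l)"
    using X by (simp add: a.horizontal_def to_a_def z_def y_def algebra_simps del: deriv_along.simps)
  have "(pullback_conn k z *v v) $ l = (\<Sum>p\<in>UNIV. J z $ p $ k * (b.G p (c z) *v v) $ l)" for v l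
    by (simp add: pullback_conn_def matrix_vector_nth sum_distrib_left sum_distrib_right mult_ac)
       (rule sum.swap)
  then have "(\<Sum>l\<in>UNIV. fps_X * fps_const ((pullback_conn k z *v (J z *v y)) $ l) * ?Y l)
      = (\<Sum>l\<in>UNIV. \<Sum>p\<in>UNIV. fps_const (J z $ p $ k) * (fps_X * fps_const ((b.G p (c z) *v (J z *v y)) $ l) * ?Y l))"
    by (simp add: fps_const_sum[symmetric] sum_distrib_left sum_distrib_right mult_ac flip: fps_const_mult)
  also have "\<dots> = (\<Sum>p\<in>UNIV. fps_const (J z $ p $ k) * (\<Sum>l\<in>UNIV. fps_X * fps_const ((b.G p (c z) *v (J z *v y)) $ l) * ?Y l))"
    by (subst sum.swap) (simp add: sum_distrib_left)
  finally show ?thesis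
    unfolding 1 b.horizontal_def right_diff_distrib sum_subtractf
    by (simp add: to_b_def z_def y_def)
qed

lemma eval_bracket_agree:
  assumes F: "F \<in> local_functions Va" and F': "F' \<in> local_functions Vb" and eqF: "agree F F'"
    and H: "H \<in> local_functions Va" and H': "H' \<in> local_functions Vb" and eqH: "agree H H'"
  shows "eval_series (a.lbr F H) (to_a u) = eval_series (b.lbr F' H') (to_b u)"
proof -
  let ?C = "\<lambda>k i. fps_const (vertical_shift k i)" and ?J = "\<lambda>j k. fps_const (J (xpart u) $ j $ k)"
  \<comment> \<open>The linear part is symmetric as a second derivative of \<open>c\<close>, the
    affine part because \<open>\<theta>\<close> is closed.\<close>
  have C: "?C i k = ?C k i" for i k
    using partial_J_commute[OF base_point, of i _ k] partial_\<theta>_commute[OF base_point, of i k]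
    by (simp add: vertical_shift_def)
  have w: "fps_const (matrix_inv (\<omega>b (xpart (to_b u))) $ p $ q)
      = (\<Sum>i\<in>UNIV. \<Sum>j\<in>UNIV. ?J p i * ?J q j * fps_const (matrix_inv (\<omega>a (xpart (to_a u))) $ i $ j))" for p q
  proof -
    have "matrix_inv (\<omega>b (xpart (to_b u))) $ p $ q =
        (\<Sum>j\<in>UNIV. \<Sum>i\<in>UNIV. J (xpart u) $ p $ i * J (xpart u) $ q $ j * matrix_inv (\<omega>a (xpart (to_a u))) $ i $ j)"
      using W_change[OF base_point]
      by (simp add: to_a_def to_b_def matrix_matrix_mult_def transpose_def sum_distrib_left sum_distrib_right mult_ac)
    then show ?thesis
      by (subst sum.swap) (simp add: fps_const_sum)
  qed
  have r: "fps_X\<^sup>2 * fps_const (1/2 * (ypart (to_a u) \<bullet> ((\<omega>a (xpart (to_a u)) ** a.R i j (xpart (to_a u))) *v ypart (to_a u))))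
      = (\<Sum>p\<in>UNIV. \<Sum>q\<in>UNIV. ?J p i * ?J q j *
        (fps_X\<^sup>2 * fps_const (1/2 * (ypart (to_b u) \<bullet> ((\<omega>b (xpart (to_b u)) ** b.R p q (xpart (to_b u))) *v ypart (to_b u))))))"
    for i j
  proof -
    let ?f = "\<lambda>p q. 1/2 * (ypart (to_b u) \<bullet> ((\<omega>b (xpart (to_b u)) ** b.R p q (xpart (to_b u))) *v ypart (to_b u)))"
    have "1/2 * (ypart (to_a u) \<bullet> ((\<omega>a (xpart (to_a u)) ** a.R i j (xpart (to_a u))) *v ypart (to_a u)))
      = (\<Sum>p\<in>UNIV. \<Sum>q\<in>UNIV. J (xpart u) $ p $ i * J (xpart u) $ q $ j * ?f p q)"
      using curvature_form_change[OF base_point, of "ypart u" i j]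
      by (simp add: to_a_def to_b_def sum_distrib_left sum_divide_distrib)
    then have "fps_X\<^sup>2 * fps_const (1/2 * (ypart (to_a u) \<bullet> ((\<omega>a (xpart (to_a u)) ** a.R i j (xpart (to_a u))) *v ypart (to_a u))))
      = fps_X\<^sup>2 * (\<Sum>p\<in>UNIV. \<Sum>q\<in>UNIV. ?J p i * ?J q j * fps_const (?f p q))"
      by (simp only: fps_const_sum[symmetric] fps_const_mult[symmetric])
    then show ?thesis
      by (simp only: sum_distrib_left mult_ac)
  qed
  show ?thesis
    unfolding a.eval_local_bracket_horizontal[OF to_a_in] b.eval_local_bracket_horizontal[OF to_b_in]
    by (rule horizontal_bracket_invariant[where C = ?C and J = ?J])
       (rule C agree_horizontal[OF F F' eqF] agree_horizontal[OF H H' eqH]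
         agree_vertical[OF F F' eqF] agree_vertical[OF H H' eqH] w r)+
qed

end

lemma agree_bracket:
  assumes "F \<in> local_functions Va" "F' \<in> local_functions Vb" "agree F F'"
    and "H \<in> local_functions Va" "H' \<in> local_functions Vb" "agree H H'"
  shows "agree (a.lbr F H) (b.lbr F' H')"
  using eval_bracket_agree[OF _ assms] by (simp add: agree_def)

lemma agree_add: "agree F F' \<Longrightarrow> agree H H' \<Longrightarrow> agree (F + H) (F' + H')"
  by (simp add: agree_def eval_series_add)

lemma agree_mult: "agree F F' \<Longrightarrow> agree H H' \<Longrightarrow> agree (F \<odot> H) (F' \<odot> H')"
  by (simp add: agree_def eval_series_mult)

lemma agree_scale: "agree F F' \<Longrightarrow> agree (series_scale r F) (series_scale r F')"
  by (simp add: agree_def eval_series_scale)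

end


section \<open>Gluing the brackets of the charts\<close>

theorem mainTheorem9:
  fixes M :: "'m topology"
    and A :: "'a set"
    and U :: "'a \<Rightarrow> 'm set"
    and x :: "'a \<Rightarrow> 'm \<Rightarrow> real^'n::finite"
    and \<omega> :: "'a \<Rightarrow> real^'n \<Rightarrow> real^'n^'n"
    and \<Gamma> :: "'a \<Rightarrow> 'n \<Rightarrow> 'n \<Rightarrow> 'n \<Rightarrow> real^'n \<Rightarrow> real"
    and \<rho> :: "'a \<Rightarrow> real^'n \<Rightarrow> real^'n"
  assumes "smooth_manifold M A U x"
    and "symplectic_form A U x \<omega>"
    and "symmetric_symplectic_connection A U x \<omega> \<Gamma>"
    and "symplectic_potentials A U x \<omega> \<rho>"
  shows
    "(\<forall>\<alpha>\<in>A.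
        let V = x \<alpha> ` U \<alpha>; br = local_bracket V (\<omega> \<alpha>) (\<Gamma> \<alpha>) in
          (\<forall>i j.
             br (x_fun V i) (p_fun V j) = base_fun V (\<lambda>z. if i = j then 1 else 0) \<and>
             br (y_fun V i) (y_fun V j) = base_fun V (\<lambda>z. matrix_inv (\<omega> \<alpha> z) $ i $ j) \<and>
             br (p_fun V i) (y_fun V j) = (\<Sum>l\<in>UNIV. base_fun V (\<Gamma> \<alpha> j i l) \<odot> y_fun V l) \<and>
             br (p_fun V i) (p_fun V j) =
               series_scale (1/2) (\<Sum>m\<in>UNIV. \<Sum>n\<in>UNIV.
                 base_fun V (curvature_low (\<omega> \<alpha>) (\<Gamma> \<alpha>) m n i j) \<odot> y_fun V m \<odot> y_fun V n) \<and>
             br (x_fun V i) (x_fun V j) = 0 \<and>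
             br (x_fun V i) (y_fun V j) = 0) \<and>
          poisson_bracket_on (local_functions V) series_scale (\<odot>) br) \<and>
     poisson_bracket_on (global_functions A U x \<rho>) global_scale global_mult
       (global_bracket A U x \<omega> \<Gamma>)"
proof -
  note M = assms(1)[unfolded smooth_manifold_def]
  note om = assms(2)[unfolded symplectic_form_def]
  note conn = assms(3)[unfolded symmetric_symplectic_connection_def affine_connection_def]
  note pot = assms(4)[unfolded symplectic_potentials_def]
  let ?V = "\<lambda>\<alpha>. x \<alpha> ` U \<alpha>" and ?br = "\<lambda>\<alpha>. local_bracket (x \<alpha> ` U \<alpha>) (\<omega> \<alpha>) (\<Gamma> \<alpha>)"
  have chart: "symplectic_chart (?V \<alpha>) (\<omega> \<alpha>) (\<Gamma> \<alpha>)" if \<alpha>: "\<alpha> \<in> A" for \<alpha>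
  proof
    show "open (?V \<alpha>)" using M \<alpha> by blast
    show "smooth_on (?V \<alpha>) (\<lambda>z. \<omega> \<alpha> z $ i $ j)" for i j using om \<alpha> by blast
    show "smooth_on (?V \<alpha>) (\<Gamma> \<alpha> k i j)" for k i j using conn \<alpha> by blast
    show "\<omega> \<alpha> z $ i $ j = - \<omega> \<alpha> z $ j $ i" if "z \<in> ?V \<alpha>" for z i j using om \<alpha> that by blast
    show "invertible (\<omega> \<alpha> z)" if "z \<in> ?V \<alpha>" for z using om \<alpha> that by blast
    show "partial i (\<lambda>z. \<omega> \<alpha> z $ j $ k) z - (\<Sum>l\<in>UNIV. \<Gamma> \<alpha> l i j z * \<omega> \<alpha> z $ l $ k)
        - (\<Sum>l\<in>UNIV. \<Gamma> \<alpha> l i k z * \<omega> \<alpha> z $ j $ l) = 0" if "z \<in> ?V \<alpha>" for z i j k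
      using conn \<alpha> that by blast
  qed
  have change: "symplectic_chart_change (?V \<alpha>) (?V \<beta>) (\<omega> \<alpha>) (\<Gamma> \<alpha>) (\<omega> \<beta>) (\<Gamma> \<beta>) (overlap U x \<alpha> \<beta>)
      (coord_change U x \<alpha> \<beta>) (\<lambda>z. \<chi> j i. jac U x \<alpha> \<beta> j i z) (\<rho> \<alpha>) (\<rho> \<beta>)"
    if \<alpha>: "\<alpha> \<in> A" and \<beta>: "\<beta> \<in> A" for \<alpha> \<beta>
  proof -
    let ?S = "overlap U x \<alpha> \<beta>" and ?c = "coord_change U x \<alpha> \<beta>"
    interpret a: symplectic_chart "?V \<alpha>" "\<omega> \<alpha>" "\<Gamma> \<alpha>" by (rule chart[OF \<alpha>])
    interpret b: symplectic_chart "?V \<beta>" "\<omega> \<beta>" "\<Gamma> \<beta>" by (rule chart[OF \<beta>])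
    have hom: "homeomorphic_map (subtopology M (U \<alpha>)) (top_of_set (?V \<alpha>)) (x \<alpha>)"
      and opn: "openin M (U \<alpha>)" "openin M (U \<beta>)"
      using M \<alpha> \<beta> by blast+
    have sub: "U \<alpha> \<subseteq> topspace M" using opn(1) by (rule openin_subset)
    have "openin (subtopology M (U \<alpha>)) (U \<alpha> \<inter> U \<beta>)"
      using opn(2) by (metis openin_subtopology_Int2)
    then have "openin (top_of_set (?V \<alpha>)) ?S"
      using homeomorphic_map_openness_eq[OF hom] unfolding overlap_def by blast
    then have open_S: "open ?S" using a.open_V openin_open_trans by blast
    \<comment> \<open>Injectivity makes \<open>inv_into\<close> in \<open>coord_change\<close>
      return the original point of the overlap, so its image lies in the second chart.\<close>
    have inj: "inj_on (x \<alpha>) (U \<alpha>)"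
      using homeomorphic_imp_injective_map[OF hom] sub by (simp add: Int_absorb1)
    have sm: "smooth_on ?S (\<lambda>z. ?c z $ j)" for j using M \<alpha> \<beta> by blast
    have tr_om: "\<omega> \<alpha> z $ i $ j = (\<Sum>k\<in>UNIV. \<Sum>l\<in>UNIV. \<omega> \<beta> (?c z) $ k $ l * jac U x \<alpha> \<beta> k i z * jac U x \<alpha> \<beta> l j z)"
      if "z \<in> ?S" for z i j using om \<alpha> \<beta> that by blast
    have tr_conn: "(\<Sum>k\<in>UNIV. \<Gamma> \<alpha> k i j z * jac U x \<alpha> \<beta> m k z) = partial i (jac U x \<alpha> \<beta> m j) z +
        (\<Sum>p\<in>UNIV. \<Sum>q\<in>UNIV. \<Gamma> \<beta> m p q (?c z) * jac U x \<alpha> \<beta> p i z * jac U x \<alpha> \<beta> q j z)"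
      if "z \<in> ?S" for z i j m using conn \<alpha> \<beta> that by blast
    show ?thesis
    proof
      show "open ?S" by (rule open_S)
      show "?S \<subseteq> ?V \<alpha>" by (auto simp: overlap_def)
      show "?c z \<in> ?V \<beta>" if "z \<in> ?S" for z
        using that inj by (auto simp: overlap_def coord_change_def)
      show "smooth_on ?S (\<lambda>z. ?c z $ j)" for j by (rule sm)
      show "(\<chi> j i. jac U x \<alpha> \<beta> j i z) $ j $ i = partial i (\<lambda>z. ?c z $ j) z" for z i j
        by (simp add: jac_def)
      show "\<omega> \<alpha> z = transpose (\<chi> j i. jac U x \<alpha> \<beta> j i z) ** \<omega> \<beta> (?c z) ** (\<chi> j i. jac U x \<alpha> \<beta> j i z)"
        if "z \<in> ?S" for z
      proof -
        have "(\<Sum>k\<in>UNIV. \<Sum>l\<in>UNIV. \<omega> \<beta> (?c z) $ k $ l * jac U x \<alpha> \<beta> k i z * jac U x \<alpha> \<beta> l j z) =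
          (\<Sum>l\<in>UNIV. \<Sum>k\<in>UNIV. jac U x \<alpha> \<beta> k i z * \<omega> \<beta> (?c z) $ k $ l * jac U x \<alpha> \<beta> l j z)" for i j
          by (subst sum.swap) (simp add: mult_ac)
        then show ?thesis
          by (simp add: vec_eq_iff tr_om[OF that] matrix_matrix_mult_def transpose_def sum_distrib_right)
      qed
      show "(\<chi> j i. jac U x \<alpha> \<beta> j i z) ** conn_matrix (\<Gamma> \<alpha>) i z =
          matrix_partial i (\<lambda>z. \<chi> j i. jac U x \<alpha> \<beta> j i z) z
          + (\<Sum>p\<in>UNIV. (\<chi> j i. jac U x \<alpha> \<beta> j i z) $ p $ i *\<^sub>R conn_matrix (\<Gamma> \<beta>) p (?c z)) ** (\<chi> j i. jac U x \<alpha> \<beta> j i z)"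
        if "z \<in> ?S" for z i
      proof -
        have "(\<Sum>p\<in>UNIV. \<Sum>q\<in>UNIV. \<Gamma> \<beta> m p q (?c z) * jac U x \<alpha> \<beta> p i z * jac U x \<alpha> \<beta> q j z) =
          (\<Sum>q\<in>UNIV. (\<Sum>p\<in>UNIV. jac U x \<alpha> \<beta> p i z * \<Gamma> \<beta> m p q (?c z)) * jac U x \<alpha> \<beta> q j z)" for m j
          by (subst sum.swap) (simp add: sum_distrib_right sum_distrib_left mult_ac)
        then show ?thesis
          using tr_conn[OF that, of i]
          by (simp add: vec_eq_iff matrix_matrix_mult_def matrix_partial_def conn_matrix_def mult.commute)
      qed
      show "smooth_on (?V \<alpha>) (\<lambda>z. \<rho> \<alpha> z $ i)" "smooth_on (?V \<beta>) (\<lambda>z. \<rho> \<beta> z $ i)" for i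
        using pot \<alpha> \<beta> by blast+
      show "\<omega> \<alpha> z $ i $ j = partial i (\<lambda>z. \<rho> \<alpha> z $ j) z - partial j (\<lambda>z. \<rho> \<alpha> z $ i) z"
        if "z \<in> ?V \<alpha>" for z i j using pot \<alpha> that by blast
      show "\<omega> \<beta> z $ i $ j = partial i (\<lambda>z. \<rho> \<beta> z $ j) z - partial j (\<lambda>z. \<rho> \<beta> z $ i) z"
        if "z \<in> ?V \<beta>" for z i j using pot \<beta> that by blast
    qed
  qed
  define ag where "ag \<alpha> \<beta> = symplectic_chart_change.agree (overlap U x \<alpha> \<beta>) (coord_change U x \<alpha> \<beta>)
    (\<lambda>z. \<chi> j i. jac U x \<alpha> \<beta> j i z) (\<rho> \<alpha>) (\<rho> \<beta>)" for \<alpha> \<beta>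
  \<comment> \<open>A point with mixed coordinates carries exactly the arguments of the gluing
    condition, and power series are equal iff they agree in every degree \<open>d\<close>.\<close>
  have glue: "(\<forall>z\<in>overlap U x \<alpha> \<beta>. \<forall>p\<^sub>\<beta> y\<^sub>\<alpha> d.
            homogeneous_part F d z (p_change U x \<rho> \<alpha> \<beta> z p\<^sub>\<beta>) y\<^sub>\<alpha> =
            homogeneous_part F' d (coord_change U x \<alpha> \<beta> z) p\<^sub>\<beta> (y_change U x \<alpha> \<beta> z y\<^sub>\<alpha>)) \<longleftrightarrow> ag \<alpha> \<beta> F F'"
    (is "?l \<longleftrightarrow> ?r") if \<alpha>: "\<alpha> \<in> A" and \<beta>: "\<beta> \<in> A" for \<alpha> \<beta> F F'
  proof -
    interpret symplectic_chart_change "?V \<alpha>" "?V \<beta>" "\<omega> \<alpha>" "\<Gamma> \<alpha>" "\<omega> \<beta>" "\<Gamma> \<beta>" "overlap U x \<alpha> \<beta>"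
      "coord_change U x \<alpha> \<beta>" "\<lambda>z. \<chi> j i. jac U x \<alpha> \<beta> j i z" "\<rho> \<alpha>" "\<rho> \<beta>"
      by (rule change[OF \<alpha> \<beta>])
    have a: "to_a u = point (xpart u) (p_change U x \<rho> \<alpha> \<beta> (xpart u) (ppart u)) (ypart u)"
      and b: "to_b u = point (coord_change U x \<alpha> \<beta> (xpart u)) (ppart u) (y_change U x \<alpha> \<beta> (xpart u) (ypart u))" for u
      by (simp_all add: to_a_def to_b_def p_change_def y_change_def potential_diff_def \<theta>_def matrix_vector_mult_def)
    show ?thesis
    proof
      assume ?l
      then show ?r
        by (auto simp: ag_def agree_def fps_eq_iff eval_series_nth a b total_over_def)
    next
      assume ?r
      show ?l
      proof (intro ballI allI)
        fix z p y d
        assume "z \<in> overlap U x \<alpha> \<beta>"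
        then have "eval_series F (to_a (point z p y)) = eval_series F' (to_b (point z p y))"
          using \<open>?r\<close> by (simp add: ag_def agree_def total_over_def)
        from arg_cong[OF this, of "\<lambda>f. fps_nth f d"]
        show "homogeneous_part F d z (p_change U x \<rho> \<alpha> \<beta> z p) y =
            homogeneous_part F' d (coord_change U x \<alpha> \<beta> z) p (y_change U x \<alpha> \<beta> z y)"
          by (simp add: eval_series_nth a b)
      qed
    qed
  qed
  let ?C = "global_functions A U x \<rho>"
  have C: "F \<in> ?C \<longleftrightarrow> (\<forall>\<alpha>\<in>A. F \<alpha> \<in> local_functions (?V \<alpha>)) \<and> (\<forall>\<alpha>. \<alpha> \<notin> A \<longrightarrow> F \<alpha> = 0) \<and>
      (\<forall>\<alpha>\<in>A. \<forall>\<beta>\<in>A. ag \<alpha> \<beta> (F \<alpha>) (F \<beta>))" for F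
    unfolding global_functions_def using glue by simp
  \<comment> \<open>Functions vanish at indices outside \<open>A\<close>, so the identities have to
    hold for zero there too; evaluation turns the Cauchy product into a ring product.\<close>
  have mult_0: "(0::'n series) \<odot> G = 0" for G
    by (rule eval_series_inject) (simp only: eval_series_mult eval_series_0 mult_zero_left)
  have scale_0: "series_scale r (0::'n series) = 0" for r
    by (rule eval_series_inject) (simp only: eval_series_scale eval_series_0 mult_zero_right)
  have ag_add: "ag \<alpha> \<beta> (F + H) (F' + H')" and ag_mult: "ag \<alpha> \<beta> (F \<odot> H) (F' \<odot> H')"
    and ag_scale: "ag \<alpha> \<beta> (series_scale r F) (series_scale r F')"
    if "\<alpha> \<in> A" "\<beta> \<in> A" "ag \<alpha> \<beta> F F'" "ag \<alpha> \<beta> H H'" for \<alpha> \<beta> F F' H H' r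
    using that symplectic_chart_change.agree_add[OF change] symplectic_chart_change.agree_mult[OF change]
      symplectic_chart_change.agree_scale[OF change] unfolding ag_def by blast+
  have ag_bracket: "ag \<alpha> \<beta> (?br \<alpha> F H) (?br \<beta> F' H')"
    if "\<alpha> \<in> A" "\<beta> \<in> A" "F \<in> local_functions (?V \<alpha>)" "F' \<in> local_functions (?V \<beta>)" "ag \<alpha> \<beta> F F'"
      "H \<in> local_functions (?V \<alpha>)" "H' \<in> local_functions (?V \<beta>)" "ag \<alpha> \<beta> H H'" for \<alpha> \<beta> F F' H H'
    using that(3-) unfolding ag_def by (rule symplectic_chart_change.agree_bracket[OF change[OF that(1,2)]])
  let ?gb = "global_bracket A U x \<omega> \<Gamma>"
  note closed = symplectic_chart.local_closed[OF chart]
  have br_in: "?gb f g \<alpha> = ?br \<alpha> (f \<alpha>) (g \<alpha>)" if "\<alpha> \<in> A" for f g \<alpha>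
    using that by (simp only: global_bracket_def if_True)
  have br_out: "?gb f g \<alpha> = 0" if "\<alpha> \<notin> A" for f g \<alpha>
    using that by (simp only: global_bracket_def if_False)
  have loc: "f \<alpha> \<in> local_functions (?V \<alpha>)" if "f \<in> ?C" "\<alpha> \<in> A" for f \<alpha>
    using that unfolding C by blast
  have off: "f \<alpha> = 0" if "f \<in> ?C" "\<alpha> \<notin> A" for f \<alpha>
    using that unfolding C by blast
  have agr: "ag \<alpha> \<beta> (f \<alpha>) (f \<beta>)" if "f \<in> ?C" "\<alpha> \<in> A" "\<beta> \<in> A" for f \<alpha> \<beta>
    using that unfolding C by blast
  have CI: "f \<in> ?C" if "\<And>\<alpha>. \<alpha> \<in> A \<Longrightarrow> f \<alpha> \<in> local_functions (?V \<alpha>)" "\<And>\<alpha>. \<alpha> \<notin> A \<Longrightarrow> f \<alpha> = 0"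
    "\<And>\<alpha> \<beta>. \<alpha> \<in> A \<Longrightarrow> \<beta> \<in> A \<Longrightarrow> ag \<alpha> \<beta> (f \<alpha>) (f \<beta>)" for f
    using that unfolding C by blast
  \<comment> \<open>The identities hold in each chart separately; agreement between charts enters
    only in the closure of \<open>?C\<close>.\<close>
  have global: "poisson_bracket_on ?C global_scale global_mult ?gb"
    unfolding poisson_bracket_on_def
  proof (intro conjI ballI allI)
    fix f g assume f: "f \<in> ?C" and g: "g \<in> ?C"
    show "f + g \<in> ?C"
    proof (rule CI)
      fix \<alpha> \<beta>
      show "(f + g) \<alpha> = 0" if "\<alpha> \<notin> A"
        by (simp only: plus_fun_apply[of f g] off[OF f that] off[OF g that] add_0_left)
      assume \<alpha>: "\<alpha> \<in> A"
      show "(f + g) \<alpha> \<in> local_functions (?V \<alpha>)"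
        unfolding plus_fun_apply[of f g] by (rule closed(1)[OF \<alpha> loc[OF f \<alpha>] loc[OF g \<alpha>]])
      assume \<beta>: "\<beta> \<in> A"
      show "ag \<alpha> \<beta> ((f + g) \<alpha>) ((f + g) \<beta>)"
        unfolding plus_fun_apply[of f g] by (rule ag_add[OF \<alpha> \<beta> agr[OF f \<alpha> \<beta>] agr[OF g \<alpha> \<beta>]])
    qed
    show "global_mult f g \<in> ?C"
    proof (rule CI)
      fix \<alpha> \<beta>
      show "global_mult f g \<alpha> = 0" if "\<alpha> \<notin> A"
        by (simp only: global_mult_def off[OF f that] mult_0)
      assume \<alpha>: "\<alpha> \<in> A"
      show "global_mult f g \<alpha> \<in> local_functions (?V \<alpha>)"
        unfolding global_mult_def by (rule closed(2)[OF \<alpha> loc[OF f \<alpha>] loc[OF g \<alpha>]])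
      assume \<beta>: "\<beta> \<in> A"
      show "ag \<alpha> \<beta> (global_mult f g \<alpha>) (global_mult f g \<beta>)"
        unfolding global_mult_def by (rule ag_mult[OF \<alpha> \<beta> agr[OF f \<alpha> \<beta>] agr[OF g \<alpha> \<beta>]])
    qed
    show "?gb f g \<in> ?C"
    proof (rule CI)
      fix \<alpha> \<beta>
      show "?gb f g \<alpha> = 0" if "\<alpha> \<notin> A" by (rule br_out[OF that])
      assume \<alpha>: "\<alpha> \<in> A"
      show "?gb f g \<alpha> \<in> local_functions (?V \<alpha>)"
        unfolding br_in[OF \<alpha>] by (rule closed(3)[OF \<alpha> loc[OF f \<alpha>] loc[OF g \<alpha>]])
      assume \<beta>: "\<beta> \<in> A"
      show "ag \<alpha> \<beta> (?gb f g \<alpha>) (?gb f g \<beta>)"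
        unfolding br_in[OF \<alpha>] br_in[OF \<beta>] 
          by (rule ag_bracket[OF \<alpha> \<beta> loc[OF f \<alpha>] loc[OF f \<beta>] agr[OF f \<alpha> \<beta>]
              loc[OF g \<alpha>] loc[OF g \<beta>] agr[OF g \<alpha> \<beta>]])
    qed
    show "?gb f g = - ?gb g f"
    proof
      fix \<alpha>
      show "?gb f g \<alpha> = (- ?gb g f) \<alpha>"
        using symplectic_chart.local_bracket_skew[OF chart loc[OF f] loc[OF g], of \<alpha>]
        by (cases "\<alpha> \<in> A") (simp_all only: simp_thms uminus_apply br_in br_out minus_zero)
    qed
  next
    fix c f assume f: "f \<in> ?C"
    show "global_scale c f \<in> ?C"
    proof (rule CI)
      fix \<alpha> \<beta>
      show "global_scale c f \<alpha> = 0" if "\<alpha> \<notin> A"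
        by (simp only: global_scale_def off[OF f that] scale_0)
      assume \<alpha>: "\<alpha> \<in> A"
      show "global_scale c f \<alpha> \<in> local_functions (?V \<alpha>)"
        unfolding global_scale_def by (rule closed(5)[OF \<alpha> loc[OF f \<alpha>]])
      assume \<beta>: "\<beta> \<in> A"
      show "ag \<alpha> \<beta> (global_scale c f \<alpha>) (global_scale c f \<beta>)"
        unfolding global_scale_def by (rule ag_scale[OF \<alpha> \<beta> agr[OF f \<alpha> \<beta>] agr[OF f \<alpha> \<beta>]])
    qed
    fix g assume g: "g \<in> ?C"
    show "?gb (global_scale c f) g = global_scale c (?gb f g)"
    proof
      fix \<alpha>
      show "?gb (global_scale c f) g \<alpha> = global_scale c (?gb f g) \<alpha>"
        using symplectic_chart.local_bracket_scale[OF chart loc[OF f] loc[OF g], of \<alpha>]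
        by (cases "\<alpha> \<in> A") (simp_all only: simp_thms global_scale_def br_in br_out scale_0)
    qed
  next
    fix f g h assume f: "f \<in> ?C" and g: "g \<in> ?C" and h: "h \<in> ?C"
    show "?gb (f + g) h = ?gb f h + ?gb g h"
    proof
      fix \<alpha>
      show "?gb (f + g) h \<alpha> = (?gb f h + ?gb g h) \<alpha>"
        using symplectic_chart.local_bracket_add[OF chart loc[OF f] loc[OF g] loc[OF h], of \<alpha>]
        by (cases "\<alpha> \<in> A") (simp_all only: simp_thms plus_fun_apply br_in br_out add_0_left)
    qed
    show "?gb (global_mult f g) h = global_mult f (?gb g h) + global_mult (?gb f h) g"
    proof
      fix \<alpha>
      show "?gb (global_mult f g) h \<alpha> = (global_mult f (?gb g h) + global_mult (?gb f h) g) \<alpha>"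
        using symplectic_chart.local_bracket_mult[OF chart loc[OF f] loc[OF g] loc[OF h], of \<alpha>] off[OF f, of \<alpha>]
        by (cases "\<alpha> \<in> A") (simp_all only: simp_thms plus_fun_apply global_mult_def br_in br_out mult_0 add_0_left)
    qed
    show "?gb f (?gb g h) + ?gb g (?gb h f) + ?gb h (?gb f g) = 0"
    proof
      fix \<alpha>
      show "(?gb f (?gb g h) + ?gb g (?gb h f) + ?gb h (?gb f g)) \<alpha> = 0 \<alpha>"
        using symplectic_chart.local_bracket_jacobi[OF chart loc[OF f] loc[OF g] loc[OF h], of \<alpha>]
        by (cases "\<alpha> \<in> A") (simp_all only: simp_thms plus_fun_apply zero_fun_apply br_in br_out add_0_left)
    qed
  qed
  show ?thesis
  proof (intro conjI ballI)
    fix \<alpha> assume \<alpha>: "\<alpha> \<in> A"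
    interpret symplectic_chart "?V \<alpha>" "\<omega> \<alpha>" "\<Gamma> \<alpha>" by (rule chart[OF \<alpha>])
    show "let V = ?V \<alpha>; br = local_bracket V (\<omega> \<alpha>) (\<Gamma> \<alpha>) in
          (\<forall>i j.
             br (x_fun V i) (p_fun V j) = base_fun V (\<lambda>z. if i = j then 1 else 0) \<and>
             br (y_fun V i) (y_fun V j) = base_fun V (\<lambda>z. matrix_inv (\<omega> \<alpha> z) $ i $ j) \<and>
             br (p_fun V i) (y_fun V j) = (\<Sum>l\<in>UNIV. base_fun V (\<Gamma> \<alpha> j i l) \<odot> y_fun V l) \<and>
             br (p_fun V i) (p_fun V j) =
               series_scale (1/2) (\<Sum>m\<in>UNIV. \<Sum>n\<in>UNIV.
                 base_fun V (curvature_low (\<omega> \<alpha>) (\<Gamma> \<alpha>) m n i j) \<odot> y_fun V m \<odot> y_fun V n) \<and>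
             br (x_fun V i) (x_fun V j) = 0 \<and>
             br (x_fun V i) (y_fun V j) = 0) \<and>
          poisson_bracket_on (local_functions V) series_scale (\<odot>) br"
      unfolding Let_def local_bracket_coordinates coord_bracket.simps
      using local_poisson_bracket by blast
  next
    show "poisson_bracket_on ?C global_scale global_mult (global_bracket A U x \<omega> \<Gamma>)" by (rule global)
  qed
qed

end
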